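(* Let $d\ge3$. There are positive finite constants $C_0,C_1,C_2,C_3$ and $\eta>0$ such that for all $n$, every admissible graph $G$ on a vertex set $V\subset\{1,\dots,q\}$, and all $2<p<\infty$, $$\rho^{|V|}\,\bigl\|\operatorname{SumProd}(X(G))\bigr\|_{L^p([0,1]^d)}\ \le\ \bigl[C_0\,|V|^{C_1}\,p^{C_2}\,q^{C_3}\,n^{-\eta}\bigr]^{|V|}.$$
   Context: Haar functions: for a dyadic interval $I$, $h_I=-\mathbf 1_{I_{\rm left}}+\mathbf 1_{I_{\rm right}}$; for a dyadic rectangle $R=R_1\times\cdots\times R_d\subset[0,1]^d$, $h_R(x)=\prod_jh_{R_j}(x_j)$. $\mathbb H_n$ is the set of $\vec r\in\mathbb Z_{\ge0}^d$ with $\sum_jr_j=n$; $\mathcal R_{\vec r}$ is the set of dyadic rectangles $R\subset[0,1]^d$ with $|R_j|=2^{-r_j}$ for all $j$. Given arbitrary real coefficients $\alpha(R)$, $f_{\vec r}=\sum_{R\in\mathcal R_{\vec r}}\operatorname{sgn}(\alpha(R))h_R$, with $\operatorname{sgn}\in\{\pm1\}$ ($\operatorname{sgn}(0)=1$); constants do not depend on $\alpha$. Parameters: $q=\lfloor an^{\varepsilon}\rfloor\ge1$ with fixed small $0<\varepsilon<1$ and fixed small $a>0$; $\rho=\sqrt q\,n^{-(d-1)/2}$. $\{1,\dots,n\}$ is divided into $q$ disjoint consecutive intervals $I_1,\dots,I_q$ of equal length (up to rounding), in increasing order; $\mathbb A_v=\{\vec r\in\mathbb H_n:r_1\in I_v\}$.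 Graphs: a $(d-1)$-colored graph is a tuple $G=(V,E_2,\dots,E_d)$ with $V=V(G)\subset\{1,\dots,q\}$ and symmetric edge sets $E_j\subset V\times V\setminus\{(k,k):k\in V\}$ of color $j$, $2\le j\le d$. A clique of color $j$ is a maximal subset $Q\subset V$ (with at least two elements) such that $(v,v')\in E_j$ for all $v\ne v'$ in $Q$. $G$ is admissible if: (i) in each color the edge set decomposes into a union of (pairwise disjoint) cliques, i.e. being equal or joined by an edge of color $j$ is an equivalence relation on $V$; (ii) if $Q_k$ is a clique of color $k$ for $k=2,\dots,d$, then $\bigcap_{k=2}^dQ_k$ contains at most one vertex; (iii) every vertex is in at least one clique. $X(G)$ is the set of tuples $(\vec r_v)_{v\in V}\in\prod_{v\in V}\mathbb A_v$ such that $r_{v,j}=r_{v',j}$ whenever $(v,v')$ is an edge of color $j$. $\operatorname{SumProd}(X(G))=\sum_{(\vec r_v)\in X(G)}\prod_{v\in V}f_{\vec r_v}$. *)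

theory Defs
  imports "HOL-Analysis.Analysis"
begin

text \<open>
  Points of \<open>\<real>\<^sup>d\<close>, multi-indices and rectangles are functions on the coordinate set
  \<open>{1..d}\<close>, extensional (\<open>undefined\<close>) outside of it, so that \<open>d\<close> is an ordinary natural number
  and coordinate 1 is distinguished from the coordinates (colors) \<open>2, \<dots>, d\<close>.
\<close>

text \<open>Dyadic intervals of length \<open>2\<^sup>-\<^sup>m\<close> contained in \<open>[0,1]\<close>, taken half-open.\<close>

definition dyadic_intervals :: "nat \<Rightarrow> real set set" where
  "dyadic_intervals m = {{real k / 2 ^ m ..< (real k + 1) / 2 ^ m} | k. k < 2 ^ m}"

definition left_half :: "real set \<Rightarrow> real set" where
  "left_half I = {x \<in> I. x < (Inf I + Sup I) / 2}"

definition right_half :: "real set \<Rightarrow> real set" where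
  "right_half I = {x \<in> I. (Inf I + Sup I) / 2 \<le> x}"

definition haar :: "real set \<Rightarrow> real \<Rightarrow> real" where
  "haar I x = - indicator (left_half I) x + indicator (right_half I) x"

text \<open>The rectangle \<open>R\<^sub>1 \<times> \<dots> \<times> R\<^sub>d\<close> is represented by its tuple of sides.\<close>

definition dyadic_rects :: "nat \<Rightarrow> (nat \<Rightarrow> nat) \<Rightarrow> (nat \<Rightarrow> real set) set" where
  "dyadic_rects d r = (\<Pi>\<^sub>E j\<in>{1..d}. dyadic_intervals (r j))"

definition haar_rect :: "nat \<Rightarrow> (nat \<Rightarrow> real set) \<Rightarrow> (nat \<Rightarrow> real) \<Rightarrow> real" where
  "haar_rect d R x = (\<Prod>j\<in>{1..d}. haar (R j) (x j))"

text \<open>Unlike the library's \<^const>\<open>sgn\<close>, the sign of \<open>0\<close> is \<open>1\<close> here.\<close>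

definition sign1 :: "real \<Rightarrow> real" where
  "sign1 t = (if t < 0 then - 1 else 1)"

definition f_layer ::
    "nat \<Rightarrow> ((nat \<Rightarrow> real set) \<Rightarrow> real) \<Rightarrow> (nat \<Rightarrow> nat) \<Rightarrow> (nat \<Rightarrow> real) \<Rightarrow> real" where
  "f_layer d \<alpha> r x = (\<Sum>R\<in>dyadic_rects d r. sign1 (\<alpha> R) * haar_rect d R x)"

definition hyperbolic_set :: "nat \<Rightarrow> nat \<Rightarrow> (nat \<Rightarrow> nat) set" where
  "hyperbolic_set d n = {r \<in> {1..d} \<rightarrow>\<^sub>E UNIV. (\<Sum>j\<in>{1..d}. r j) = n}"

definition q_param :: "real \<Rightarrow> real \<Rightarrow> nat \<Rightarrow> nat" where
  "q_param a \<epsilon> n = nat \<lfloor>a * real n powr \<epsilon>\<rfloor>"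

definition rho :: "nat \<Rightarrow> nat \<Rightarrow> nat \<Rightarrow> real" where
  "rho d n q = sqrt (real q) * real n powr (- (real d - 1) / 2)"

text \<open>
  \<open>{1..n}\<close> is divided into \<open>q\<close> blocks \<open>I 1, \<dots>, I q\<close> in increasing order, with lengths
  differing by at most one. Order and covering together force each block to be an interval
  (possibly empty, if \<open>q > n\<close>).
\<close>

definition equal_division :: "nat \<Rightarrow> nat \<Rightarrow> (nat \<Rightarrow> nat set) \<Rightarrow> bool" where
  "equal_division n q I \<longleftrightarrow>
     (\<Union>v\<in>{1..q}. I v) = {1..n} \<and>
     (\<forall>v\<in>{1..q}. \<forall>w\<in>{1..q}. v < w \<longrightarrow> (\<forall>s\<in>I v. \<forall>t\<in>I w. s < t)) \<and>
     (\<forall>v\<in>{1..q}. \<forall>w\<in>{1..q}. card (I v) \<le> card (I w) + 1)"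

definition A_block :: "nat \<Rightarrow> nat \<Rightarrow> (nat \<Rightarrow> nat set) \<Rightarrow> nat \<Rightarrow> (nat \<Rightarrow> nat) set" where
  "A_block d n I v = {r \<in> hyperbolic_set d n. r 1 \<in> I v}"

text \<open>Only the edge sets of the colors \<open>2, \<dots>, d\<close> are relevant.\<close>

record colored_graph =
  verts :: "nat set"
  edges :: "nat \<Rightarrow> (nat \<times> nat) set"

definition is_colored_graph :: "nat \<Rightarrow> nat \<Rightarrow> colored_graph \<Rightarrow> bool" where
  "is_colored_graph d q G \<longleftrightarrow>
     verts G \<subseteq> {1..q} \<and>
     (\<forall>j\<in>{2..d}. edges G j \<subseteq> verts G \<times> verts G - Id \<and> sym (edges G j))"

definition pairwise_joined :: "colored_graph \<Rightarrow> nat \<Rightarrow> nat set \<Rightarrow> bool" where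
  "pairwise_joined G j Q \<longleftrightarrow>
     Q \<subseteq> verts G \<and> (\<forall>v\<in>Q. \<forall>w\<in>Q. v \<noteq> w \<longrightarrow> (v, w) \<in> edges G j)"

definition clique :: "colored_graph \<Rightarrow> nat \<Rightarrow> nat set \<Rightarrow> bool" where
  "clique G j Q \<longleftrightarrow>
     2 \<le> card Q \<and> pairwise_joined G j Q \<and>
     (\<forall>Q'. pairwise_joined G j Q' \<and> Q \<subseteq> Q' \<longrightarrow> Q' = Q)"

definition admissible :: "nat \<Rightarrow> nat \<Rightarrow> colored_graph \<Rightarrow> bool" where
  "admissible d q G \<longleftrightarrow>
     is_colored_graph d q G \<and>
     (\<forall>j\<in>{2..d}. equiv (verts G) (Id_on (verts G) \<union> edges G j)) \<and>
     (\<forall>Q. (\<forall>k\<in>{2..d}. clique G k (Q k)) \<longrightarrow> card (\<Inter>k\<in>{2..d}. Q k) \<le> 1) \<and>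
     (\<forall>v\<in>verts G. \<exists>j\<in>{2..d}. \<exists>Q. clique G j Q \<and> v \<in> Q)"

definition X_set ::
    "nat \<Rightarrow> nat \<Rightarrow> (nat \<Rightarrow> nat set) \<Rightarrow> colored_graph \<Rightarrow> (nat \<Rightarrow> nat \<Rightarrow> nat) set" where
  "X_set d n I G =
     {r \<in> (\<Pi>\<^sub>E v\<in>verts G. A_block d n I v).
        \<forall>j\<in>{2..d}. \<forall>(v, w)\<in>edges G j. r v j = r w j}"

definition SumProd ::
    "nat \<Rightarrow> ((nat \<Rightarrow> real set) \<Rightarrow> real) \<Rightarrow> nat set \<Rightarrow> (nat \<Rightarrow> nat \<Rightarrow> nat) set \<Rightarrow>
     (nat \<Rightarrow> real) \<Rightarrow> real" where
  "SumProd d \<alpha> V X x = (\<Sum>r\<in>X. \<Prod>v\<in>V. f_layer d \<alpha> (r v) x)"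

definition Lp_norm_cube :: "nat \<Rightarrow> real \<Rightarrow> ((nat \<Rightarrow> real) \<Rightarrow> real) \<Rightarrow> real" where
  "Lp_norm_cube d p F =
     (set_lebesgue_integral (\<Pi>\<^sub>M j\<in>{1..d}. lborel) ({1..d} \<rightarrow>\<^sub>E {0..1})
        (\<lambda>x. \<bar>F x\<bar> powr p)) powr (1 / p)"

end

theory Submission
  imports Defs
begin

text \<open>
  The Beck gain comes from pairs. Fix the common values of the cliques: a clique \<open>Q\<close> costs a
  factor \<open>n\<close>, while the constraint saves \<open>n\<^bsup>1/2\<^esup>\<close> in the square function estimate of each of its
  vertices, so that cliques with at least three vertices already gain. Cliques with exactly two
  vertices break even; a maximal matching \<open>P\<close> of disjoint ones is treated separately. Once all
  other clique values are fixed, the sum factors over the pairs in \<open>P\<close> and the unmatched vertices,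
  and Hoelder's inequality (at the cost of \<open>p \<mapsto> p |V|\<close>) reduces to a single pair
  \<open>\<Sum>\<^sub>b F\<^sub>b G\<^sub>b\<close> with shared value \<open>b\<close>. As the first coordinates are ordered, the square function
  in \<open>x\<^sub>1\<close> applies to \<open>F\<close>; expanding the square leaves \<open>\<Sum>\<^sub>t F\<^bsub>b,t\<^esub> F\<^bsub>b',t\<^esub>\<close> with \<open>b \<noteq> b'\<close>, again a
  sum over one shared value, now of two families with different total degree. Induction on the
  number of free coordinates bounds it, since with none left the two degrees cannot match.

  All functions depend on finitely many binary digits, so the cube is replaced by a finite grid
  on which the digits are flipped by involutions, and it suffices to treat even \<open>p\<close>.
\<close>

text \<open>Power counting: with all clique values fixed, a vertex in \<open>k\<close> cliques has
  \<open>d - k\<close> free coordinates and one degree constraint, so its factor has size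
  \<open>n\<close> to the power \<open>(d - k - 1) / 2\<close>. Summing over the clique values, each
  clique \<open>Q\<close> shifts the total exponent \<open>|V| (d - 1) / 2\<close> by
  \<open>1 - |Q| / 2\<close>, which is zero exactly for pairs.

  The obstacle for a pair is that the two factors have equal level in the shared coordinate, so
  their product is even there and no square function applies. It has to be run in coordinate 1, the
  only one with a known order. There the second factor depends on the level through a truncation; a
  Stein-type inequality removes it, and only then does the expanded square separate into a
  coincidence sum times a harmless factor.

  Each such square root halves the gain in the exponent, so that after at most \<open>d\<close>
  coordinates a pair still gains \<open>(1/2) ^ d / 2\<close>. A maximal matching has at least
  \<open>|V| / (4 * d)\<close> pairs, up to what the larger cliques pay for; this gives
  \<open>\<eta> = (1/2) ^ d / (8 * d)\<close>. The square functions cost powers of the exponent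
  only, hence the polynomial dependence on \<open>p\<close> and \<open>|V|\<close>.\<close>

section \<open>Elementary inequalities for powers\<close>

text \<open>One step of Burkholder's inequality: \<open>x\<close> is the martingale so far and
  \<open>y\<close> the next increment, with symmetric sign. Only even powers of \<open>y\<close>
  survive in the binomial expansion, and beyond the constant term the coefficients are at most
  \<open>m * (2*m - 1)\<close> times those for the exponent \<open>2*(m-1)\<close>, shifted by
  two.\<close>

lemma square_function_step:
  fixes x y :: real
  assumes "1 \<le> m"
  shows "(x + y) ^ (2*m) + (x - y) ^ (2*m)
     \<le> 2 * x ^ (2*m) + real (m * (2*m - 1)) * y\<^sup>2 * ((x + y) ^ (2*(m-1)) + (x - y) ^ (2*(m-1)))"
proof -
  obtain k where m: "m = Suc k" using assms by (cases m) auto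
  define N where "N = 2 * k"
  have even_sum: "(x + y) ^ M + (x - y) ^ M = (\<Sum>i\<le>M. real (M choose i) * (1 + (-1)^i) * (x^(M-i) * y^i))" for M
  proof -
    have "(y + x) ^ M + (- y + x) ^ M =
       (\<Sum>i\<le>M. real (M choose i) * y^i * x^(M-i)) + (\<Sum>i\<le>M. real (M choose i) * (-y)^i * x^(M-i))"
      by (subst (1 2) binomial_ring) simp
    also have "\<dots> = (\<Sum>i\<le>M. real (M choose i) * (1 + (-1)^i) * (x^(M-i) * y^i))"
      unfolding sum.distrib[symmetric]
      by (intro sum.cong refl) (simp add: algebra_simps power_minus[of y])
    finally show ?thesis by (simp add: algebra_simps)
  qed
  \<comment> \<open>The two coefficients have quotient
    \<open>2*m * (2*m - 1) / ((i + 1) * (i + 2))\<close>, and the denominator is at least 2.\<close>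
  have ch: "real (Suc (Suc N) choose Suc (Suc i)) \<le> real (m * (2*m-1)) * real (N choose i)" for i
  proof -
    have "Suc (Suc i) * (Suc (Suc N) choose Suc (Suc i)) = Suc (Suc N) * (Suc N choose Suc i)"
      by (rule Suc_times_binomial)
    moreover have "Suc i * (Suc N choose Suc i) = Suc N * (N choose i)"
      by (rule Suc_times_binomial)
    ultimately have e: "(Suc i * Suc (Suc i)) * (Suc (Suc N) choose Suc (Suc i)) = Suc (Suc N) * Suc N * (N choose i)"
      by (metis (no_types, lifting) mult.assoc mult.commute)
    have "2 * (Suc (Suc N) choose Suc (Suc i)) \<le> (Suc i * Suc (Suc i)) * (Suc (Suc N) choose Suc (Suc i))"
      by (intro mult_right_mono) auto
    also have "\<dots> = 2 * ((m * (2*m-1)) * (N choose i))" unfolding e by (simp add: m N_def algebra_simps)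
    finally have "(Suc (Suc N) choose Suc (Suc i)) \<le> (m * (2*m-1)) * (N choose i)" by simp
    then show ?thesis by (metis of_nat_le_iff of_nat_mult)
  qed
  have "(x + y) ^ (2*m) + (x - y) ^ (2*m) = (\<Sum>i\<le>Suc (Suc N). real (Suc (Suc N) choose i) * (1 + (-1)^i) * (x^(Suc (Suc N)-i) * y^i))"
    by (simp add: even_sum[symmetric] m N_def del: power_Suc)
  also have "\<dots> = 2 * x ^ (2*m) + (\<Sum>i\<le>N. real (Suc (Suc N) choose Suc (Suc i)) * (1 + (-1)^i) * (x^(N-i) * y^Suc (Suc i)))"
    by (subst sum.atMost_Suc_shift, subst sum.atMost_Suc_shift) (simp add: m N_def)
  also have "\<dots> \<le> 2 * x ^ (2*m) + (\<Sum>i\<le>N. (real (m * (2*m-1)) * real (N choose i)) * (1 + (-1)^i) * (x^(N-i) * y^Suc (Suc i)))"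
  proof (intro add_left_mono sum_mono)
    fix i assume i: "i \<in> {..N}"
    show "real (Suc (Suc N) choose Suc (Suc i)) * (1 + (-1)^i) * (x^(N-i) * y^Suc (Suc i))
       \<le> (real (m * (2*m-1)) * real (N choose i)) * (1 + (-1)^i) * (x^(N-i) * y^Suc (Suc i))"
    proof (cases "even i")
      case True
      then have "0 \<le> x^(N-i)" "0 \<le> y^Suc (Suc i)" using i
        by (auto simp: N_def intro!: zero_le_even_power simp del: power_Suc)
      then show ?thesis using ch[of i] True by (intro mult_right_mono) auto
    qed simp
  qed
  also have "(\<Sum>i\<le>N. (real (m * (2*m-1)) * real (N choose i)) * (1 + (-1)^i) * (x^(N-i) * y^Suc (Suc i)))
      = real (m * (2*m-1)) * y\<^sup>2 * (\<Sum>i\<le>N. real (N choose i) * (1 + (-1)^i) * (x^(N-i) * y^i))"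
    unfolding sum_distrib_left by (intro sum.cong refl) (simp add: power2_eq_square algebra_simps)
  also have "\<dots> = real (m * (2*m-1)) * y\<^sup>2 * ((x + y) ^ (2*(m-1)) + (x - y) ^ (2*(m-1)))"
    by (simp add: even_sum[symmetric] m N_def)
  finally show ?thesis .
qed

lemma even_power_midpoint:
  fixes x y :: real
  shows "2 * x ^ (2*m) \<le> (x + y) ^ (2*m) + (x - y) ^ (2*m)"
proof -
  have "convex_on UNIV (\<lambda>x::real. x ^ (2*m))" by (rule convex_power_even) simp
  from convex_onD[OF this, of "1/2" "x+y" "x-y"]
  have "((1/2) * (x+y) + (1/2) * (x-y)) ^ (2*m) \<le> (1/2) * (x + y) ^ (2*m) + (1/2) * (x - y) ^ (2*m)"
    by simp
  also have "(1/2) * (x+y) + (1/2) * (x-y) = x" by (simp add: field_simps)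
  finally show ?thesis by linarith
qed

text \<open>Weighted arithmetic-geometric mean inequality, kept in natural exponents. The induction
  step rests on \<open>x - y\<close> and \<open>x ^ k - y ^ k\<close> having the same sign.\<close>

lemma young_power:
  fixes x y :: real
  assumes "0 \<le> x" "0 \<le> y" "1 \<le> m"
  shows "real m * (x * y ^ (m-1)) \<le> x ^ m + real (m-1) * y ^ m"
  using assms(3)
proof (induction m rule: nat_induct_at_least)
  case base then show ?case by simp
next
  case (Suc k)
  then obtain l where k: "k = Suc l" by (cases k) auto
  have "0 \<le> (x - y) * (x ^ k - y ^ k)"
  proof (cases "x \<le> y")
    case True
    then show ?thesis using assms power_mono[of x y k] by (simp add: mult_nonpos_nonpos)
  next
    case False
    then show ?thesis using assms power_mono[of y x k] by simp
  qed
  moreover have "(real k * (x * y ^ (k-1))) * y \<le> (x ^ k + real (k-1) * y ^ k) * y"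
    by (rule mult_right_mono[OF Suc.IH assms(2)])
  ultimately show ?case by (simp add: k algebra_simps)
qed

text \<open>A rearrangement of \<open>young_power\<close>; it bounds the increments of a telescoping
  sum of powers.\<close>

lemma power_diff_le:
  fixes a b :: real
  assumes "0 \<le> a" "a \<le> b" "1 \<le> m"
  shows "b ^ m - a ^ m \<le> real m * ((b - a) * b ^ (m-1))"
  using young_power[of a b m] assms
  by (cases m) (auto simp: algebra_simps)

subsection \<open>Moments on a finite space\<close>

definition avg :: "'a set \<Rightarrow> ('a \<Rightarrow> real) \<Rightarrow> real" where
  "avg \<Omega> F = (\<Sum>\<omega>\<in>\<Omega>. F \<omega>) / real (card \<Omega>)"

lemma avg_mono: "(\<And>\<omega>. \<omega> \<in> \<Omega> \<Longrightarrow> F \<omega> \<le> G \<omega>) \<Longrightarrow> avg \<Omega> F \<le> avg \<Omega> G"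
  unfolding avg_def by (intro divide_right_mono sum_mono) auto

lemma avg_cong: "(\<And>\<omega>. \<omega> \<in> \<Omega> \<Longrightarrow> F \<omega> = G \<omega>) \<Longrightarrow> avg \<Omega> F = avg \<Omega> G"
  unfolding avg_def by (auto intro!: sum.cong arg_cong2[of _ _ _ _ "(/)"])

lemma avg_add: "avg \<Omega> (\<lambda>\<omega>. F \<omega> + G \<omega>) = avg \<Omega> F + avg \<Omega> G"
  unfolding avg_def by (simp add: sum.distrib add_divide_distrib)

lemma avg_diff: "avg \<Omega> (\<lambda>\<omega>. F \<omega> - G \<omega>) = avg \<Omega> F - avg \<Omega> G"
  unfolding avg_def by (simp add: sum_subtractf diff_divide_distrib)

lemma avg_cmult: "avg \<Omega> (\<lambda>\<omega>. c * F \<omega>) = c * avg \<Omega> F"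
  unfolding avg_def by (simp add: sum_distrib_left)

lemma avg_sum: "avg \<Omega> (\<lambda>\<omega>. \<Sum>i\<in>I. F i \<omega>) = (\<Sum>i\<in>I. avg \<Omega> (F i))"
  unfolding avg_def by (subst sum.swap) (simp add: sum_divide_distrib)

lemma avg_nonneg: "(\<And>\<omega>. \<omega> \<in> \<Omega> \<Longrightarrow> 0 \<le> F \<omega>) \<Longrightarrow> 0 \<le> avg \<Omega> F"
  unfolding avg_def by (intro divide_nonneg_nonneg sum_nonneg) auto

lemma avg_const: "finite \<Omega> \<Longrightarrow> \<Omega> \<noteq> {} \<Longrightarrow> avg \<Omega> (\<lambda>_. c) = c"
  unfolding avg_def by simp

text \<open>Young's inequality splits the mixed moment into \<open>X ^ m\<close> and
  \<open>m - 1\<close> copies of \<open>Y ^ m\<close>, which are absorbed on the left. Both square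
  function arguments end with this step.\<close>

lemma avg_power_absorb:
  assumes "1 \<le> m" and nn: "\<And>\<omega>. \<omega> \<in> \<Omega> \<Longrightarrow> 0 \<le> X \<omega>" "\<And>\<omega>. \<omega> \<in> \<Omega> \<Longrightarrow> 0 \<le> Y \<omega>"
    and le: "avg \<Omega> (\<lambda>\<omega>. Y \<omega> ^ m) \<le> avg \<Omega> (\<lambda>\<omega>. X \<omega> * Y \<omega> ^ (m-1))"
  shows "avg \<Omega> (\<lambda>\<omega>. Y \<omega> ^ m) \<le> avg \<Omega> (\<lambda>\<omega>. X \<omega> ^ m)"
proof -
  have "real m * avg \<Omega> (\<lambda>\<omega>. Y \<omega> ^ m) \<le> real m * avg \<Omega> (\<lambda>\<omega>. X \<omega> * Y \<omega> ^ (m-1))"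
    by (intro mult_left_mono le) auto
  also have "\<dots> = avg \<Omega> (\<lambda>\<omega>. real m * (X \<omega> * Y \<omega> ^ (m-1)))" by (simp add: avg_cmult)
  also have "\<dots> \<le> avg \<Omega> (\<lambda>\<omega>. X \<omega> ^ m + real (m-1) * Y \<omega> ^ m)"
    by (intro avg_mono young_power nn assms)
  also have "\<dots> = avg \<Omega> (\<lambda>\<omega>. X \<omega> ^ m) + real (m-1) * avg \<Omega> (\<lambda>\<omega>. Y \<omega> ^ m)"
    by (simp add: avg_add avg_cmult)
  finally show ?thesis using assms(1) by (simp add: algebra_simps of_nat_diff)
qed

text \<open>A bound for the p-norm under the uniform probability measure on \<open>\<Omega>\<close>,
  raised to the power \<open>p\<close> so that no roots occur and exponents stay natural
  numbers.\<close>

definition bnd :: "'a set \<Rightarrow> nat \<Rightarrow> ('a \<Rightarrow> real) \<Rightarrow> real \<Rightarrow> bool" where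
  "bnd \<Omega> p F a \<longleftrightarrow> 0 \<le> a \<and> avg \<Omega> (\<lambda>\<omega>. \<bar>F \<omega>\<bar> ^ p) \<le> a ^ p"

lemma bnd_cong: "bnd \<Omega> p F a \<Longrightarrow> (\<And>\<omega>. \<omega> \<in> \<Omega> \<Longrightarrow> F \<omega> = G \<omega>) \<Longrightarrow> bnd \<Omega> p G a"
  unfolding bnd_def using avg_cong[of \<Omega> "\<lambda>\<omega>. \<bar>F \<omega>\<bar> ^ p" "\<lambda>\<omega>. \<bar>G \<omega>\<bar> ^ p"] by auto

lemma bnd_weaken: "bnd \<Omega> p F a \<Longrightarrow> a \<le> b \<Longrightarrow> bnd \<Omega> p F b"
  unfolding bnd_def by (meson order_trans power_mono)

lemma bnd_nonneg: "bnd \<Omega> p F a \<Longrightarrow> 0 \<le> a" by (simp add: bnd_def)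

lemma bnd_zero: "1 \<le> p \<Longrightarrow> 0 \<le> a \<Longrightarrow> bnd \<Omega> p (\<lambda>_. 0) a"
  by (simp add: bnd_def avg_def zero_power)

lemma bnd_pointwise:
  assumes "finite \<Omega>" "\<Omega> \<noteq> {}" "\<And>\<omega>. \<omega> \<in> \<Omega> \<Longrightarrow> \<bar>F \<omega>\<bar> \<le> a" "0 \<le> a"
  shows "bnd \<Omega> p F a"
proof -
  have "avg \<Omega> (\<lambda>\<omega>. \<bar>F \<omega>\<bar> ^ p) \<le> avg \<Omega> (\<lambda>_. a ^ p)"
    by (intro avg_mono power_mono assms) auto
  then show ?thesis using assms by (simp add: bnd_def avg_const)
qed

lemma bnd_eq_0:
  assumes "finite \<Omega>" "\<Omega> \<noteq> {}" "1 \<le> p" "bnd \<Omega> p F 0" "\<omega> \<in> \<Omega>"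
  shows "F \<omega> = 0"
proof -
  have "(\<Sum>\<omega>\<in>\<Omega>. \<bar>F \<omega>\<bar> ^ p) \<le> 0"
    using assms by (auto simp: bnd_def avg_def zero_power divide_le_0_iff card_gt_0_iff)
  then have "(\<Sum>\<omega>\<in>\<Omega>. \<bar>F \<omega>\<bar> ^ p) = 0" by (intro antisym sum_nonneg) auto
  then have "\<bar>F \<omega>\<bar> ^ p = 0" using assms by (subst (asm) sum_nonneg_eq_0_iff) auto
  then show ?thesis using assms by auto
qed

text \<open>The norm inequalities below are proved by normalizing to norm one; this is why the bound
  0 is always treated apart, by \<open>bnd_eq_0\<close>.\<close>

lemma bnd_normalized:
  assumes "0 < a" shows "bnd \<Omega> p F a \<longleftrightarrow> avg \<Omega> (\<lambda>\<omega>. (\<bar>F \<omega>\<bar> / a) ^ p) \<le> 1"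
  using assms by (simp add: bnd_def power_divide avg_cmult[of _ "1 / a^p", simplified] divide_le_eq)

text \<open>Norms on a probability space increase with the exponent: average the pointwise Young
  inequality with weights \<open>p' / p\<close> and \<open>1 - p' / p\<close>.\<close>

lemma bnd_mono:
  assumes "finite \<Omega>" "\<Omega> \<noteq> {}" "1 \<le> p'" "p' \<le> p" "bnd \<Omega> p F a"
  shows "bnd \<Omega> p' F a"
proof (cases "a = 0")
  case True
  then have "F \<omega> = 0" if "\<omega> \<in> \<Omega>" for \<omega> using bnd_eq_0[of \<Omega> p F \<omega>] assms that by auto
  then show ?thesis using True by (intro bnd_pointwise assms) auto
next
  case False
  then have a: "0 < a" using bnd_nonneg[OF assms(5)] by auto
  have y: "t ^ p' \<le> (real p' / real p) * t ^ p + (1 - real p' / real p)" if "0 \<le> t" for t :: real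
  proof -
    have "t powr p' \<le> (real p' / real p) * t powr p + (1 - real p' / real p)" if "t > 0"
      using Youngs_inequality_0[of "real p' / real p" "1 - real p' / real p" "t powr p" 1] assms that
      by (auto simp: powr_powr)
    then show ?thesis using that assms
      by (cases "t = 0") (auto simp: powr_realpow zero_power)
  qed
  have "avg \<Omega> (\<lambda>\<omega>. (\<bar>F \<omega>\<bar> / a) ^ p') \<le> avg \<Omega> (\<lambda>\<omega>. (real p' / real p) * (\<bar>F \<omega>\<bar> / a) ^ p + (1 - real p' / real p))"
    by (intro avg_mono y) (use a in auto)
  also have "\<dots> = (real p' / real p) * avg \<Omega> (\<lambda>\<omega>. (\<bar>F \<omega>\<bar> / a) ^ p) + (1 - real p' / real p)"
    by (simp only: avg_add avg_cmult avg_const[OF assms(1,2)])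
  also have "\<dots> \<le> (real p' / real p) * 1 + (1 - real p' / real p)"
    using assms(5) a by (intro add_right_mono mult_left_mono) (auto simp: bnd_normalized)
  finally show ?thesis using a by (simp add: bnd_normalized)
qed

text \<open>Minkowski's inequality, by convexity of the power with weights \<open>a/(a+b)\<close>
  and \<open>b/(a+b)\<close> at the normalized functions.\<close>

lemma bnd_add:
  assumes fin: "finite \<Omega>" "\<Omega> \<noteq> {}" and p: "1 \<le> p" and F: "bnd \<Omega> p F a" and G: "bnd \<Omega> p G b"
  shows "bnd \<Omega> p (\<lambda>\<omega>. F \<omega> + G \<omega>) (a + b)"
proof -
  consider "a = 0" | "b = 0" | "0 < a" "0 < b" using bnd_nonneg[OF F] bnd_nonneg[OF G] by fastforce
  then show ?thesis
  proof cases
    case 1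
    then show ?thesis using G bnd_eq_0[OF fin p, of F] F by (auto intro: bnd_cong)
  next
    case 2
    then show ?thesis using F bnd_eq_0[OF fin p, of G] G by (auto intro: bnd_cong)
  next
    case 3
    have c: "convex_on {0..} (\<lambda>x::real. x ^ p)"
      using convex_power_even[of p] convex_power_odd[of p] by (cases "even p") (auto intro: convex_on_subset)
    have pt: "(\<bar>F \<omega> + G \<omega>\<bar> / (a+b)) ^ p \<le> (a/(a+b)) * (\<bar>F \<omega>\<bar> / a) ^ p + (b/(a+b)) * (\<bar>G \<omega>\<bar> / b) ^ p" for \<omega>
    proof -
      have "(\<bar>F \<omega> + G \<omega>\<bar> / (a+b)) ^ p \<le> ((\<bar>F \<omega>\<bar> + \<bar>G \<omega>\<bar>) / (a+b)) ^ p"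
        using 3 by (intro power_mono divide_right_mono) auto
      also have "\<dots> = ((1 - b/(a+b)) *\<^sub>R (\<bar>F \<omega>\<bar> / a) + (b/(a+b)) *\<^sub>R (\<bar>G \<omega>\<bar> / b)) ^ p"
      proof (rule arg_cong[of _ _ "\<lambda>z. z ^ p"])
        have "1 - b/(a+b) = a/(a+b)" using 3 by (simp add: field_simps)
        then show "(\<bar>F \<omega>\<bar> + \<bar>G \<omega>\<bar>) / (a+b) = (1 - b/(a+b)) *\<^sub>R (\<bar>F \<omega>\<bar> / a) + (b/(a+b)) *\<^sub>R (\<bar>G \<omega>\<bar> / b)"
          using 3 by (simp add: add_divide_distrib)
      qed
      also have "\<dots> \<le> (1 - b/(a+b)) * (\<bar>F \<omega>\<bar> / a) ^ p + (b/(a+b)) * (\<bar>G \<omega>\<bar> / b) ^ p"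
        by (rule convex_onD[OF c]) (use 3 in auto)
      also have "1 - b/(a+b) = a/(a+b)" using 3 by (simp add: field_simps)
      finally show ?thesis .
    qed
    have "avg \<Omega> (\<lambda>\<omega>. (\<bar>F \<omega> + G \<omega>\<bar> / (a+b)) ^ p) \<le> avg \<Omega> (\<lambda>\<omega>. (a/(a+b)) * (\<bar>F \<omega>\<bar> / a) ^ p + (b/(a+b)) * (\<bar>G \<omega>\<bar> / b) ^ p)"
      by (intro avg_mono pt)
    also have "\<dots> = (a/(a+b)) * avg \<Omega> (\<lambda>\<omega>. (\<bar>F \<omega>\<bar> / a) ^ p) + (b/(a+b)) * avg \<Omega> (\<lambda>\<omega>. (\<bar>G \<omega>\<bar> / b) ^ p)"
      by (simp only: avg_add avg_cmult)
    also have "\<dots> \<le> (a/(a+b)) * 1 + (b/(a+b)) * 1"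
      using F G 3 by (intro add_mono mult_left_mono) (auto simp: bnd_normalized)
    also have "\<dots> = 1" using 3 by (simp add: add_divide_distrib[symmetric])
    finally show ?thesis using 3 by (simp add: bnd_normalized)
  qed
qed

lemma bnd_sum:
  assumes fin: "finite \<Omega>" "\<Omega> \<noteq> {}" and p: "1 \<le> p" and F: "\<And>i. i \<in> I \<Longrightarrow> bnd \<Omega> p (F i) (a i)"
  shows "bnd \<Omega> p (\<lambda>\<omega>. \<Sum>i\<in>I. F i \<omega>) (\<Sum>i\<in>I. a i)"
  using F
proof (induction I rule: infinite_finite_induct)
  case (insert i I)
  then show ?case using bnd_add[OF fin p, of "F i" "a i"] by simp
qed (use p in \<open>auto intro: bnd_zero\<close>)

text \<open>Cauchy-Schwarz, in the form of \<open>2 u v \<le> u^2 + v^2\<close> for the normalized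
  functions.\<close>

lemma bnd_mult:
  assumes fin: "finite \<Omega>" "\<Omega> \<noteq> {}" and p: "1 \<le> p" and F: "bnd \<Omega> (2*p) F a" and G: "bnd \<Omega> (2*p) G b"
  shows "bnd \<Omega> p (\<lambda>\<omega>. F \<omega> * G \<omega>) (a * b)"
proof -
  have p2: "1 \<le> 2 * p" using p by simp
  consider "a = 0" | "b = 0" | "0 < a" "0 < b" using bnd_nonneg[OF F] bnd_nonneg[OF G] by fastforce
  then show ?thesis
  proof cases
    case 1
    then show ?thesis using bnd_eq_0[OF fin p2, of F] F bnd_zero[OF p, of 0 \<Omega>] by (auto elim!: bnd_cong)
  next
    case 2
    then show ?thesis using bnd_eq_0[OF fin p2, of G] G bnd_zero[OF p, of 0 \<Omega>] by (auto elim!: bnd_cong)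
  next
    case 3
    have pt: "(\<bar>F \<omega> * G \<omega>\<bar> / (a*b)) ^ p \<le> (1/2) * (\<bar>F \<omega>\<bar> / a) ^ (2*p) + (1/2) * (\<bar>G \<omega>\<bar> / b) ^ (2*p)" for \<omega>
    proof -
      have "2 * ((\<bar>F \<omega>\<bar> / a) ^ p * (\<bar>G \<omega>\<bar> / b) ^ p) \<le> ((\<bar>F \<omega>\<bar> / a) ^ p)\<^sup>2 + ((\<bar>G \<omega>\<bar> / b) ^ p)\<^sup>2"
        using sum_squares_bound[of "(\<bar>F \<omega>\<bar> / a) ^ p" "(\<bar>G \<omega>\<bar> / b) ^ p"] by (simp add: mult.assoc)
      then show ?thesis by (simp add: power_mult_distrib[symmetric] abs_mult power_mult[symmetric] mult.commute[of p])
    qed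
    have "avg \<Omega> (\<lambda>\<omega>. (\<bar>F \<omega> * G \<omega>\<bar> / (a*b)) ^ p) \<le> avg \<Omega> (\<lambda>\<omega>. (1/2) * (\<bar>F \<omega>\<bar> / a) ^ (2*p) + (1/2) * (\<bar>G \<omega>\<bar> / b) ^ (2*p))"
      by (intro avg_mono pt)
    also have "\<dots> = (1/2) * avg \<Omega> (\<lambda>\<omega>. (\<bar>F \<omega>\<bar> / a) ^ (2*p)) + (1/2) * avg \<Omega> (\<lambda>\<omega>. (\<bar>G \<omega>\<bar> / b) ^ (2*p))"
      by (simp only: avg_add avg_cmult)
    also have "\<dots> \<le> (1/2) * 1 + (1/2) * 1"
      using F G 3 by (intro add_mono mult_left_mono) (auto simp: bnd_normalized)
    finally show ?thesis using 3 by (simp add: bnd_normalized)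
  qed
qed

lemma bnd_square: "bnd \<Omega> (2*p) F a \<Longrightarrow> bnd \<Omega> p (\<lambda>\<omega>. (F \<omega>)\<^sup>2) (a\<^sup>2)"
  unfolding bnd_def by (simp add: power_mult)

lemma prod_le_mean_power:
  fixes x :: "'b \<Rightarrow> real"
  assumes "finite S" "S \<noteq> {}" "\<And>i. i \<in> S \<Longrightarrow> 0 \<le> x i"
  shows "(\<Prod>i\<in>S. x i) \<le> (\<Sum>i\<in>S. (1 / real (card S)) * x i ^ card S)"
proof (cases "\<exists>i\<in>S. x i = 0")
  case True
  then have "(\<Prod>i\<in>S. x i) = 0" using assms by auto
  moreover have "0 \<le> (\<Sum>i\<in>S. (1 / real (card S)) * x i ^ card S)"
    using assms(3) by (intro sum_nonneg mult_nonneg_nonneg zero_le_power) auto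
  ultimately show ?thesis by simp
next
  case False
  then have pos: "0 < x i" if "i \<in> S" for i using assms(3)[OF that] that by force
  have k: "0 < real (card S)" using assms by (simp add: card_gt_0_iff)
  have "(\<Prod>i\<in>S. x i) = exp (\<Sum>i\<in>S. (1 / real (card S)) *\<^sub>R (real (card S) * ln (x i)))"
    using pos assms k by (simp add: exp_sum exp_ln cong: prod.cong)
  also have "\<dots> \<le> (\<Sum>i\<in>S. (1 / real (card S)) * exp (real (card S) * ln (x i)))"
    by (rule convex_on_sum[OF assms(1) assms(2), of UNIV exp])
       (use assms k exp_convex in auto)
  also have "\<dots> = (\<Sum>i\<in>S. (1 / real (card S)) * x i ^ card S)"
    using pos by (intro sum.cong refl) (simp add: exp_of_nat_mult)
  finally show ?thesis .
qed

text \<open>Hoelder's inequality for several factors. Since \<open>k\<close> may exceed their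
  number, one exponent \<open>p * k\<close> serves products of different lengths.\<close>

lemma bnd_prod:
  assumes fin: "finite \<Omega>" "\<Omega> \<noteq> {}" and p: "1 \<le> p" and S: "finite S" "card S \<le> k"
    and F: "\<And>i. i \<in> S \<Longrightarrow> bnd \<Omega> (p * k) (F i) (a i)"
  shows "bnd \<Omega> p (\<lambda>\<omega>. \<Prod>i\<in>S. F i \<omega>) (\<Prod>i\<in>S. a i)"
proof (cases "S = {}")
  case True
  then show ?thesis using fin by (auto intro: bnd_pointwise)
next
  case False
  then have c: "1 \<le> card S" using S by (simp add: Suc_le_eq card_gt_0_iff)
  have pc: "1 \<le> p * card S" using p c by simp
  have F': "bnd \<Omega> (p * card S) (F i) (a i)" if "i \<in> S" for i
    by (rule bnd_mono[OF fin pc _ F[OF that]]) (use S in simp)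
  show ?thesis
  proof (cases "\<exists>i\<in>S. a i = 0")
    case True
    then obtain i where i: "i \<in> S" "a i = 0" by auto
    then have "F i \<omega> = 0" if "\<omega> \<in> \<Omega>" for \<omega> using bnd_eq_0[OF fin pc _ that, of "F i"] F'[OF i(1)] by simp
    then have "(\<Prod>i\<in>S. F i \<omega>) = 0" if "\<omega> \<in> \<Omega>" for \<omega> using i S that by (auto intro!: prod_zero)
    moreover have "(\<Prod>i\<in>S. a i) = 0" using i S by auto
    ultimately show ?thesis using fin by (auto intro: bnd_pointwise)
  next
    case False
    then have a: "0 < a i" if "i \<in> S" for i using bnd_nonneg[OF F'[OF that]] that by force
    have pt: "(\<bar>\<Prod>i\<in>S. F i \<omega>\<bar> / (\<Prod>i\<in>S. a i)) ^ p \<le> (\<Sum>i\<in>S. (1 / real (card S)) * (\<bar>F i \<omega>\<bar> / a i) ^ (p * card S))" for \<omega>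
    proof -
      have "(\<bar>\<Prod>i\<in>S. F i \<omega>\<bar> / (\<Prod>i\<in>S. a i)) ^ p = (\<Prod>i\<in>S. (\<bar>F i \<omega>\<bar> / a i) ^ p)"
        unfolding abs_prod prod_dividef[symmetric] prod_power_distrib ..
      also have "\<dots> \<le> (\<Sum>i\<in>S. (1 / real (card S)) * ((\<bar>F i \<omega>\<bar> / a i) ^ p) ^ card S)"
        by (rule prod_le_mean_power) (use S \<open>S \<noteq> {}\<close> a in \<open>auto intro!: divide_nonneg_nonneg simp: less_imp_le\<close>)
      finally show ?thesis by (simp add: power_mult)
    qed
    have "avg \<Omega> (\<lambda>\<omega>. (\<bar>\<Prod>i\<in>S. F i \<omega>\<bar> / (\<Prod>i\<in>S. a i)) ^ p) \<le> avg \<Omega> (\<lambda>\<omega>. \<Sum>i\<in>S. (1 / real (card S)) * (\<bar>F i \<omega>\<bar> / a i) ^ (p * card S))"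
      by (intro avg_mono pt)
    also have "\<dots> = (\<Sum>i\<in>S. (1 / real (card S)) * avg \<Omega> (\<lambda>\<omega>. (\<bar>F i \<omega>\<bar> / a i) ^ (p * card S)))"
      by (simp only: avg_sum avg_cmult)
    also have "\<dots> \<le> (\<Sum>i\<in>S. (1 / real (card S)) * 1)"
      using F' a by (intro sum_mono mult_left_mono) (auto simp: bnd_normalized)
    also have "\<dots> = 1" using S \<open>S \<noteq> {}\<close> by simp
    finally show ?thesis using a by (subst bnd_normalized) (auto intro!: prod_pos)
  qed
qed

subsection \<open>Square functions\<close>

text \<open>\<open>\<tau> c i\<close> stands for flipping digit \<open>i\<close> of coordinate
  \<open>c\<close>. Symmetrizing over such a measure-preserving involution takes the place of
  conditional expectation, so no filtration has to be set up.\<close>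

locale flip_space =
  fixes \<Omega> :: "'a set" and \<tau> :: "'c \<Rightarrow> nat \<Rightarrow> 'a \<Rightarrow> 'a"
  assumes finite_space: "finite \<Omega>" and space_nonempty: "\<Omega> \<noteq> {}"
    and flip_closed: "\<omega> \<in> \<Omega> \<Longrightarrow> \<tau> c i \<omega> \<in> \<Omega>"
    and flip_flip: "\<tau> c i (\<tau> c i \<omega>) = \<omega>"
begin

lemma avg_flip: "avg \<Omega> (\<lambda>\<omega>. F (\<tau> c i \<omega>)) = avg \<Omega> F"
proof -
  have "bij_betw (\<tau> c i) \<Omega> \<Omega>"
    by (rule bij_betwI[where g = "\<tau> c i"]) (auto simp: flip_closed flip_flip)
  then have "(\<Sum>\<omega>\<in>\<Omega>. F (\<tau> c i \<omega>)) = (\<Sum>\<omega>\<in>\<Omega>. F \<omega>)"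
    by (rule sum.reindex_bij_betw)
  then show ?thesis by (simp add: avg_def)
qed

lemma avg_le_flip:
  assumes "\<And>\<omega>. F \<omega> + F (\<tau> c i \<omega>) \<le> G \<omega> + G (\<tau> c i \<omega>)"
  shows "avg \<Omega> F \<le> avg \<Omega> G"
proof -
  have "avg \<Omega> (\<lambda>\<omega>. F \<omega> + F (\<tau> c i \<omega>)) \<le> avg \<Omega> (\<lambda>\<omega>. G \<omega> + G (\<tau> c i \<omega>))"
    by (intro avg_mono assms)
  then show ?thesis by (simp add: avg_add avg_flip)
qed

text \<open>Stands for measurability with respect to the digits of coordinate \<open>c\<close> below
  \<open>t\<close>; \<open>haar_level\<close> then describes a martingale difference at time
  \<open>t\<close>.\<close>

definition flip_invariant :: "'c \<Rightarrow> nat \<Rightarrow> ('a \<Rightarrow> real) \<Rightarrow> bool" where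
  "flip_invariant c t F \<longleftrightarrow> (\<forall>i\<ge>t. \<forall>\<omega>. F (\<tau> c i \<omega>) = F \<omega>)"

definition haar_level :: "'c \<Rightarrow> nat \<Rightarrow> ('a \<Rightarrow> real) \<Rightarrow> bool" where
  "haar_level c t F \<longleftrightarrow> (\<forall>\<omega>. F (\<tau> c t \<omega>) = - F \<omega>) \<and> flip_invariant c (Suc t) F"

lemma haar_levelD:
  assumes "haar_level c t F"
  shows "F (\<tau> c t \<omega>) = - F \<omega>" "t < i \<Longrightarrow> F (\<tau> c i \<omega>) = F \<omega>"
  using assms by (auto simp: haar_level_def flip_invariant_def)

text \<open>Burkholder's inequality for even exponents, by telescoping the moments of the partial
  sums \<open>M k\<close>. Each increment is an average of \<open>(d k)^2\<close> against a power of
  \<open>M (Suc k)\<close>; replacing the latter by the full sum \<open>M L\<close> gives all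
  increments a common factor, and \<open>avg_power_absorb\<close> applies.\<close>

lemma square_function_even_power:
  assumes d: "\<And>t. t < L \<Longrightarrow> haar_level c t (d t)" and m: "1 \<le> m"
  shows "avg \<Omega> (\<lambda>\<omega>. (\<Sum>t<L. d t \<omega>) ^ (2*m))
       \<le> avg \<Omega> (\<lambda>\<omega>. (real (m * (2*m - 1)) * (\<Sum>t<L. (d t \<omega>)\<^sup>2)) ^ m)"
proof -
  define M where "M k \<omega> = (\<Sum>t<k. d t \<omega>)" for k \<omega>
  define K where "K = real (m * (2*m - 1))"
  have odd: "d t (\<tau> c t \<omega>) = - d t \<omega>" if "t < L" for t \<omega>
    using haar_levelD(1)[OF d[OF that]] .
  have inv: "d t (\<tau> c i \<omega>) = d t \<omega>" if "t < i" "t < L" for t i \<omega>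
    using haar_levelD(2)[OF d[OF that(2)] that(1)] .
  have M_Suc: "M (Suc k) \<omega> = M k \<omega> + d k \<omega>" for k \<omega> by (simp add: M_def)
  have M_inv: "M k (\<tau> c k \<omega>) = M k \<omega>" if "k < L" for k \<omega>
    unfolding M_def using that by (intro sum.cong refl inv) auto
  have step: "avg \<Omega> (\<lambda>\<omega>. M (Suc k) \<omega> ^ (2*m)) - avg \<Omega> (\<lambda>\<omega>. M k \<omega> ^ (2*m))
      \<le> K * avg \<Omega> (\<lambda>\<omega>. (d k \<omega>)\<^sup>2 * M (Suc k) \<omega> ^ (2*(m-1)))" if k: "k < L" for k
  proof -
    have "avg \<Omega> (\<lambda>\<omega>. M (Suc k) \<omega> ^ (2*m)) \<le> avg \<Omega> (\<lambda>\<omega>. M k \<omega> ^ (2*m) + K * ((d k \<omega>)\<^sup>2 * M (Suc k) \<omega> ^ (2*(m-1))))"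
    proof (rule avg_le_flip[where c = c and i = k])
      fix \<omega>
      show "M (Suc k) \<omega> ^ (2*m) + M (Suc k) (\<tau> c k \<omega>) ^ (2*m)
        \<le> M k \<omega> ^ (2*m) + K * ((d k \<omega>)\<^sup>2 * M (Suc k) \<omega> ^ (2*(m-1))) +
           (M k (\<tau> c k \<omega>) ^ (2*m) + K * ((d k (\<tau> c k \<omega>))\<^sup>2 * M (Suc k) (\<tau> c k \<omega>) ^ (2*(m-1))))"
        using square_function_step[OF m, of "M k \<omega>" "d k \<omega>"]
        by (simp add: M_Suc M_inv[OF k] odd[OF k] K_def algebra_simps)
    qed
    then show ?thesis by (simp add: avg_add avg_cmult)
  qed
  \<comment> \<open>The submartingale property: the weight \<open>(d k)^2\<close> is unaffected by
    flips at levels above \<open>k\<close>, and adding an odd increment can only raise an even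
    moment.\<close>
  have up: "avg \<Omega> (\<lambda>\<omega>. (d k \<omega>)\<^sup>2 * M (Suc k) \<omega> ^ (2*j)) \<le> avg \<Omega> (\<lambda>\<omega>. (d k \<omega>)\<^sup>2 * M l \<omega> ^ (2*j))"
    if "Suc k \<le> l" "l \<le> L" for k l j
    using that
  proof (induction l rule: nat_induct_at_least)
    case (Suc l)
    then have kl: "k < l" "l < L" "k < L" by auto
    have "avg \<Omega> (\<lambda>\<omega>. (d k \<omega>)\<^sup>2 * M l \<omega> ^ (2*j)) \<le> avg \<Omega> (\<lambda>\<omega>. (d k \<omega>)\<^sup>2 * M (Suc l) \<omega> ^ (2*j))"
    proof (rule avg_le_flip[where c = c and i = l])
      fix \<omega>
      show "(d k \<omega>)\<^sup>2 * M l \<omega> ^ (2*j) + (d k (\<tau> c l \<omega>))\<^sup>2 * M l (\<tau> c l \<omega>) ^ (2*j)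
        \<le> (d k \<omega>)\<^sup>2 * M (Suc l) \<omega> ^ (2*j) + (d k (\<tau> c l \<omega>))\<^sup>2 * M (Suc l) (\<tau> c l \<omega>) ^ (2*j)"
        using mult_left_mono[OF even_power_midpoint[of "M l \<omega>" j "d l \<omega>"], of "(d k \<omega>)\<^sup>2"]
        by (simp add: M_Suc M_inv[OF kl(2)] odd[OF kl(2)] inv[OF kl(1,3)] algebra_simps)
    qed
    with Suc show ?case by auto
  qed simp
  have tel: "avg \<Omega> (\<lambda>\<omega>. M l \<omega> ^ (2*m)) \<le> K * (\<Sum>k<l. avg \<Omega> (\<lambda>\<omega>. (d k \<omega>)\<^sup>2 * M L \<omega> ^ (2*(m-1))))"
    if "l \<le> L" for l
    using that
  proof (induction l)
    case 0
    show ?case using m by (simp add: M_def avg_def zero_power)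
  next
    case (Suc l)
    have "K * avg \<Omega> (\<lambda>\<omega>. (d l \<omega>)\<^sup>2 * M (Suc l) \<omega> ^ (2*(m-1))) \<le> K * avg \<Omega> (\<lambda>\<omega>. (d l \<omega>)\<^sup>2 * M L \<omega> ^ (2*(m-1)))"
      by (intro mult_left_mono up) (use Suc in \<open>auto simp: K_def\<close>)
    then show ?case using Suc step[of l] by (simp add: distrib_left)
  qed
  have "avg \<Omega> (\<lambda>\<omega>. ((M L \<omega>)\<^sup>2) ^ m) \<le> avg \<Omega> (\<lambda>\<omega>. (K * (\<Sum>t<L. (d t \<omega>)\<^sup>2)) ^ m)"
  proof (rule avg_power_absorb[OF m])
    have "avg \<Omega> (\<lambda>\<omega>. (K * (\<Sum>t<L. (d t \<omega>)\<^sup>2)) * ((M L \<omega>)\<^sup>2) ^ (m-1)) = K * (\<Sum>k<L. avg \<Omega> (\<lambda>\<omega>. (d k \<omega>)\<^sup>2 * M L \<omega> ^ (2*(m-1))))"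
      by (simp add: avg_sum[symmetric] avg_cmult[symmetric] sum_distrib_right sum_distrib_left power_mult mult.assoc)
    then show "avg \<Omega> (\<lambda>\<omega>. ((M L \<omega>)\<^sup>2) ^ m) \<le> avg \<Omega> (\<lambda>\<omega>. (K * (\<Sum>t<L. (d t \<omega>)\<^sup>2)) * ((M L \<omega>)\<^sup>2) ^ (m-1))"
      using tel[of L] by (simp add: power_mult)
  qed (auto simp: K_def intro!: mult_nonneg_nonneg sum_nonneg)
  then show ?thesis by (simp add: M_def K_def power_mult)
qed

text \<open>An inequality between conditional second moments given the digits below
  \<open>t\<close>, stated by testing against nonnegative weights. Nothing is asked of
  \<open>\<phi>\<close> itself; it need not have Haar level \<open>t\<close>.\<close>

definition dominated :: "'c \<Rightarrow> nat \<Rightarrow> ('a \<Rightarrow> real) \<Rightarrow> ('a \<Rightarrow> real) \<Rightarrow> bool" where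
  "dominated c t d \<phi> \<longleftrightarrow> (\<forall>C. (\<forall>\<omega>. 0 \<le> C \<omega>) \<longrightarrow> flip_invariant c t C \<longrightarrow>
     avg \<Omega> (\<lambda>\<omega>. C \<omega> * (d \<omega>)\<^sup>2) \<le> avg \<Omega> (\<lambda>\<omega>. C \<omega> * (\<phi> \<omega>)\<^sup>2))"

lemma dominated_refl: "dominated c t d d" by (simp add: dominated_def)

text \<open>Stein's inequality in a dual form: conditional domination term by term passes to the
  moments of the sum at the price of a factor \<open>m\<close>. The key point is that squaring
  removes the sign change at level \<open>k\<close>, so that \<open>T (Suc k)\<close>, although it
  contains the term \<open>k\<close>, is still an admissible weight at level
  \<open>k\<close>.\<close>

lemma stein_even_power:
  assumes d: "\<And>t. t < L \<Longrightarrow> haar_level c t (d t)"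
    and \<phi>: "\<And>t. t < L \<Longrightarrow> dominated c t (d t) (\<phi> t)" and m: "1 \<le> m"
  shows "avg \<Omega> (\<lambda>\<omega>. (\<Sum>t<L. (d t \<omega>)\<^sup>2) ^ m) \<le> avg \<Omega> (\<lambda>\<omega>. (real m * (\<Sum>t<L. (\<phi> t \<omega>)\<^sup>2)) ^ m)"
proof -
  define T where "T k \<omega> = (\<Sum>t<k. (d t \<omega>)\<^sup>2)" for k \<omega>
  have T0: "0 \<le> T k \<omega>" for k \<omega> by (simp add: T_def sum_nonneg)
  have T_Suc: "T (Suc k) \<omega> = T k \<omega> + (d k \<omega>)\<^sup>2" for k \<omega> by (simp add: T_def)
  have T_mono: "T k \<omega> \<le> T l \<omega>" if "k \<le> l" for k l \<omega>
    unfolding T_def using that by (intro sum_mono2) auto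
  have d_inv: "(d t (\<tau> c i \<omega>))\<^sup>2 = (d t \<omega>)\<^sup>2" if "t < L" "t \<le> i" for t i \<omega>
    using haar_levelD[OF d[OF that(1)]] that(2) by (cases "t = i") auto
  have T_inv: "flip_invariant c k (T (Suc k))" if "k < L" for k
    unfolding flip_invariant_def T_def using that by (intro allI impI sum.cong refl d_inv) auto
  have step: "avg \<Omega> (\<lambda>\<omega>. T (Suc k) \<omega> ^ m) - avg \<Omega> (\<lambda>\<omega>. T k \<omega> ^ m)
      \<le> real m * avg \<Omega> (\<lambda>\<omega>. (\<phi> k \<omega>)\<^sup>2 * T L \<omega> ^ (m-1))" if k: "k < L" for k
  proof -
    have "T (Suc k) \<omega> ^ m - T k \<omega> ^ m \<le> real m * (T (Suc k) \<omega> ^ (m-1) * (d k \<omega>)\<^sup>2)" for \<omega>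
      using power_diff_le[OF T0[of k \<omega>] T_mono[of k "Suc k" \<omega>] m] by (simp add: T_Suc mult.commute)
    then have "avg \<Omega> (\<lambda>\<omega>. T (Suc k) \<omega> ^ m - T k \<omega> ^ m) \<le> avg \<Omega> (\<lambda>\<omega>. real m * (T (Suc k) \<omega> ^ (m-1) * (d k \<omega>)\<^sup>2))"
      by (intro avg_mono)
    also have "\<dots> \<le> real m * avg \<Omega> (\<lambda>\<omega>. T (Suc k) \<omega> ^ (m-1) * (\<phi> k \<omega>)\<^sup>2)"
      unfolding avg_cmult
    proof (intro mult_left_mono)
      have "flip_invariant c k (\<lambda>\<omega>. T (Suc k) \<omega> ^ (m-1))"
        using T_inv[OF k] by (simp add: flip_invariant_def)
      then show "avg \<Omega> (\<lambda>\<omega>. T (Suc k) \<omega> ^ (m-1) * (d k \<omega>)\<^sup>2) \<le> avg \<Omega> (\<lambda>\<omega>. T (Suc k) \<omega> ^ (m-1) * (\<phi> k \<omega>)\<^sup>2)"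
        using \<phi>[OF k] T0 unfolding dominated_def by auto
    qed auto
    also have "\<dots> \<le> real m * avg \<Omega> (\<lambda>\<omega>. (\<phi> k \<omega>)\<^sup>2 * T L \<omega> ^ (m-1))"
      using k by (intro mult_left_mono avg_mono) (auto simp: mult.commute intro!: mult_left_mono power_mono T0 T_mono)
    finally show ?thesis by (simp add: avg_diff)
  qed
  have tel: "avg \<Omega> (\<lambda>\<omega>. T l \<omega> ^ m) \<le> real m * (\<Sum>k<l. avg \<Omega> (\<lambda>\<omega>. (\<phi> k \<omega>)\<^sup>2 * T L \<omega> ^ (m-1)))" if "l \<le> L" for l
    using that
  proof (induction l)
    case 0
    show ?case using m by (simp add: T_def avg_def zero_power)
  next
    case (Suc l)
    then show ?case using step[of l] by (simp add: distrib_left)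
  qed
  have "avg \<Omega> (\<lambda>\<omega>. T L \<omega> ^ m) \<le> avg \<Omega> (\<lambda>\<omega>. (real m * (\<Sum>t<L. (\<phi> t \<omega>)\<^sup>2)) ^ m)"
  proof (rule avg_power_absorb[OF m])
    have "avg \<Omega> (\<lambda>\<omega>. (real m * (\<Sum>t<L. (\<phi> t \<omega>)\<^sup>2)) * T L \<omega> ^ (m-1)) = real m * (\<Sum>k<L. avg \<Omega> (\<lambda>\<omega>. (\<phi> k \<omega>)\<^sup>2 * T L \<omega> ^ (m-1)))"
      by (simp add: avg_sum[symmetric] avg_cmult[symmetric] sum_distrib_right sum_distrib_left mult.assoc)
    then show "avg \<Omega> (\<lambda>\<omega>. T L \<omega> ^ m) \<le> avg \<Omega> (\<lambda>\<omega>. (real m * (\<Sum>t<L. (\<phi> t \<omega>)\<^sup>2)) * T L \<omega> ^ (m-1))"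
      using tel[of L] by simp
  qed (auto intro!: mult_nonneg_nonneg sum_nonneg T0)
  then show ?thesis by (simp add: T_def)
qed

text \<open>Burkholder's factor \<open>m * (2*m - 1)\<close> times Stein's factor \<open>m\<close>
  is at most \<open>2 * m ^ 3\<close>, the origin of the cubes in all constants below.\<close>

lemma bnd_sum_haar:
  assumes d: "\<And>t. t < L \<Longrightarrow> haar_level c t (d t)"
    and \<phi>: "\<And>t. t < L \<Longrightarrow> dominated c t (d t) (\<phi> t)" and m: "1 \<le> m"
    and A: "bnd \<Omega> m (\<lambda>\<omega>. \<Sum>t<L. (\<phi> t \<omega>)\<^sup>2) A"
  shows "bnd \<Omega> (2*m) (\<lambda>\<omega>. \<Sum>t<L. d t \<omega>) (sqrt (2 * real m ^ 3 * A))"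
proof -
  define K where "K = real (m * (2*m - 1))"
  have A0: "0 \<le> A" using A by (rule bnd_nonneg)
  have K0: "0 \<le> K" by (simp add: K_def)
  have KA: "K * (real m * A) \<le> 2 * real m ^ 3 * A"
  proof -
    have "K * real m \<le> 2 * real m ^ 3"
      using m by (simp add: K_def power3_eq_cube of_nat_diff algebra_simps)
    from mult_right_mono[OF this A0] show ?thesis by (simp add: mult.assoc)
  qed
  have "avg \<Omega> (\<lambda>\<omega>. \<bar>\<Sum>t<L. d t \<omega>\<bar> ^ (2*m)) = avg \<Omega> (\<lambda>\<omega>. (\<Sum>t<L. d t \<omega>) ^ (2*m))"
    by (simp add: power_mult)
  also have "\<dots> \<le> avg \<Omega> (\<lambda>\<omega>. (K * (\<Sum>t<L. (d t \<omega>)\<^sup>2)) ^ m)"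
    unfolding K_def by (rule square_function_even_power[OF d m])
  also have "\<dots> = K ^ m * avg \<Omega> (\<lambda>\<omega>. (\<Sum>t<L. (d t \<omega>)\<^sup>2) ^ m)"
    by (simp add: power_mult_distrib avg_cmult)
  also have "\<dots> \<le> K ^ m * avg \<Omega> (\<lambda>\<omega>. (real m * (\<Sum>t<L. (\<phi> t \<omega>)\<^sup>2)) ^ m)"
    by (intro mult_left_mono stein_even_power[OF d \<phi> m]) (use K0 in auto)
  also have "\<dots> = K ^ m * (real m ^ m * avg \<Omega> (\<lambda>\<omega>. \<bar>\<Sum>t<L. (\<phi> t \<omega>)\<^sup>2\<bar> ^ m))"
    by (simp add: power_mult_distrib avg_cmult sum_nonneg)
  also have "\<dots> \<le> K ^ m * (real m ^ m * A ^ m)"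
    using A by (intro mult_left_mono) (use K0 in \<open>auto simp: bnd_def\<close>)
  also have "\<dots> = (K * (real m * A)) ^ m" by (simp add: power_mult_distrib)
  also have "\<dots> \<le> (2 * real m ^ 3 * A) ^ m"
    by (intro power_mono KA) (use A0 K0 in auto)
  also have "\<dots> = sqrt (2 * real m ^ 3 * A) ^ (2*m)"
    using A0 by (simp add: power_mult)
  finally show ?thesis using A0 by (simp add: bnd_def)
qed

end

subsection \<open>Sums of layers and their coincidences\<close>

definition fiber :: "'c \<Rightarrow> nat \<Rightarrow> ('c \<Rightarrow> nat) set \<Rightarrow> ('c \<Rightarrow> nat) set" where
  "fiber c t R = {r \<in> R. r c = t}"

definition below :: "'c \<Rightarrow> nat \<Rightarrow> ('c \<Rightarrow> nat) set \<Rightarrow> ('c \<Rightarrow> nat) set" where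
  "below c t R = {r \<in> R. r c < t}"

lemma fiber_subset: "fiber c t R \<subseteq> R" by (auto simp: fiber_def)

lemma fiber_commute: "fiber c t (fiber c' t' R) = fiber c' t' (fiber c t R)"
  by (auto simp: fiber_def)

text \<open>A product of two sums is sorted by which index is larger. In the first two parts the
  larger level decides the parity under flips; the third is a coincidence of levels.\<close>

lemma sum_mult_sum_split:
  fixes a b :: "nat \<Rightarrow> real"
  shows "(\<Sum>t<L. a t) * (\<Sum>t<L. b t) =
    (\<Sum>t<L. a t * (\<Sum>u<t. b u)) + (\<Sum>t<L. (\<Sum>u<t. a u) * b t) + (\<Sum>t<L. a t * b t)"
  by (induction L) (simp_all add: algebra_simps)

locale haar_family = flip_space \<Omega> \<tau>
  for \<Omega> :: "'a set" and \<tau> :: "'c \<Rightarrow> nat \<Rightarrow> 'a \<Rightarrow> 'a" +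
  fixes D :: "'c set" and n :: nat and f :: "('c \<Rightarrow> nat) \<Rightarrow> 'a \<Rightarrow> real"
  assumes finite_D: "finite D"
    and f_le: "r \<in> D \<rightarrow>\<^sub>E {..n} \<Longrightarrow> \<bar>f r \<omega>\<bar> \<le> 1"
    and f_haar: "r \<in> D \<rightarrow>\<^sub>E {..n} \<Longrightarrow> c \<in> D \<Longrightarrow> haar_level c (r c) (f r)"
begin

definition box :: "('c \<Rightarrow> nat) set" where "box = D \<rightarrow>\<^sub>E {..n}"

definition S :: "('c \<Rightarrow> nat) set \<Rightarrow> 'a \<Rightarrow> real" where "S R \<omega> = (\<Sum>r\<in>R. f r \<omega>)"

text \<open>Doubling \<open>m\<close> turns the factor \<open>2 * m ^ 3\<close> per coordinate in
  \<open>bnd_S\<close> into \<open>16 * m ^ 3\<close>. The constant \<open>B\<close> has one factor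
  more, for one further square function.\<close>

definition E :: "nat \<Rightarrow> real" where "E m = (16 * real m ^ 3) ^ card D"

definition B :: "nat \<Rightarrow> real" where "B m = (16 * real m ^ 3) ^ Suc (card D)"

lemma finite_box: "finite box" unfolding box_def by (intro finite_PiE finite_D) auto

lemma finite_sub_box: "R \<subseteq> box \<Longrightarrow> finite R" using finite_box finite_subset by blast

lemma box_le: "R \<subseteq> box \<Longrightarrow> r \<in> R \<Longrightarrow> c \<in> D \<Longrightarrow> r c \<le> n" by (auto simp: box_def PiE_iff)

lemma S_empty [simp]: "S {} \<omega> = 0" by (simp add: S_def)

lemma S_abs_le: "R \<subseteq> box \<Longrightarrow> \<bar>S R \<omega>\<bar> \<le> real (card R)"
  unfolding S_def by (rule order_trans[OF sum_abs])
    (use sum_bounded_above[of R "\<lambda>r. \<bar>f r \<omega>\<bar>" 1] f_le in \<open>auto simp: box_def subset_iff\<close>)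

lemma S_flip_gt:
  assumes "R \<subseteq> box" "c \<in> D" "\<And>r. r \<in> R \<Longrightarrow> r c < i"
  shows "S R (\<tau> c i \<omega>) = S R \<omega>"
  unfolding S_def using assms by (intro sum.cong refl haar_levelD(2)[OF f_haar]) (auto simp: box_def)

lemma S_fiber_odd:
  assumes "R \<subseteq> box" "c \<in> D"
  shows "S (fiber c t R) (\<tau> c t \<omega>) = - S (fiber c t R) \<omega>"
proof -
  have "f r (\<tau> c t \<omega>) = - f r \<omega>" if "r \<in> fiber c t R" for r
    using haar_levelD(1)[OF f_haar, of r c \<omega>] that assms by (auto simp: fiber_def box_def)
  then show ?thesis unfolding S_def by (simp add: sum_negf)
qed

lemma S_fiber_flip_gt:
  "R \<subseteq> box \<Longrightarrow> c \<in> D \<Longrightarrow> t < i \<Longrightarrow> S (fiber c t R) (\<tau> c i \<omega>) = S (fiber c t R) \<omega>"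
  by (rule S_flip_gt) (auto simp: fiber_def)

lemma S_below_flip:
  "R \<subseteq> box \<Longrightarrow> c \<in> D \<Longrightarrow> t \<le> i \<Longrightarrow> S (below c t R) (\<tau> c i \<omega>) = S (below c t R) \<omega>"
  by (rule S_flip_gt) (auto simp: below_def)

lemma S_haar_level: "R \<subseteq> box \<Longrightarrow> c \<in> D \<Longrightarrow> haar_level c t (S (fiber c t R))"
  by (auto simp: haar_level_def flip_invariant_def S_fiber_odd S_fiber_flip_gt)

lemma S_below_Suc:
  assumes "R \<subseteq> box"
  shows "S (below c (Suc t) R) \<omega> = S (below c t R) \<omega> + S (fiber c t R) \<omega>"
proof -
  have "below c (Suc t) R = below c t R \<union> fiber c t R" "below c t R \<inter> fiber c t R = {}"
    by (auto simp: below_def fiber_def)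
  moreover have "finite (below c t R)" "finite (fiber c t R)"
    using finite_sub_box[OF assms] by (auto simp: below_def fiber_def)
  ultimately show ?thesis by (simp add: S_def sum.union_disjoint)
qed

lemma S_below: "R \<subseteq> box \<Longrightarrow> S (below c t R) \<omega> = (\<Sum>u<t. S (fiber c u R) \<omega>)"
  by (induction t) (simp_all add: S_below_Suc, simp add: below_def)

lemma below_top: "R \<subseteq> box \<Longrightarrow> c \<in> D \<Longrightarrow> below c (Suc n) R = R"
  by (auto simp: below_def less_Suc_eq_le box_le)

lemma S_fibers: "R \<subseteq> box \<Longrightarrow> c \<in> D \<Longrightarrow> S R \<omega> = (\<Sum>t<Suc n. S (fiber c t R) \<omega>)"
  using S_below[of R c "Suc n" \<omega>] below_top[of R c] by simp

lemma card_fibers: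
  assumes "R \<subseteq> box" "c \<in> D"
  shows "(\<Sum>t<Suc n. card (fiber c t R)) = card R"
proof -
  have "(\<lambda>r. r c) ` R \<subseteq> {..<Suc n}" using box_le[OF assms(1) _ assms(2)] by (auto simp: less_Suc_eq_le)
  from sum.group[OF finite_sub_box[OF assms(1)] _ this, of "\<lambda>_. 1::nat"] show ?thesis
    by (simp add: fiber_def)
qed

text \<open>The square function is applied in one coordinate of \<open>J\<close> after another.
  Injectivity leaves at most one term when all of them are fixed, and the squared bounds of the
  fibers add up to that of \<open>R\<close>.\<close>

lemma bnd_S_inj:
  assumes "finite J" "J \<subseteq> D" "R \<subseteq> box" "inj_on (\<lambda>r. restrict r J) R" and m: "1 \<le> m"
  shows "bnd \<Omega> (2*m) (S R) (sqrt ((2 * real m ^ 3) ^ card J * real (card R)))"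
  using assms(1-4)
proof (induction J arbitrary: R rule: finite_induct)
  case empty
  have "card R \<le> 1"
  proof (rule ccontr)
    assume "\<not> card R \<le> 1"
    then obtain r r' where "r \<in> R" "r' \<in> R" "r \<noteq> r'"
      by (metis card_le_Suc0_iff_eq One_nat_def finite_sub_box empty.prems(2))
    then show False using inj_onD[OF empty.prems(3), of r r'] by (simp add: restrict_def)
  qed
  then have "card R = 0 \<or> card R = 1" by linarith
  then have "real (card R) \<le> sqrt (real (card R))" by auto
  then show ?case using S_abs_le[OF empty.prems(2)]
    by (intro bnd_pointwise finite_space space_nonempty) (auto intro: order_trans)
next
  case (insert c J)
  let ?K = "2 * real m ^ 3"
  have c: "c \<in> D" using insert by simp
  have fib: "bnd \<Omega> (2*m) (S (fiber c t R)) (sqrt (?K ^ card J * real (card (fiber c t R))))" for t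
  proof (rule insert.IH)
    show "inj_on (\<lambda>r. restrict r J) (fiber c t R)"
    proof (rule inj_onI)
      fix r r' assume r: "r \<in> fiber c t R" "r' \<in> fiber c t R" "restrict r J = restrict r' J"
      then have "r j = r' j" if "j \<in> insert c J" for j
        using that r by (metis (mono_tags, lifting) fiber_def insert_iff mem_Collect_eq restrict_apply')
      then have "restrict r (insert c J) = restrict r' (insert c J)" by (auto simp: restrict_def)
      with r show "r = r'" using inj_onD[OF insert.prems(3), of r r'] by (simp add: fiber_def)
    qed
  qed (use insert.prems in \<open>auto simp: fiber_def\<close>)
  have "bnd \<Omega> m (\<lambda>\<omega>. \<Sum>t<Suc n. (S (fiber c t R) \<omega>)\<^sup>2) (\<Sum>t<Suc n. (sqrt (?K ^ card J * real (card (fiber c t R))))\<^sup>2)"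
    by (intro bnd_sum bnd_square fib finite_space space_nonempty m)
  also have "(\<Sum>t<Suc n. (sqrt (?K ^ card J * real (card (fiber c t R))))\<^sup>2) = ?K ^ card J * real (card R)"
    by (simp add: card_fibers[OF insert.prems(2) c, symmetric] sum_distrib_left distrib_left)
  finally have "bnd \<Omega> (2*m) (\<lambda>\<omega>. \<Sum>t<Suc n. S (fiber c t R) \<omega>) (sqrt (?K * (?K ^ card J * real (card R))))"
    by (rule bnd_sum_haar[where c = c, OF S_haar_level[OF insert.prems(2) c] dominated_refl m])
  then show ?case
    by (rule bnd_cong[THEN bnd_weaken]) (use insert in \<open>auto simp: S_fibers[OF insert.prems(2) c] algebra_simps\<close>)
qed

lemma bnd_S:
  assumes "R \<subseteq> box" "1 \<le> m"
  shows "bnd \<Omega> (2*m) (S R) (sqrt ((2 * real m ^ 3) ^ card D * real (card R)))"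
proof (rule bnd_S_inj[OF finite_D order_refl assms(1) _ assms(2)])
  show "inj_on (\<lambda>r. restrict r D) R"
    using assms(1) by (auto intro!: inj_onI simp: box_def PiE_iff subset_iff extensional_restrict)
qed

lemma bnd_S_double:
  assumes "R \<subseteq> box" "1 \<le> m"
  shows "bnd \<Omega> (2*(2*m)) (S R) (sqrt (E m * real (card R)))"
  using bnd_S[OF assms(1), of "2*m"] assms(2) by (simp add: E_def power_mult_distrib)

lemma E_ge_1: "1 \<le> m \<Longrightarrow> 1 \<le> E m"
proof -
  assume "1 \<le> m"
  then have "1 \<le> real m ^ 3" by (intro one_le_power) simp
  then show ?thesis unfolding E_def by (intro one_le_power) simp
qed

text \<open>Multiplying the odd factor by the whole sum over \<open>R'\<close> instead of its part of lower level
  only adds terms that are orthogonal to the original ones, digit by digit.\<close>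

lemma bnd_top_part:
  fixes R R' :: "'i \<Rightarrow> ('c \<Rightarrow> nat) set"
  assumes fin: "finite I" and R: "\<And>s. s \<in> I \<Longrightarrow> R s \<subseteq> box" and R': "\<And>s. s \<in> I \<Longrightarrow> R' s \<subseteq> box"
    and j: "j \<in> D" and m: "1 \<le> m"
    and \<beta>: "\<And>s. s \<in> I \<Longrightarrow> real (card (R s)) \<le> \<beta>" and \<gamma>: "\<And>s. s \<in> I \<Longrightarrow> real (card (R' s)) \<le> \<gamma>"
    and \<beta>0: "0 \<le> \<beta>" and \<gamma>0: "0 \<le> \<gamma>"
    and h: "\<And>s s'. s \<in> I \<Longrightarrow> s' \<in> I \<Longrightarrow> s \<noteq> s' \<Longrightarrow>
        bnd \<Omega> (2*m) (\<lambda>\<omega>. \<Sum>t<Suc n. S (fiber j t (R s)) \<omega> * S (fiber j t (R s')) \<omega>) h"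
    and h0: "0 \<le> h"
  shows "bnd \<Omega> (2*m) (\<lambda>\<omega>. \<Sum>t<Suc n. \<Sum>s\<in>I. S (fiber j t (R s)) \<omega> * S (below j t (R' s)) \<omega>)
    (sqrt (2 * real m ^ 3 * (((real (card I))\<^sup>2 * h + real (card I) * (E m * \<beta>)) * (E m * \<gamma>))))"
proof (rule bnd_sum_haar[where c = j and \<phi> = "\<lambda>t \<omega>. \<Sum>s\<in>I. S (fiber j t (R s)) \<omega> * S (R' s) \<omega>", OF _ _ m])
  fix t assume t: "t < Suc n"
  show "haar_level j t (\<lambda>\<omega>. \<Sum>s\<in>I. S (fiber j t (R s)) \<omega> * S (below j t (R' s)) \<omega>)"
    by (simp add: haar_level_def flip_invariant_def sum_negf S_fiber_odd[OF R j]
        S_fiber_flip_gt[OF R j] S_below_flip[OF R' j] cong: sum.cong)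
  show "dominated j t (\<lambda>\<omega>. \<Sum>s\<in>I. S (fiber j t (R s)) \<omega> * S (below j t (R' s)) \<omega>)
     (\<lambda>\<omega>. \<Sum>s\<in>I. S (fiber j t (R s)) \<omega> * S (R' s) \<omega>)"
    unfolding dominated_def
  proof (intro allI impI)
    fix C :: "'a \<Rightarrow> real" assume C0: "\<forall>\<omega>. 0 \<le> C \<omega>" and C: "flip_invariant j t C"
    define P where "P l \<omega> = (\<Sum>s\<in>I. S (fiber j t (R s)) \<omega> * S (below j l (R' s)) \<omega>)" for l \<omega>
    define Q where "Q l \<omega> = (\<Sum>s\<in>I. S (fiber j t (R s)) \<omega> * S (fiber j l (R' s)) \<omega>)" for l \<omega>
    have P_Suc: "P (Suc l) \<omega> = P l \<omega> + Q l \<omega>" for l \<omega>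
      unfolding P_def Q_def using R' by (simp add: S_below_Suc sum.distrib distrib_left)
    have gt: "P l (\<tau> j l \<omega>) = P l \<omega>" "Q l (\<tau> j l \<omega>) = - Q l \<omega>" if "t < l" for l \<omega>
      using that by (simp_all add: P_def Q_def sum_negf S_fiber_odd[OF R' j]
          S_fiber_flip_gt[OF R j] S_below_flip[OF R' j] cong: sum.cong)
    have eq: "P t (\<tau> j t \<omega>) = - P t \<omega>" "Q t (\<tau> j t \<omega>) = Q t \<omega>" for \<omega>
      by (simp_all add: P_def Q_def sum_negf S_fiber_odd[OF R j] S_fiber_odd[OF R' j]
          S_below_flip[OF R' j] cong: sum.cong)
    have "avg \<Omega> (\<lambda>\<omega>. C \<omega> * (P t \<omega>)\<^sup>2) \<le> avg \<Omega> (\<lambda>\<omega>. C \<omega> * (P l \<omega>)\<^sup>2)" if "t \<le> l" for l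
      using that
    proof (induction l rule: nat_induct_at_least)
      case (Suc l)
      have "avg \<Omega> (\<lambda>\<omega>. C \<omega> * (P l \<omega>)\<^sup>2) \<le> avg \<Omega> (\<lambda>\<omega>. C \<omega> * (P (Suc l) \<omega>)\<^sup>2)"
      proof (rule avg_le_flip[where c = j and i = l])
        fix \<omega>
        have "0 \<le> 2 * C \<omega> * (Q l \<omega>)\<^sup>2" using C0 by simp
        moreover have "C (\<tau> j l \<omega>) = C \<omega>" using C Suc.hyps by (simp add: flip_invariant_def)
        \<comment> \<open>For \<open>l > t\<close> the new part \<open>Q l\<close> is odd and
          \<open>P l\<close> even; for \<open>l = t\<close> the level \<open>t\<close> occurs in
          both factors of \<open>Q\<close>, so that \<open>Q\<close> is even and \<open>P\<close>
          odd. Either way the cross term cancels under the flip.\<close>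
        moreover have "P l (\<tau> j l \<omega>) = - P l \<omega> \<and> Q l (\<tau> j l \<omega>) = Q l \<omega> \<or>
            P l (\<tau> j l \<omega>) = P l \<omega> \<and> Q l (\<tau> j l \<omega>) = - Q l \<omega>"
          using gt[of l \<omega>] eq[of \<omega>] Suc.hyps by (cases "t = l") simp_all
        ultimately show "C \<omega> * (P l \<omega>)\<^sup>2 + C (\<tau> j l \<omega>) * (P l (\<tau> j l \<omega>))\<^sup>2
          \<le> C \<omega> * (P (Suc l) \<omega>)\<^sup>2 + C (\<tau> j l \<omega>) * (P (Suc l) (\<tau> j l \<omega>))\<^sup>2"
          by (elim disjE) (simp_all add: P_Suc power2_eq_square algebra_simps)
      qed
      with Suc.IH show ?case by linarith
    qed simp
    from this[of "Suc n"] t have "avg \<Omega> (\<lambda>\<omega>. C \<omega> * (P t \<omega>)\<^sup>2) \<le> avg \<Omega> (\<lambda>\<omega>. C \<omega> * (P (Suc n) \<omega>)\<^sup>2)" by simp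
    moreover have "P (Suc n) \<omega> = (\<Sum>s\<in>I. S (fiber j t (R s)) \<omega> * S (R' s) \<omega>)" for \<omega>
      unfolding P_def by (intro sum.cong refl arg_cong2[of _ _ _ _ "(*)"]) (simp add: below_top[OF R' j])
    ultimately show "avg \<Omega> (\<lambda>\<omega>. C \<omega> * (\<Sum>s\<in>I. S (fiber j t (R s)) \<omega> * S (below j t (R' s)) \<omega>)\<^sup>2)
       \<le> avg \<Omega> (\<lambda>\<omega>. C \<omega> * (\<Sum>s\<in>I. S (fiber j t (R s)) \<omega> * S (R' s) \<omega>)\<^sup>2)"
      by (simp add: P_def)
  qed
next
  \<comment> \<open>With the truncation gone, the second factor does not depend on \<open>t\<close>.
    Expanding the square therefore gives \<open>?H s s'\<close>, which contains the sum over
    \<open>t\<close>, times \<open>?G s s'\<close>. Off the diagonal \<open>h\<close> is available;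
    on the diagonal there is no cancellation, but it has only \<open>card I\<close> terms.\<close>
  let ?H = "\<lambda>s s' \<omega>. \<Sum>t<Suc n. S (fiber j t (R s)) \<omega> * S (fiber j t (R s')) \<omega>"
  let ?G = "\<lambda>s s' \<omega>. S (R' s) \<omega> * S (R' s') \<omega>"
  have m2: "1 \<le> 2 * m" using m by simp
  have E0: "0 \<le> E m" using E_ge_1[OF m] by simp
  have G: "bnd \<Omega> (2*m) (?G s s') (E m * \<gamma>)" if "s \<in> I" "s' \<in> I" for s s'
  proof -
    have "bnd \<Omega> (2*(2*m)) (S (R' s)) (sqrt (E m * \<gamma>))" if "s \<in> I" for s
      by (rule bnd_weaken[OF bnd_S_double[OF R'[OF that] m]]) (simp add: mult_left_mono[OF \<gamma>[OF that] E0])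
    from bnd_mult[OF finite_space space_nonempty m2 this this] that E0 \<gamma>0 show ?thesis by simp
  qed
  have diag: "bnd \<Omega> (2*m) (?H s s) (E m * \<beta>)" if s: "s \<in> I" for s
  proof -
    have "bnd \<Omega> (2*m) (\<lambda>\<omega>. \<Sum>t<Suc n. (S (fiber j t (R s)) \<omega>)\<^sup>2) (\<Sum>t<Suc n. (sqrt (E m * real (card (fiber j t (R s)))))\<^sup>2)"
      by (intro bnd_sum bnd_square bnd_S_double finite_space space_nonempty m m2)
        (rule order_trans[OF fiber_subset R[OF s]])
    also have "(\<Sum>t<Suc n. (sqrt (E m * real (card (fiber j t (R s)))))\<^sup>2) = E m * real (card (R s))"
      using E0 by (simp add: card_fibers[OF R[OF s] j, symmetric] sum_distrib_left distrib_left)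
    finally show ?thesis
      by (rule bnd_weaken[OF bnd_cong]) (simp_all add: power2_eq_square mult_left_mono[OF \<beta>[OF s] E0])
  qed
  have HH: "bnd \<Omega> (2*m) (?H s s') (if s = s' then E m * \<beta> else h)" if "s \<in> I" "s' \<in> I" for s s'
    using h[OF that] diag[OF that(1)] by (cases "s = s'") simp_all
  have "bnd \<Omega> m (\<lambda>\<omega>. \<Sum>s\<in>I. \<Sum>s'\<in>I. ?H s s' \<omega> * ?G s s' \<omega>)
     (\<Sum>s\<in>I. \<Sum>s'\<in>I. (if s = s' then E m * \<beta> else h) * (E m * \<gamma>))"
    by (intro bnd_sum[OF finite_space space_nonempty m] bnd_mult[OF finite_space space_nonempty m] HH G)
  moreover have "(\<Sum>s\<in>I. \<Sum>s'\<in>I. ?H s s' \<omega> * ?G s s' \<omega>) = (\<Sum>t<Suc n. (\<Sum>s\<in>I. S (fiber j t (R s)) \<omega> * S (R' s) \<omega>)\<^sup>2)" for \<omega>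
  proof -
    have "(\<Sum>t<Suc n. (\<Sum>s\<in>I. S (fiber j t (R s)) \<omega> * S (R' s) \<omega>)\<^sup>2)
       = (\<Sum>t<Suc n. \<Sum>s\<in>I. \<Sum>s'\<in>I. (S (fiber j t (R s)) \<omega> * S (fiber j t (R s')) \<omega>) * ?G s s' \<omega>)"
      unfolding power2_eq_square sum_product by (intro sum.cong refl) (simp add: algebra_simps)
    also have "\<dots> = (\<Sum>s\<in>I. \<Sum>t<Suc n. \<Sum>s'\<in>I. (S (fiber j t (R s)) \<omega> * S (fiber j t (R s')) \<omega>) * ?G s s' \<omega>)"
      by (rule sum.swap)
    also have "\<dots> = (\<Sum>s\<in>I. \<Sum>s'\<in>I. \<Sum>t<Suc n. (S (fiber j t (R s)) \<omega> * S (fiber j t (R s')) \<omega>) * ?G s s' \<omega>)"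
      by (intro sum.cong refl sum.swap)
    finally show ?thesis by (simp only: sum_distrib_right)
  qed
  moreover have "(\<Sum>s\<in>I. \<Sum>s'\<in>I. (if s = s' then E m * \<beta> else h) * (E m * \<gamma>))
     \<le> ((real (card I))\<^sup>2 * h + real (card I) * (E m * \<beta>)) * (E m * \<gamma>)"
  proof -
    have "(\<Sum>s\<in>I. \<Sum>s'\<in>I. (if s = s' then E m * \<beta> else h)) \<le> (\<Sum>s\<in>I. \<Sum>s'\<in>I. h + (if s = s' then E m * \<beta> else 0))"
      using h0 by (intro sum_mono) auto
    also have "\<dots> = (real (card I))\<^sup>2 * h + real (card I) * (E m * \<beta>)"
      using fin by (simp add: sum.distrib power2_eq_square distrib_left)
    finally show ?thesis unfolding sum_distrib_right[symmetric]
      by (rule mult_right_mono) (use E0 \<gamma>0 in simp)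
  qed
  ultimately show "bnd \<Omega> m (\<lambda>\<omega>. \<Sum>t<Suc n. (\<Sum>s\<in>I. S (fiber j t (R s)) \<omega> * S (R' s) \<omega>)\<^sup>2)
     (((real (card I))\<^sup>2 * h + real (card I) * (E m * \<beta>)) * (E m * \<gamma>))"
    by (simp only: bnd_weaken)
qed

section \<open>Slices of fixed degree and the coincidence estimate\<close>

text \<open>\<open>U\<close> holds the coordinates that may still vary, \<open>N\<close> their total
  degree. The degree is an integer because values of coordinates being fixed are subtracted from it
  without knowing that they are smaller.\<close>

definition slice :: "'c set \<Rightarrow> int \<Rightarrow> ('c \<Rightarrow> nat) set \<Rightarrow> bool" where
  "slice U N R \<longleftrightarrow> R \<subseteq> box \<and> U \<subseteq> D \<and> (\<forall>r\<in>R. (\<Sum>j\<in>U. int (r j)) = N) \<and>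
     (\<forall>r\<in>R. \<forall>r'\<in>R. \<forall>j\<in>D - U. r j = r' j)"

lemma slice_box: "slice U N R \<Longrightarrow> R \<subseteq> box" by (simp add: slice_def)

lemma slice_fiber:
  assumes "slice (insert c U) N R" "c \<notin> U"
  shows "slice U (N - int t) (fiber c t R)"
proof -
  have "finite U" using assms finite_D finite_subset by (auto simp: slice_def)
  then show ?thesis using assms by (fastforce simp: slice_def fiber_def)
qed

text \<open>The degree determines coordinate \<open>j\<close> from the remaining ones in
  \<open>U\<close>.\<close>

lemma slice_card:
  assumes "slice U N R" "j \<in> U"
  shows "card R \<le> Suc n ^ (card U - 1)"
proof -
  have R: "R \<subseteq> box" "U \<subseteq> D" using assms by (auto simp: slice_def)
  have fU: "finite U" using R(2) finite_D finite_subset by blast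
  have "inj_on (\<lambda>r. restrict r (U - {j})) R"
  proof (rule inj_onI)
    fix r r' assume r: "r \<in> R" "r' \<in> R" and eq: "restrict r (U - {j}) = restrict r' (U - {j})"
    have 1: "r i = r' i" if "i \<in> U - {j}" for i using eq that by (metis restrict_apply')
    have "(\<Sum>i\<in>U. int (r i)) = (\<Sum>i\<in>U. int (r' i))" using assms r by (simp add: slice_def)
    then have 2: "r j = r' j"
      using fU assms(2) 1 by (simp add: sum.remove[of U j])
    have 3: "r i = r' i" if "i \<in> D - U" for i using assms(1) r that by (auto simp: slice_def)
    show "r = r'"
    proof (rule PiE_ext[of r D "\<lambda>_. {..n}" r'])
      show "r \<in> D \<rightarrow>\<^sub>E {..n}" "r' \<in> D \<rightarrow>\<^sub>E {..n}" using R r by (auto simp: box_def)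
    qed (use 1 2 3 in blast)
  qed
  then have "card R = card ((\<lambda>r. restrict r (U - {j})) ` R)" by (simp add: card_image)
  also have "\<dots> \<le> card ((U - {j}) \<rightarrow>\<^sub>E {..n})"
  proof (intro card_mono finite_PiE image_subsetI PiE_I)
    fix r i assume "r \<in> R" "i \<in> U - {j}"
    then show "restrict r (U - {j}) i \<in> {..n}" using box_le[OF R(1), of r i] R(2) by auto
  qed (use fU in auto)
  also have "\<dots> = Suc n ^ (card U - 1)" using fU assms(2) by (simp add: card_PiE)
  finally show ?thesis .
qed

lemma B_ge: "1 \<le> m \<Longrightarrow> E m \<le> B m" "1 \<le> m \<Longrightarrow> 1 \<le> B m" "2 * real m ^ 3 * E m \<le> B m"
proof -
  assume "1 \<le> m"
  then have "1 \<le> real m ^ 3" by (intro one_le_power) simp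
  then have 1: "1 \<le> 16 * real m ^ 3" by simp
  have "B m = (16 * real m ^ 3) * E m" by (simp add: B_def E_def)
  moreover have "1 * E m \<le> (16 * real m ^ 3) * E m"
    by (intro mult_right_mono 1) (use E_ge_1[OF \<open>1 \<le> m\<close>] in simp)
  ultimately show "E m \<le> B m" by simp
  then show "1 \<le> B m" using E_ge_1[OF \<open>1 \<le> m\<close>] by simp
next
  have "2 * real m ^ 3 * E m \<le> 16 * real m ^ 3 * E m"
    by (intro mult_right_mono) (auto simp: E_def)
  then show "2 * real m ^ 3 * E m \<le> B m" by (simp add: B_def E_def)
qed

text \<open>Exponents for \<open>bnd_top_part\<close> with \<open>L\<close> values of
  \<open>s\<close>. The off-diagonal terms contribute \<open>k + 2 - \<delta>\<close>, the diagonal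
  ones \<open>k + 1\<close>, which is no worse since \<open>\<delta> \<le> 1\<close>. The square
  root halves the gain \<open>\<delta>\<close>.\<close>

lemma top_constant_bound:
  assumes m: "1 \<le> m" and X: "B m \<le> X" and \<delta>: "0 \<le> \<delta>" "\<delta> \<le> 1" and L: "L = real (Suc n)"
  shows "sqrt (2 * real m ^ 3 * ((L\<^sup>2 * (X * L powr (real k - \<delta>)) + L * (E m * L ^ k)) * (E m * L ^ k')))
      \<le> 2 * X * L powr ((real k + real k') / 2 + 1 - \<delta> / 2)"
proof -
  have L1: "1 \<le> L" using L by simp
  have B: "E m \<le> X" "1 \<le> X" "2 * real m ^ 3 * E m \<le> X" using B_ge(1,2)[OF m] B_ge(3)[of m] X by auto
  have E0: "0 \<le> E m" using E_ge_1[OF m] by simp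
  have "L * (E m * L ^ k) = E m * L powr (real k + 1)"
    using L1 by (simp add: powr_add powr_realpow algebra_simps)
  also have "\<dots> \<le> X * L powr (real k + 2 - \<delta>)"
    using B E0 L1 \<delta> by (intro mult_mono powr_mono) auto
  finally have 1: "L * (E m * L ^ k) \<le> X * L powr (real k + 2 - \<delta>)" .
  have "L powr (real k + 2 - \<delta>) = L powr (2 + (real k - \<delta>))" by (simp add: algebra_simps)
  also have "\<dots> = L\<^sup>2 * L powr (real k - \<delta>)"
    using L1 by (simp only: powr_add) simp
  finally have 2: "L\<^sup>2 * (X * L powr (real k - \<delta>)) = X * L powr (real k + 2 - \<delta>)" by simp
  have "2 * real m ^ 3 * ((L\<^sup>2 * (X * L powr (real k - \<delta>)) + L * (E m * L ^ k)) * (E m * L ^ k'))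
     \<le> 2 * real m ^ 3 * ((2 * (X * L powr (real k + 2 - \<delta>))) * (E m * L ^ k'))"
    unfolding 2 using 1 E0 L1 by (intro mult_left_mono mult_right_mono) auto
  also have "\<dots> = (2 * real m ^ 3 * E m) * (2 * (X * (L powr (real k + 2 - \<delta>) * L ^ k')))"
    by (simp add: algebra_simps)
  also have "\<dots> \<le> X * (2 * (X * (L powr (real k + 2 - \<delta>) * L ^ k')))"
    using B L1 by (intro mult_right_mono) auto
  also have "\<dots> \<le> (2 * X)\<^sup>2 * (L powr (real k + 2 - \<delta>) * L ^ k')"
    using B L1 by (simp add: power2_eq_square mult_right_mono)
  also have "L powr (real k + 2 - \<delta>) * L ^ k' = (L powr ((real k + real k') / 2 + 1 - \<delta> / 2))\<^sup>2"
  proof -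
    have "(real k + real k') / 2 + 1 - \<delta> / 2 + ((real k + real k') / 2 + 1 - \<delta> / 2) = real k + 2 - \<delta> + real k'"
      by (simp add: field_simps)
    then show ?thesis
      using L1 unfolding power2_eq_square powr_add[symmetric] by (simp only: powr_add) (simp add: powr_realpow)
  qed
  finally show ?thesis using B L1
    by (intro real_le_lsqrt) (auto simp: power_mult_distrib)
qed

text \<open>Without cancellation the exponent would be \<open>card U\<close>: one sum over the
  shared value and two factors of exponent \<open>(card U - 1) / 2\<close>. The two families are
  compared in a coordinate \<open>j\<close> of \<open>U\<close>. Where their levels differ,
  \<open>bnd_top_part\<close> leads to coincidences in \<open>j\<close> between fibers of one family
  at \<open>s \<noteq> s'\<close>, which have distinct degrees; where they agree, \<open>j\<close>
  is fixed on both sides and the degrees stay distinct. Each time \<open>U\<close> loses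
  \<open>j\<close>.\<close>

lemma bnd_coincidence:
  assumes "finite U" "\<sigma> \<notin> U" "slice (insert \<sigma> U) N R" "slice (insert \<sigma> U) N' R'" "N \<noteq> N'" and m: "1 \<le> m"
  shows "bnd \<Omega> (2*m) (\<lambda>\<omega>. \<Sum>s<Suc n. S (fiber \<sigma> s R) \<omega> * S (fiber \<sigma> s R') \<omega>)
     (5 ^ card U * B m * real (Suc n) powr (real (card U) - (1/2) ^ card U))"
  using assms(1-5)
proof (induction U arbitrary: \<sigma> N N' R R' rule: finite_induct)
  case empty
  have "S (fiber \<sigma> s R) \<omega> * S (fiber \<sigma> s R') \<omega> = 0" for s \<omega>
  proof -
    have "fiber \<sigma> s R = {} \<or> fiber \<sigma> s R' = {}"
      using empty.prems by (auto simp: slice_def fiber_def)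
    then show ?thesis by auto
  qed
  then have z: "(\<lambda>\<omega>. \<Sum>s<Suc n. S (fiber \<sigma> s R) \<omega> * S (fiber \<sigma> s R') \<omega>) = (\<lambda>_. 0)"
    by (intro ext sum.neutral) blast
  show ?case unfolding z
    by (rule bnd_zero) (use m B_ge(2)[OF m] in auto)
next
  case (insert j U)
  define k where "k = card U"
  define L where "L = real (Suc n)"
  define X where "X = 5 ^ k * B m"
  define \<delta> :: real where "\<delta> = (1/2) ^ k"
  have \<delta>: "0 \<le> \<delta>" "\<delta> \<le> 1" by (auto simp: \<delta>_def power_le_one)
  have "1 * B m \<le> 5 ^ k * B m" using B_ge(2)[OF m] by (intro mult_right_mono) auto
  then have X: "B m \<le> X" "0 \<le> X" using B_ge(2)[OF m] by (auto simp: X_def)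
  have L1: "1 \<le> L" by (simp add: L_def)
  have m2: "1 \<le> 2 * m" using m by simp
  have \<sigma>: "\<sigma> \<noteq> j" "\<sigma> \<notin> U" using insert by auto
  have box: "R \<subseteq> box" "R' \<subseteq> box" using insert.prems slice_box by blast+
  have jD: "j \<in> D" using insert.prems by (auto simp: slice_def)
  define h where "h = X * L powr (real k - \<delta>)"
  have h0: "0 \<le> h" using X by (simp add: h_def)
  have IH: "bnd \<Omega> (2*m) (\<lambda>\<omega>. \<Sum>s<Suc n. S (fiber \<sigma>' s R1) \<omega> * S (fiber \<sigma>' s R2) \<omega>) h"
    if "\<sigma>' \<notin> U" "slice (insert \<sigma>' U) N1 R1" "slice (insert \<sigma>' U) N2 R2" "N1 \<noteq> N2" for \<sigma>' N1 N2 R1 R2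
    using insert.IH[OF that] by (simp add: h_def X_def L_def k_def \<delta>_def)
  have card_le: "real (card (fiber \<sigma> s R1)) \<le> L ^ k" if "slice (insert \<sigma> (insert j U)) N1 R1" for s N1 R1
  proof -
    have "slice (insert j U) (N1 - int s) (fiber \<sigma> s R1)" by (rule slice_fiber[OF that]) (use insert in auto)
    from slice_card[OF this, of j] have "card (fiber \<sigma> s R1) \<le> Suc n ^ k"
      using insert by (simp add: k_def)
    then show ?thesis unfolding L_def by (metis of_nat_le_iff of_nat_power)
  qed
  have top: "bnd \<Omega> (2*m) (\<lambda>\<omega>. \<Sum>t<Suc n. \<Sum>s<Suc n. S (fiber j t (fiber \<sigma> s R1)) \<omega> * S (below j t (fiber \<sigma> s R2)) \<omega>)
      (2 * X * L powr (real k + 1 - \<delta> / 2))"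
    if R1: "slice (insert \<sigma> (insert j U)) N1 R1" and R2: "slice (insert \<sigma> (insert j U)) N2 R2" for N1 N2 R1 R2
  proof -
    have "bnd \<Omega> (2*m) (\<lambda>\<omega>. \<Sum>t<Suc n. \<Sum>s\<in>{..<Suc n}. S (fiber j t (fiber \<sigma> s R1)) \<omega> * S (below j t (fiber \<sigma> s R2)) \<omega>)
      (sqrt (2 * real m ^ 3 * (((real (card {..<Suc n}))\<^sup>2 * h + real (card {..<Suc n}) * (E m * L ^ k)) * (E m * L ^ k))))"
    proof (rule bnd_top_part[OF _ _ _ jD m])
      fix s s' :: nat assume ss: "s \<noteq> s'"
      show "bnd \<Omega> (2*m) (\<lambda>\<omega>. \<Sum>t<Suc n. S (fiber j t (fiber \<sigma> s R1)) \<omega> * S (fiber j t (fiber \<sigma> s' R1)) \<omega>) h"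
        by (rule IH[OF insert.hyps(2) slice_fiber[OF R1] slice_fiber[OF R1]]) (use insert ss in auto)
    qed (simp_all add: h0 L1 order_trans[OF zero_le_one L1] order_trans[OF fiber_subset slice_box[OF R1]]
        order_trans[OF fiber_subset slice_box[OF R2]] card_le[OF R1] card_le[OF R2])
    then show ?thesis
      by (rule bnd_weaken)
        (use top_constant_bound[OF m X(1) \<delta> L_def, of k k] in \<open>simp add: h_def L_def[symmetric] del: of_nat_Suc\<close>)
  qed
  have eqpart: "bnd \<Omega> (2*m) (\<lambda>\<omega>. \<Sum>t<Suc n. \<Sum>s<Suc n. S (fiber \<sigma> s (fiber j t R)) \<omega> * S (fiber \<sigma> s (fiber j t R')) \<omega>)
      (\<Sum>t<Suc n. h)"
  proof (rule bnd_sum[OF finite_space space_nonempty m2])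
    fix t
    have "slice (insert \<sigma> U) (M - int t) (fiber j t R1)" if "slice (insert \<sigma> (insert j U)) M R1" for M R1
      by (rule slice_fiber) (use that insert \<sigma> in \<open>auto simp: insert_commute\<close>)
    then show "bnd \<Omega> (2*m) (\<lambda>\<omega>. \<Sum>s<Suc n. S (fiber \<sigma> s (fiber j t R)) \<omega> * S (fiber \<sigma> s (fiber j t R')) \<omega>) h"
      using insert.prems
      by (intro IH[OF \<sigma>(2), of "N - int t" _ "N' - int t"]) auto
  qed
  have split: "(\<Sum>s<Suc n. S (fiber \<sigma> s R) \<omega> * S (fiber \<sigma> s R') \<omega>)
     = (\<Sum>t<Suc n. \<Sum>s<Suc n. S (fiber j t (fiber \<sigma> s R)) \<omega> * S (below j t (fiber \<sigma> s R')) \<omega>)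
     + (\<Sum>t<Suc n. \<Sum>s<Suc n. S (fiber j t (fiber \<sigma> s R')) \<omega> * S (below j t (fiber \<sigma> s R)) \<omega>)
     + (\<Sum>t<Suc n. \<Sum>s<Suc n. S (fiber \<sigma> s (fiber j t R)) \<omega> * S (fiber \<sigma> s (fiber j t R')) \<omega>)" for \<omega>
  proof -
    have b: "fiber \<sigma> s R \<subseteq> box" "fiber \<sigma> s R' \<subseteq> box" for s using box by (auto simp: fiber_def)
    have "S (fiber \<sigma> s R) \<omega> * S (fiber \<sigma> s R') \<omega> =
       (\<Sum>t<Suc n. S (fiber j t (fiber \<sigma> s R)) \<omega> * S (below j t (fiber \<sigma> s R')) \<omega>)
     + (\<Sum>t<Suc n. S (fiber j t (fiber \<sigma> s R')) \<omega> * S (below j t (fiber \<sigma> s R)) \<omega>)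
     + (\<Sum>t<Suc n. S (fiber \<sigma> s (fiber j t R)) \<omega> * S (fiber \<sigma> s (fiber j t R')) \<omega>)" for s
      unfolding S_fibers[OF b(1) jD] S_fibers[OF b(2) jD] S_below[OF b(1)] S_below[OF b(2)]
      unfolding sum_mult_sum_split fiber_commute[of \<sigma> s j]
      by (simp only: mult.commute)
    then have "(\<Sum>s<Suc n. S (fiber \<sigma> s R) \<omega> * S (fiber \<sigma> s R') \<omega>)
     = (\<Sum>s<Suc n. \<Sum>t<Suc n. S (fiber j t (fiber \<sigma> s R)) \<omega> * S (below j t (fiber \<sigma> s R')) \<omega>)
     + (\<Sum>s<Suc n. \<Sum>t<Suc n. S (fiber j t (fiber \<sigma> s R')) \<omega> * S (below j t (fiber \<sigma> s R)) \<omega>)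
     + (\<Sum>s<Suc n. \<Sum>t<Suc n. S (fiber \<sigma> s (fiber j t R)) \<omega> * S (fiber \<sigma> s (fiber j t R')) \<omega>)"
      by (simp only: sum.distrib)
    also have "\<dots> = (\<Sum>t<Suc n. \<Sum>s<Suc n. S (fiber j t (fiber \<sigma> s R)) \<omega> * S (below j t (fiber \<sigma> s R')) \<omega>)
     + (\<Sum>t<Suc n. \<Sum>s<Suc n. S (fiber j t (fiber \<sigma> s R')) \<omega> * S (below j t (fiber \<sigma> s R)) \<omega>)
     + (\<Sum>t<Suc n. \<Sum>s<Suc n. S (fiber \<sigma> s (fiber j t R)) \<omega> * S (fiber \<sigma> s (fiber j t R')) \<omega>)"
      by (intro arg_cong2[of _ _ _ _ "(+)"] sum.swap)
    finally show ?thesis .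
  qed
  have "(\<Sum>t<Suc n. h) = X * L powr (1 + (real k - \<delta>))"
    using L1 by (simp only: powr_add) (simp add: h_def L_def algebra_simps)
  also have "\<dots> \<le> X * L powr (real k + 1 - \<delta> / 2)"
    using X L1 \<delta> by (intro mult_left_mono powr_mono) auto
  finally have hs: "(\<Sum>t<Suc n. h) \<le> X * L powr (real k + 1 - \<delta> / 2)" .
  have "bnd \<Omega> (2*m) (\<lambda>\<omega>. \<Sum>s<Suc n. S (fiber \<sigma> s R) \<omega> * S (fiber \<sigma> s R') \<omega>)
     (2 * X * L powr (real k + 1 - \<delta> / 2) + 2 * X * L powr (real k + 1 - \<delta> / 2) + (\<Sum>t<Suc n. h))"
    unfolding split by (intro bnd_add[OF finite_space space_nonempty m2] top[OF insert.prems(2,3)] top[OF insert.prems(3,2)] eqpart)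
  \<comment> \<open>The constant 5 per coordinate: 2 for each of the two strict orders of the levels
    in \<open>j\<close>, and 1 for equality.\<close>
  then have "bnd \<Omega> (2*m) (\<lambda>\<omega>. \<Sum>s<Suc n. S (fiber \<sigma> s R) \<omega> * S (fiber \<sigma> s R') \<omega>)
     (5 * X * L powr (real k + 1 - \<delta> / 2))"
    by (rule bnd_weaken) (use hs in simp)
  then show ?case using insert.hyps by (simp add: X_def L_def k_def \<delta>_def algebra_simps)
qed

text \<open>The order in \<open>j\<close> leaves only one of the three parts of the comparison, and
  its coincidences lie within the family \<open>R\<close>. So the degrees \<open>N\<close> and
  \<open>N'\<close> may be equal here, and the free sets \<open>insert j U\<close> and
  \<open>U'\<close> may differ. Stating the gain with \<open>card D\<close> makes it uniform in
  \<open>U\<close>.\<close>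

lemma bnd_ordered_pair:
  assumes U: "finite U" "j \<notin> U" "\<sigma> \<notin> insert j U" and U': "finite U'" "j \<in> U'" "\<sigma> \<notin> U'"
    and R: "slice (insert \<sigma> (insert j U)) N R" and R': "slice (insert \<sigma> U') N' R'"
    and less: "\<And>r r'. r \<in> R \<Longrightarrow> r' \<in> R' \<Longrightarrow> r' j < r j" and m: "1 \<le> m"
  shows "bnd \<Omega> (2*m) (\<lambda>\<omega>. \<Sum>s<Suc n. S (fiber \<sigma> s R) \<omega> * S (fiber \<sigma> s R') \<omega>)
     (2 * 5 ^ card D * B m * real (Suc n) powr ((real (card (insert j U)) + real (card U')) / 2 - (1/2) ^ card D / 2))"
proof -
  define k where "k = card U"
  define k' where "k' = card U' - 1"
  define L where "L = real (Suc n)"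
  define X where "X = 5 ^ card D * B m"
  define \<delta> :: real where "\<delta> = (1/2) ^ card D"
  have \<delta>: "0 \<le> \<delta>" "\<delta> \<le> 1" by (auto simp: \<delta>_def power_le_one)
  have "1 * B m \<le> 5 ^ card D * B m" using B_ge(2)[OF m] by (intro mult_right_mono) auto
  then have X: "B m \<le> X" "0 \<le> X" using B_ge(2)[OF m] by (auto simp: X_def)
  have L1: "1 \<le> L" by (simp add: L_def)
  have UD: "U \<subseteq> D" and jD: "j \<in> D" using R by (auto simp: slice_def)
  have kD: "k \<le> card D" unfolding k_def by (rule card_mono[OF finite_D UD])
  define h where "h = X * L powr (real k - \<delta>)"
  have h0: "0 \<le> h" using X by (simp add: h_def)
  have fR: "slice (insert j U) (N - int s) (fiber \<sigma> s R)" for s by (rule slice_fiber[OF R U(3)])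
  have fR': "slice U' (N' - int s) (fiber \<sigma> s R')" for s by (rule slice_fiber[OF R' U'(3)])
  have cR: "real (card (fiber \<sigma> s R)) \<le> L ^ k" for s
    using slice_card[OF fR, of j s] U unfolding L_def k_def by (simp flip: of_nat_power of_nat_Suc)
  have cR': "real (card (fiber \<sigma> s R')) \<le> L ^ k'" for s
    using slice_card[OF fR' U'(2), of s] unfolding L_def k'_def by (simp flip: of_nat_power of_nat_Suc)
  have "bnd \<Omega> (2*m) (\<lambda>\<omega>. \<Sum>t<Suc n. \<Sum>s\<in>{..<Suc n}. S (fiber j t (fiber \<sigma> s R)) \<omega> * S (below j t (fiber \<sigma> s R')) \<omega>)
      (sqrt (2 * real m ^ 3 * (((real (card {..<Suc n}))\<^sup>2 * h + real (card {..<Suc n}) * (E m * L ^ k)) * (E m * L ^ k'))))"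
  proof (rule bnd_top_part[OF _ _ _ jD m])
    fix s s' :: nat assume ss: "s \<noteq> s'"
    have "bnd \<Omega> (2*m) (\<lambda>\<omega>. \<Sum>t<Suc n. S (fiber j t (fiber \<sigma> s R)) \<omega> * S (fiber j t (fiber \<sigma> s' R)) \<omega>)
       (5 ^ card U * B m * L powr (real (card U) - (1/2) ^ card U))"
      unfolding L_def by (rule bnd_coincidence[OF U(1,2) fR fR _ m]) (use ss in simp)
    then show "bnd \<Omega> (2*m) (\<lambda>\<omega>. \<Sum>t<Suc n. S (fiber j t (fiber \<sigma> s R)) \<omega> * S (fiber j t (fiber \<sigma> s' R)) \<omega>) h"
    proof (rule bnd_weaken)
      have "(1/2::real) ^ card D \<le> (1/2) ^ card U" using kD by (intro power_decreasing) (auto simp: k_def)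
      then show "5 ^ card U * B m * L powr (real (card U) - (1/2) ^ card U) \<le> h"
        unfolding h_def X_def k_def[symmetric] \<delta>_def using kD B_ge(2)[OF m] L1
        by (intro mult_mono powr_mono power_increasing) auto
    qed
  qed (simp_all add: h0 order_trans[OF zero_le_one L1] order_trans[OF fiber_subset slice_box[OF R]]
      order_trans[OF fiber_subset slice_box[OF R']] cR cR')
  then have "bnd \<Omega> (2*m) (\<lambda>\<omega>. \<Sum>t<Suc n. \<Sum>s<Suc n. S (fiber j t (fiber \<sigma> s R)) \<omega> * S (below j t (fiber \<sigma> s R')) \<omega>)
     (2 * X * L powr ((real k + real k') / 2 + 1 - \<delta> / 2))"
    by (rule bnd_weaken)
      (use top_constant_bound[OF m X(1) \<delta> L_def, of k k'] in \<open>simp add: h_def L_def[symmetric] del: of_nat_Suc\<close>)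
  moreover have "(\<Sum>t<Suc n. \<Sum>s<Suc n. S (fiber j t (fiber \<sigma> s R)) \<omega> * S (below j t (fiber \<sigma> s R')) \<omega>)
     = (\<Sum>s<Suc n. S (fiber \<sigma> s R) \<omega> * S (fiber \<sigma> s R') \<omega>)" for \<omega>
  proof -
    \<comment> \<open>Wherever the first factor is not an empty sum, all of \<open>R'\<close> lies
      strictly below level \<open>t\<close>, and the truncation does nothing.\<close>
    have "S (fiber j t (fiber \<sigma> s R)) \<omega> * S (below j t (fiber \<sigma> s R')) \<omega> = S (fiber j t (fiber \<sigma> s R)) \<omega> * S (fiber \<sigma> s R') \<omega>" for s t
    proof (cases "fiber j t (fiber \<sigma> s R) = {}")
      case False
      then obtain r where "r \<in> R" "r j = t" by (auto simp: fiber_def)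
      then have "below j t (fiber \<sigma> s R') = fiber \<sigma> s R'" using less by (auto simp: below_def fiber_def)
      then show ?thesis by simp
    qed simp
    then have "(\<Sum>t<Suc n. \<Sum>s<Suc n. S (fiber j t (fiber \<sigma> s R)) \<omega> * S (below j t (fiber \<sigma> s R')) \<omega>)
      = (\<Sum>s<Suc n. (\<Sum>t<Suc n. S (fiber j t (fiber \<sigma> s R)) \<omega>) * S (fiber \<sigma> s R') \<omega>)"
      by (subst sum.swap) (simp only: sum_distrib_right)
    then show ?thesis using S_fibers[OF slice_box[OF fR] jD] by (simp only:)
  qed
  moreover have "(real k + real k') / 2 + 1 - \<delta> / 2 = (real (card (insert j U)) + real (card U')) / 2 - (1/2) ^ card D / 2"
  proof -
    have "1 \<le> card U'" using U' by (metis One_nat_def Suc_leI card_gt_0_iff empty_iff)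
    then show ?thesis using U by (simp add: k_def k'_def \<delta>_def of_nat_diff field_simps)
  qed
  ultimately show ?thesis by (simp add: X_def L_def mult.assoc)
qed

lemma bnd_slice:
  assumes "slice U N R" "j \<in> U" "1 \<le> m"
  shows "bnd \<Omega> (2*m) (S R) (B m * real (Suc n) powr ((real (card U) - 1) / 2))"
proof (rule bnd_weaken[OF bnd_S[OF slice_box[OF assms(1)] assms(3)]])
  have m3: "1 \<le> real m ^ 3" by (intro one_le_power) (use assms in simp)
  have fU: "finite U" using assms(1) finite_D finite_subset by (auto simp: slice_def)
  have c1: "1 \<le> card U" using fU assms(2) by (metis One_nat_def Suc_leI card_gt_0_iff empty_iff)
  have "real (card R) \<le> real (Suc n) ^ (card U - 1)"
    using slice_card[OF assms(1,2)] by (simp flip: of_nat_power of_nat_Suc)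
  also have "\<dots> = (real (Suc n) powr ((real (card U) - 1) / 2))\<^sup>2"
    using c1 unfolding power2_eq_square powr_add[symmetric] field_sum_of_halves
    by (simp add: powr_realpow[symmetric] of_nat_diff)
  finally have 1: "real (card R) \<le> (real (Suc n) powr ((real (card U) - 1) / 2))\<^sup>2" .
  have "(2 * real m ^ 3) ^ card D \<le> E m" unfolding E_def by (intro power_mono) auto
  also have "\<dots> \<le> B m" by (rule B_ge(1)[OF assms(3)])
  also have "\<dots> \<le> (B m)\<^sup>2" using B_ge(2)[OF assms(3)] by (simp add: power2_eq_square)
  finally have 2: "(2 * real m ^ 3) ^ card D \<le> (B m)\<^sup>2" .
  show "sqrt ((2 * real m ^ 3) ^ card D * real (card R)) \<le> B m * real (Suc n) powr ((real (card U) - 1) / 2)"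
    using mult_mono[OF 2 1] B_ge(2)[OF assms(3)] by (intro real_le_lsqrt) (auto simp: power_mult_distrib)
qed

end

subsection \<open>Binary digits\<close>

text \<open>Levels run up to \<open>n\<close>, and a Haar function of level \<open>n\<close> needs
  one digit more to tell its two halves apart; hence \<open>Suc n\<close> digits per
  coordinate.\<close>

definition grid :: "nat \<Rightarrow> nat \<Rightarrow> (nat \<Rightarrow> nat) set" where
  "grid d n = {1..d} \<rightarrow>\<^sub>E {..<2 ^ Suc n}"

text \<open>Digits are counted from the most significant one, hence bit \<open>n - i\<close>. Out of
  range the map is the identity, so that it is an involution for all arguments.\<close>

definition flip_digit :: "nat \<Rightarrow> nat \<Rightarrow> nat \<Rightarrow> nat \<Rightarrow> (nat \<Rightarrow> nat) \<Rightarrow> (nat \<Rightarrow> nat)" where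
  "flip_digit d n c i k = (if c \<in> {1..d} \<and> i \<le> n then k(c := flip_bit (n - i) (k c)) else k)"

definition dyadic :: "nat \<Rightarrow> nat \<Rightarrow> real set" where
  "dyadic m i = {real i / 2 ^ m ..< (real i + 1) / 2 ^ m}"

text \<open>A layer read off from the digits: in coordinate \<open>j\<close> the first
  \<open>r j\<close> digits select the interval, and the next one decides between its
  halves.\<close>

definition grid_layer ::
    "nat \<Rightarrow> nat \<Rightarrow> ((nat \<Rightarrow> real set) \<Rightarrow> real) \<Rightarrow> (nat \<Rightarrow> nat) \<Rightarrow> (nat \<Rightarrow> nat) \<Rightarrow> real" where
  "grid_layer d n \<alpha> r k =
     sign1 (\<alpha> (\<lambda>j\<in>{1..d}. dyadic (r j) (k j div 2 ^ (Suc n - r j)))) *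
     (\<Prod>j\<in>{1..d}. if odd (k j div 2 ^ (n - r j)) then 1 else - 1)"

lemma flip_bit_div_power: "b < a \<Longrightarrow> flip_bit b k div 2 ^ a = k div 2 ^ a" for k :: nat
  unfolding drop_bit_eq_div[symmetric]
  by (rule bit_eqI) (auto simp: bit_drop_bit_eq bit_flip_bit_iff)

lemma odd_flip_bit_div_power: "odd (flip_bit b k div 2 ^ b) \<longleftrightarrow> even (k div 2 ^ b)" for k :: nat
  using bit_flip_bit_iff[of b k b] by (simp add: bit_iff_odd)

lemma flip_bit_involution: "flip_bit b (flip_bit b k) = k" for k :: nat
  by (rule bit_eqI) (auto simp: bit_flip_bit_iff)

lemma flip_bit_less: "b \<le> n \<Longrightarrow> k < 2 ^ Suc n \<Longrightarrow> flip_bit b k < 2 ^ Suc n" for k :: nat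
  using flip_bit_div_power[of b "Suc n" k] by (simp add: div_eq_0_iff)

lemma finite_grid: "finite (grid d n)" unfolding grid_def by (intro finite_PiE) auto

lemma card_grid: "card (grid d n) = (2 ^ Suc n) ^ d" by (simp add: grid_def card_PiE)

lemma grid_nonempty: "grid d n \<noteq> {}"
proof -
  have "(\<lambda>j\<in>{1..d}. 0) \<in> grid d n" by (auto simp: grid_def)
  then show ?thesis by blast
qed

lemma grid_layer_abs: "\<bar>grid_layer d n \<alpha> r k\<bar> = 1"
proof -
  have "\<bar>\<Prod>j\<in>{1..d}. if odd (k j div 2 ^ (n - r j)) then 1 else - 1 :: real\<bar> = 1"
    unfolding abs_prod by (rule prod.neutral) auto
  then show ?thesis by (simp add: grid_layer_def abs_mult sign1_def)
qed

text \<open>A flip at level \<open>r c\<close> or beyond leaves the selected rectangle, hence its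
  coefficient, unchanged; the sign factor of coordinate \<open>c\<close> reacts to the flip at
  \<open>r c\<close> and to no later one.\<close>

lemma haar_family_grid: "haar_family (grid d n) (flip_digit d n) {1..d} n (grid_layer d n \<alpha>)"
proof -
  interpret flip_space "grid d n" "flip_digit d n"
  proof
    fix k c i assume "k \<in> grid d n"
    then show "flip_digit d n c i k \<in> grid d n"
      by (auto simp: grid_def flip_digit_def PiE_iff extensional_def intro!: flip_bit_less simp del: power_Suc)
  qed (auto simp: finite_grid grid_nonempty flip_digit_def flip_bit_involution)
  show ?thesis
  proof
    fix r c assume r: "r \<in> {1..d} \<rightarrow>\<^sub>E {..n}" and c: "c \<in> {1..d}"
    have rc: "r c \<le> n" using r c by auto
    let ?R = "\<lambda>k. \<lambda>j\<in>{1..d}. dyadic (r j) (k j div 2 ^ (Suc n - r j))"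
    let ?s = "\<lambda>k j. if odd (k j div 2 ^ (n - r j)) then 1 else - 1 :: real"
    have R: "?R (flip_digit d n c i k) = ?R k" if "r c \<le> i" for i k
    proof (cases "i \<le> n")
      case True
      then have "n - i < Suc n - r c" using that rc by auto
      then show ?thesis by (intro restrict_ext) (auto simp: flip_digit_def flip_bit_div_power)
    qed (simp add: flip_digit_def)
    have pr: "(\<Prod>j\<in>{1..d}. ?s k j) = ?s k c * (\<Prod>j\<in>{1..d} - {c}. ?s k j)" for k
      using c by (subst prod.remove[of _ c]) auto
    have oth: "(\<Prod>j\<in>{1..d} - {c}. ?s (flip_digit d n c i k) j) = (\<Prod>j\<in>{1..d} - {c}. ?s k j)" for i k
      by (intro prod.cong refl) (auto simp: flip_digit_def)
    have same: "?s (flip_digit d n c (r c) k) c = - ?s k c" for k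
      using c rc by (simp add: flip_digit_def odd_flip_bit_div_power)
    have gt: "?s (flip_digit d n c i k) c = ?s k c" if "r c < i" for i k
    proof (cases "i \<le> n")
      case True
      then have "n - i < n - r c" using that by auto
      then show ?thesis by (simp add: flip_digit_def flip_bit_div_power)
    qed (simp add: flip_digit_def)
    show "haar_level c (r c) (grid_layer d n \<alpha> r)"
      unfolding haar_level_def flip_invariant_def
    proof (intro conjI allI impI)
      fix k
      show "grid_layer d n \<alpha> r (flip_digit d n c (r c) k) = - grid_layer d n \<alpha> r k"
        unfolding grid_layer_def R[OF order_refl] pr oth same by simp
      fix i assume "Suc (r c) \<le> i"
      then have i: "r c < i" "r c \<le> i" by auto
      show "grid_layer d n \<alpha> r (flip_digit d n c i k) = grid_layer d n \<alpha> r k"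
        unfolding grid_layer_def R[OF i(2)] pr oth gt[OF i(1)] by simp
    qed
  qed (simp_all add: grid_layer_abs)
qed

section \<open>Transfer from the cube to the grid\<close>

definition digits :: "nat \<Rightarrow> nat \<Rightarrow> (nat \<Rightarrow> real) \<Rightarrow> nat \<Rightarrow> nat" where
  "digits d n x = (\<lambda>j\<in>{1..d}. nat \<lfloor>2 ^ Suc n * x j\<rfloor>)"

lemma mem_dyadic_iff:
  assumes "0 \<le> x" shows "x \<in> dyadic m i \<longleftrightarrow> nat \<lfloor>2 ^ m * x\<rfloor> = i"
proof -
  have "x \<in> dyadic m i \<longleftrightarrow> real i \<le> 2 ^ m * x \<and> 2 ^ m * x < real i + 1"
    by (auto simp: dyadic_def field_simps)
  also have "\<dots> \<longleftrightarrow> \<lfloor>2 ^ m * x\<rfloor> = int i" by (simp add: floor_eq_iff)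
  also have "\<dots> \<longleftrightarrow> nat \<lfloor>2 ^ m * x\<rfloor> = i" using assms by auto
  finally show ?thesis .
qed

lemma nat_floor_div_power:
  fixes x :: real
  assumes "0 \<le> x" "m \<le> N"
  shows "nat \<lfloor>2 ^ N * x\<rfloor> div 2 ^ (N - m) = nat \<lfloor>2 ^ m * x\<rfloor>"
proof -
  have "2 ^ N = 2 ^ m * (2 ^ (N - m) :: real)" using assms by (simp flip: power_add)
  then have "2 ^ m * x = 2 ^ N * x / real_of_int (2 ^ (N - m))" by simp
  then have "\<lfloor>2 ^ m * x\<rfloor> = \<lfloor>2 ^ N * x\<rfloor> div 2 ^ (N - m)"
    by (simp only: floor_divide_real_eq_div[of "2 ^ (N - m)"] zero_le_power zero_le_numeral)
  then show ?thesis using assms by (simp add: nat_div_distrib nat_power_eq)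
qed

lemma haar_outside: "x \<notin> I \<Longrightarrow> haar I x = 0"
  by (simp add: haar_def left_half_def right_half_def)

text \<open>The midpoint of interval \<open>i\<close> of level \<open>m\<close> is the left end of
  interval \<open>2 * i + 1\<close> of level \<open>Suc m\<close>, so the parity of the index at
  level \<open>Suc m\<close> tells the halves apart.\<close>

lemma haar_dyadic:
  assumes "0 \<le> x" "m \<le> n" and i: "i = nat \<lfloor>2 ^ Suc n * x\<rfloor> div 2 ^ (Suc n - m)"
  shows "haar (dyadic m i) x = (if odd (nat \<lfloor>2 ^ Suc n * x\<rfloor> div 2 ^ (n - m)) then 1 else - 1)"
proof -
  define y where "y = nat \<lfloor>2 ^ Suc m * x\<rfloor>"
  have y: "nat \<lfloor>2 ^ Suc n * x\<rfloor> div 2 ^ (n - m) = y"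
    using nat_floor_div_power[of x "Suc m" "Suc n"] assms by (simp add: y_def)
  have i': "i = nat \<lfloor>2 ^ m * x\<rfloor>" using nat_floor_div_power[of x m "Suc n"] assms by simp
  have iy: "i = y div 2" using nat_floor_div_power[of x m "Suc m"] assms i' by (simp add: y_def)
  have mem: "x \<in> dyadic m i" using mem_dyadic_iff[OF assms(1)] i' by simp
  have mid: "(Inf (dyadic m i) + Sup (dyadic m i)) / 2 = real (2 * i + 1) / 2 ^ Suc m"
    by (simp add: dyadic_def divide_strict_right_mono field_simps)
  have ge: "real (2 * i + 1) / 2 ^ Suc m \<le> x \<longleftrightarrow> 2 * i + 1 \<le> y"
  proof -
    have "real (2 * i + 1) / 2 ^ Suc m \<le> x \<longleftrightarrow> real_of_int (int (2 * i + 1)) \<le> 2 ^ Suc m * x"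
      by (simp add: field_simps)
    also have "\<dots> \<longleftrightarrow> int (2 * i + 1) \<le> \<lfloor>2 ^ Suc m * x\<rfloor>" by (rule le_floor_iff[symmetric])
    also have "\<dots> \<longleftrightarrow> 2 * i + 1 \<le> y" unfolding y_def by linarith
    finally show ?thesis .
  qed
  have "2 * i + 1 \<le> y \<longleftrightarrow> odd y" unfolding iy by presburger
  then show ?thesis
    using mem ge unfolding y haar_def left_half_def right_half_def mid by (auto simp: not_le not_less)
qed

lemma dyadic_intervals_eq: "dyadic_intervals m = dyadic m ` {..<2 ^ m}"
  by (auto simp: dyadic_intervals_def dyadic_def)

text \<open>The rectangles of one shape partition the half-open cube, so a single term of the layer
  survives at each point.\<close>

lemma f_layer_eq_grid_layer:
  assumes x: "\<And>j. j \<in> {1..d} \<Longrightarrow> 0 \<le> x j \<and> x j < 1" and r: "\<And>j. j \<in> {1..d} \<Longrightarrow> r j \<le> n"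
  shows "f_layer d \<alpha> r x = grid_layer d n \<alpha> r (digits d n x)"
proof -
  let ?k = "digits d n x"
  let ?R = "\<lambda>j\<in>{1..d}. dyadic (r j) (?k j div 2 ^ (Suc n - r j))"
  have kj: "?k j = nat \<lfloor>2 ^ Suc n * x j\<rfloor>" if "j \<in> {1..d}" for j using that by (simp add: digits_def)
  have idx: "?k j div 2 ^ (Suc n - r j) = nat \<lfloor>2 ^ r j * x j\<rfloor>" if "j \<in> {1..d}" for j
    using nat_floor_div_power[of "x j" "r j" "Suc n"] x[OF that] r[OF that] kj[OF that] by simp
  have RR: "?R \<in> dyadic_rects d r"
    unfolding dyadic_rects_def dyadic_intervals_eq
  proof (rule restrict_PiE_iff[THEN iffD2], intro ballI imageI)
    fix j assume j: "j \<in> {1..d}"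
    have "2 ^ r j * x j < 2 ^ r j" using x[OF j] by simp
    then show "?k j div 2 ^ (Suc n - r j) \<in> {..<2 ^ r j}"
      unfolding idx[OF j] using x[OF j] by (simp add: nat_less_iff floor_less_iff)
  qed
  have "f_layer d \<alpha> r x = (\<Sum>R\<in>{?R}. sign1 (\<alpha> R) * haar_rect d R x)"
    unfolding f_layer_def
  proof (rule sum.mono_neutral_right)
    show "finite (dyadic_rects d r)"
      unfolding dyadic_rects_def dyadic_intervals_eq by (intro finite_PiE) auto
    show "\<forall>R\<in>dyadic_rects d r - {?R}. sign1 (\<alpha> R) * haar_rect d R x = 0"
    proof
      fix R assume R: "R \<in> dyadic_rects d r - {?R}"
      have "\<exists>j\<in>{1..d}. R j \<noteq> ?R j"
      proof (rule ccontr)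
        assume "\<not> ?thesis"
        then have "R = ?R" using R RR by (intro PiE_ext[of R "{1..d}" "\<lambda>j. dyadic_intervals (r j)"]) (auto simp: dyadic_rects_def)
        then show False using R by simp
      qed
      then obtain j where j: "j \<in> {1..d}" "R j \<noteq> ?R j" by blast
      have "R j \<in> dyadic_intervals (r j)" using R j(1) by (auto simp: dyadic_rects_def)
      then obtain i where i: "R j = dyadic (r j) i" by (auto simp: dyadic_intervals_eq)
      have "x j \<notin> R j"
        using j i mem_dyadic_iff[of "x j" "r j" i] x[OF j(1)] idx[OF j(1)] by auto
      then have "haar_rect d R x = 0"
        unfolding haar_rect_def using j(1) by (intro prod_zero bexI[of _ j]) (auto simp: haar_outside)
      then show "sign1 (\<alpha> R) * haar_rect d R x = 0" by simp
    qed
  qed (use RR in simp)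
  also have "haar_rect d ?R x = (\<Prod>j\<in>{1..d}. if odd (?k j div 2 ^ (n - r j)) then 1 else - 1)"
    unfolding haar_rect_def
  proof (intro prod.cong refl)
    fix j assume j: "j \<in> {1..d}"
    show "haar (?R j) (x j) = (if odd (?k j div 2 ^ (n - r j)) then 1 else - 1)"
      using haar_dyadic[of "x j" "r j" n] x[OF j] r[OF j] kj[OF j] j by simp
  qed
  then have "(\<Sum>R\<in>{?R}. sign1 (\<alpha> R) * haar_rect d R x) = grid_layer d n \<alpha> r ?k"
    by (simp add: grid_layer_def)
  finally show ?thesis .
qed

text \<open>Half-open dyadic intervals all miss the point 1. Vanishing on these faces of the closed
  cube makes the passage to the grid exact everywhere, with no argument up to null sets.\<close>

lemma f_layer_boundary:
  assumes "j \<in> {1..d}" "x j = 1" shows "f_layer d \<alpha> r x = 0"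
  unfolding f_layer_def
proof (intro sum.neutral ballI)
  fix R assume "R \<in> dyadic_rects d r"
  then have "R j \<in> dyadic_intervals (r j)" using assms(1) by (auto simp: dyadic_rects_def)
  then obtain i where i: "R j = dyadic (r j) i" "i < 2 ^ r j" by (auto simp: dyadic_intervals_eq)
  have "real (i + 1) \<le> real (2 ^ r j)" using i(2) by (subst of_nat_le_iff) simp
  then have "x j \<notin> R j" using assms i(1) by (simp add: dyadic_def field_simps)
  then have "haar_rect d R x = 0"
    unfolding haar_rect_def using assms(1) by (intro prod_zero bexI[of _ j]) (auto simp: haar_outside)
  then show "sign1 (\<alpha> R) * haar_rect d R x = 0" by simp
qed

text \<open>On the closed cube \<open>F\<close> is a combination of indicators of finitely many
  cells of equal measure, so its measurability need not be assumed.\<close>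

lemma integral_cube_eq_avg_grid:
  fixes F :: "(nat \<Rightarrow> real) \<Rightarrow> real"
  assumes in_cube: "\<And>x. x \<in> {1..d} \<rightarrow>\<^sub>E {0..<1} \<Longrightarrow> F x = \<Psi> (digits d n x)"
    and boundary: "\<And>x. x \<in> {1..d} \<rightarrow>\<^sub>E {0..1} \<Longrightarrow> x \<notin> {1..d} \<rightarrow>\<^sub>E {0..<1} \<Longrightarrow> F x = 0"
  shows "set_lebesgue_integral (\<Pi>\<^sub>M j\<in>{1..d}. lborel) ({1..d} \<rightarrow>\<^sub>E {0..1}) F = avg (grid d n) \<Psi>"
proof -
  interpret product_sigma_finite "\<lambda>_::nat. lborel :: real measure"
    by standard
  let ?M = "\<Pi>\<^sub>M j\<in>{1..d}. (lborel :: real measure)"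
  define cell where "cell k = (\<Pi>\<^sub>E j\<in>{1..d}. dyadic (Suc n) (k j))" for k
  have cell_sets: "cell k \<in> sets ?M" for k
    unfolding cell_def by (intro sets_PiM_I_finite) (auto simp: dyadic_def)
  have em: "emeasure ?M (cell k) = ennreal (1 / (2 ^ Suc n) ^ d)" for k
  proof -
    have "emeasure ?M (cell k) = (\<Prod>j\<in>{1..d}. emeasure lborel (dyadic (Suc n) (k j)))"
      unfolding cell_def by (intro emeasure_PiM) (auto simp: dyadic_def)
    also have "\<dots> = (\<Prod>j\<in>{1..d}. ennreal (1 / 2 ^ Suc n))"
      by (intro prod.cong refl) (auto simp: dyadic_def divide_right_mono diff_divide_distrib[symmetric])
    also have "\<dots> = ennreal (1 / (2 ^ Suc n) ^ d)"
      by (simp add: ennreal_power power_divide del: power_Suc)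
    finally show ?thesis .
  qed
  have mem: "x \<in> cell k \<longleftrightarrow> x \<in> {1..d} \<rightarrow>\<^sub>E {0..<1} \<and> digits d n x = k" if k: "k \<in> grid d n" for x k
  proof
    assume x: "x \<in> cell k"
    have xj: "0 \<le> x j \<and> x j < 1" if j: "j \<in> {1..d}" for j
    proof -
      have "x j \<in> dyadic (Suc n) (k j)" using x j by (auto simp: cell_def)
      moreover have "real (k j + 1) \<le> real (2 ^ Suc n)" 
        using k j by (subst of_nat_le_iff) (auto simp: grid_def PiE_iff Suc_le_eq)
      then have "(real (k j) + 1) / 2 ^ Suc n \<le> 1" by (simp del: power_Suc)
      moreover have "0 \<le> real (k j) / 2 ^ Suc n" by simp
      ultimately show ?thesis unfolding dyadic_def atLeastLessThan_iff by linarith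
    qed
    moreover have "nat \<lfloor>2 ^ Suc n * x j\<rfloor> = k j" if j: "j \<in> {1..d}" for j
      using mem_dyadic_iff[of "x j" "Suc n" "k j"] xj[OF j] x j by (auto simp: cell_def)
    ultimately show "x \<in> {1..d} \<rightarrow>\<^sub>E {0..<1} \<and> digits d n x = k"
      using x k by (auto simp: cell_def PiE_iff digits_def grid_def extensional_def fun_eq_iff)
  next
    assume x: "x \<in> {1..d} \<rightarrow>\<^sub>E {0..<1} \<and> digits d n x = k"
    then have "x j \<in> dyadic (Suc n) (k j)" if j: "j \<in> {1..d}" for j
      using mem_dyadic_iff[of "x j" "Suc n" "k j"] j by (auto simp: digits_def PiE_iff)
    then show "x \<in> cell k" using x by (auto simp: cell_def PiE_iff)
  qed
  have dig: "digits d n x \<in> grid d n" if "x \<in> {1..d} \<rightarrow>\<^sub>E {0..<1}" for x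
  proof -
    have "nat \<lfloor>2 ^ Suc n * x j\<rfloor> < 2 ^ Suc n" if j: "j \<in> {1..d}" for j
    proof -
      have "2 ^ Suc n * x j < 2 ^ Suc n" "0 \<le> x j" using \<open>x \<in> _\<close> j by (auto simp: PiE_iff)
      then show ?thesis by (simp add: nat_less_iff floor_less_iff)
    qed
    then show ?thesis by (auto simp: digits_def grid_def)
  qed
  have pt: "indicator ({1..d} \<rightarrow>\<^sub>E {0..1}) x *\<^sub>R F x = (\<Sum>k\<in>grid d n. \<Psi> k * indicator (cell k) x)" for x
  proof (cases "x \<in> {1..d} \<rightarrow>\<^sub>E {0..<1}")
    case True
    then have "x \<in> {1..d} \<rightarrow>\<^sub>E {0..1}" by (auto simp: PiE_iff less_imp_le)
    moreover have "(\<Sum>k\<in>grid d n. \<Psi> k * indicator (cell k) x) = (\<Sum>k\<in>grid d n. if k = digits d n x then \<Psi> k else 0)"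
      using True by (intro sum.cong refl) (auto simp: mem indicator_def)
    ultimately show ?thesis using True dig in_cube by (simp add: finite_grid)
  next
    case False
    then have "(\<Sum>k\<in>grid d n. \<Psi> k * indicator (cell k) x) = 0"
      by (intro sum.neutral) (auto simp: mem indicator_def)
    then show ?thesis using False boundary by (auto simp: indicator_def)
  qed
  have "set_lebesgue_integral ?M ({1..d} \<rightarrow>\<^sub>E {0..1}) F = (\<integral>x. (\<Sum>k\<in>grid d n. \<Psi> k * indicator (cell k) x) \<partial>?M)"
    unfolding set_lebesgue_integral_def pt ..
  also have "\<dots> = (\<Sum>k\<in>grid d n. \<integral>x. \<Psi> k * indicator (cell k) x \<partial>?M)"
    by (intro Bochner_Integration.integral_sum integrable_mult_right integrable_real_indicator cell_sets)
       (simp only: em ennreal_less_top infinity_ennreal_def)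
  also have "\<dots> = (\<Sum>k\<in>grid d n. \<Psi> k * (1 / (2 ^ Suc n) ^ d))"
  proof (intro sum.cong refl)
    fix k
    have me: "measure ?M (cell k) = 1 / (2 ^ Suc n) ^ d" unfolding measure_def em by simp
    show "(\<integral>x. \<Psi> k * indicator (cell k) x \<partial>?M) = \<Psi> k * (1 / (2 ^ Suc n) ^ d)"
      by (simp only: integral_mult_right_zero Bochner_Integration.integral_indicator
          sets.Int_space_eq2[OF cell_sets] me)
  qed
  also have "\<dots> = avg (grid d n) \<Psi>"
    by (simp add: avg_def card_grid sum_divide_distrib)
  finally show ?thesis .
qed

text \<open>The argument of \<open>bnd_mono\<close> with \<open>powr\<close>, bridging a real
  exponent and a natural one.\<close>

lemma avg_powr_le:
  assumes fin: "finite \<Omega>" "\<Omega> \<noteq> {}" and p: "0 < p" "p \<le> real N" and F: "bnd \<Omega> N F a"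
  shows "avg \<Omega> (\<lambda>\<omega>. \<bar>F \<omega>\<bar> powr p) powr (1 / p) \<le> a"
proof (cases "a = 0")
  case True
  have "1 \<le> N" using p by linarith
  then have "F \<omega> = 0" if "\<omega> \<in> \<Omega>" for \<omega> using bnd_eq_0[OF fin _ _ that, of N F] F True by simp
  then have "avg \<Omega> (\<lambda>\<omega>. \<bar>F \<omega>\<bar> powr p) = 0" by (simp add: avg_def)
  then show ?thesis using True by simp
next
  case False
  then have a: "0 < a" using bnd_nonneg[OF F] by auto
  have N: "0 < N" using p by (cases N) auto
  have y: "t powr p \<le> (p / real N) * t ^ N + (1 - p / real N)" if "0 \<le> t" for t :: real
  proof (cases "t = 0")
    case False
    then have "(t ^ N) powr (p / real N) = t powr p"
      using N that by (simp add: powr_realpow[symmetric] powr_powr)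
    then show ?thesis
      using Youngs_inequality_0[of "p / real N" "1 - p / real N" "t ^ N" 1] p N that False by simp
  qed (use p N in \<open>auto simp: zero_power\<close>)
  have "avg \<Omega> (\<lambda>\<omega>. \<bar>F \<omega>\<bar> powr p) = avg \<Omega> (\<lambda>\<omega>. a powr p * (\<bar>F \<omega>\<bar> / a) powr p)"
    using a by (intro avg_cong) (simp add: powr_divide)
  also have "\<dots> = a powr p * avg \<Omega> (\<lambda>\<omega>. (\<bar>F \<omega>\<bar> / a) powr p)" by (rule avg_cmult)
  also have "\<dots> \<le> a powr p * avg \<Omega> (\<lambda>\<omega>. (p / real N) * (\<bar>F \<omega>\<bar> / a) ^ N + (1 - p / real N))"
    using a by (intro mult_left_mono avg_mono y) auto
  also have "avg \<Omega> (\<lambda>\<omega>. (p / real N) * (\<bar>F \<omega>\<bar> / a) ^ N + (1 - p / real N)) = (p / real N) * avg \<Omega> (\<lambda>\<omega>. (\<bar>F \<omega>\<bar> / a) ^ N) + (1 - p / real N)"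
    by (simp only: avg_add avg_cmult avg_const[OF fin])
  also have "a powr p * \<dots> \<le> a powr p * ((p / real N) * 1 + (1 - p / real N))"
    using F a p by (intro mult_left_mono add_right_mono) (auto simp: bnd_normalized)
  finally have "avg \<Omega> (\<lambda>\<omega>. \<bar>F \<omega>\<bar> powr p) \<le> a powr p" by simp
  then have "avg \<Omega> (\<lambda>\<omega>. \<bar>F \<omega>\<bar> powr p) powr (1 / p) \<le> (a powr p) powr (1 / p)"
    using p by (intro powr_mono2 avg_nonneg) auto
  then show ?thesis using a p by (simp add: powr_powr)
qed

lemma Lp_norm_cube_le:
  assumes in_cube: "\<And>x. x \<in> {1..d} \<rightarrow>\<^sub>E {0..<1} \<Longrightarrow> F x = \<Psi> (digits d n x)"
    and boundary: "\<And>x. x \<in> {1..d} \<rightarrow>\<^sub>E {0..1} \<Longrightarrow> x \<notin> {1..d} \<rightarrow>\<^sub>E {0..<1} \<Longrightarrow> F x = 0"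
    and p: "0 < p" "p \<le> real N" and b: "bnd (grid d n) N \<Psi> a"
  shows "Lp_norm_cube d p F \<le> a"
proof -
  have "set_lebesgue_integral (\<Pi>\<^sub>M j\<in>{1..d}. lborel) ({1..d} \<rightarrow>\<^sub>E {0..1}) (\<lambda>x. \<bar>F x\<bar> powr p)
     = avg (grid d n) (\<lambda>k. \<bar>\<Psi> k\<bar> powr p)"
    by (rule integral_cube_eq_avg_grid) (simp_all add: in_cube boundary)
  then show ?thesis
    unfolding Lp_norm_cube_def using avg_powr_le[OF finite_grid grid_nonempty p b] by simp
qed

subsection \<open>Matchings of small cliques\<close>

lemma sum_PiE_Diff:
  assumes "P \<subseteq> C"
  shows "(\<Sum>x\<in>C \<rightarrow>\<^sub>E T. h x) = (\<Sum>y\<in>(C - P) \<rightarrow>\<^sub>E T. \<Sum>z\<in>P \<rightarrow>\<^sub>E T. h (\<lambda>c. if c \<in> P then z c else y c))"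
proof -
  let ?m = "\<lambda>(y, z) c. if c \<in> P then z c else y c"
  have "bij_betw ?m (((C - P) \<rightarrow>\<^sub>E T) \<times> (P \<rightarrow>\<^sub>E T)) (C \<rightarrow>\<^sub>E T)"
  proof (rule bij_betwI[where g = "\<lambda>x. (restrict x (C - P), restrict x P)"])
    show "?m \<in> ((C - P) \<rightarrow>\<^sub>E T) \<times> (P \<rightarrow>\<^sub>E T) \<rightarrow> (C \<rightarrow>\<^sub>E T)"
      using assms by (fastforce simp: PiE_iff extensional_def)
    show "(\<lambda>x. (restrict x (C - P), restrict x P)) \<in> (C \<rightarrow>\<^sub>E T) \<rightarrow> ((C - P) \<rightarrow>\<^sub>E T) \<times> (P \<rightarrow>\<^sub>E T)"
      using assms by (auto simp: PiE_iff)
  next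
    fix u assume "u \<in> ((C - P) \<rightarrow>\<^sub>E T) \<times> (P \<rightarrow>\<^sub>E T)"
    then show "(restrict (?m u) (C - P), restrict (?m u) P) = u"
      by (cases u) (auto simp: PiE_iff extensional_def fun_eq_iff)
  next
    fix x assume "x \<in> C \<rightarrow>\<^sub>E T"
    then show "?m (restrict x (C - P), restrict x P) = x"
      using assms by (auto simp: PiE_iff extensional_def fun_eq_iff)
  qed
  from sum.reindex_bij_betw[OF this, of h, symmetric] show ?thesis
    by (simp add: sum.cartesian_product case_prod_beta)
qed

section \<open>Clique systems: decoupling into pairs and single vertices\<close>

text \<open>What the estimate needs of a graph: a hypergraph of cliques, disjoint within each color.
  Cliques carry their color because one vertex set may be a clique in several colors, with a
  separate shared value in each.\<close>

locale clique_system = haar_family \<Omega> \<tau> "{1..d}" n f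
  for \<Omega> :: "'a set" and \<tau> and d :: nat and n and f :: "(nat \<Rightarrow> nat) \<Rightarrow> 'a \<Rightarrow> real" +
  fixes V :: "nat set" and C :: "(nat \<times> nat set) set" and A :: "nat \<Rightarrow> (nat \<Rightarrow> nat) set"
  assumes d_pos: "1 \<le> d" and finite_V: "finite V"
    and C_color: "c \<in> C \<Longrightarrow> fst c \<in> {2..d}"
    and C_verts: "c \<in> C \<Longrightarrow> snd c \<subseteq> V"
    and C_card: "c \<in> C \<Longrightarrow> 2 \<le> card (snd c)"
    and C_disjoint: "c \<in> C \<Longrightarrow> c' \<in> C \<Longrightarrow> fst c = fst c' \<Longrightarrow> v \<in> snd c \<Longrightarrow> v \<in> snd c' \<Longrightarrow> c = c'"
    and C_cover: "v \<in> V \<Longrightarrow> \<exists>c\<in>C. v \<in> snd c"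
    and A_box: "v \<in> V \<Longrightarrow> A v \<subseteq> box"
    and A_sum: "v \<in> V \<Longrightarrow> r \<in> A v \<Longrightarrow> (\<Sum>j\<in>{1..d}. r j) = n"
    and A_less: "v \<in> V \<Longrightarrow> w \<in> V \<Longrightarrow> v < w \<Longrightarrow> r \<in> A v \<Longrightarrow> s \<in> A w \<Longrightarrow> r 1 < s 1"
begin

definition X :: "(nat \<Rightarrow> nat \<Rightarrow> nat) set" where
  "X = {r \<in> Pi\<^sub>E V A. \<forall>c\<in>C. \<forall>v\<in>snd c. \<forall>w\<in>snd c. r v (fst c) = r w (fst c)}"

definition pinned :: "(nat \<times> nat set) set \<Rightarrow> (nat \<times> nat set \<Rightarrow> nat) \<Rightarrow> nat \<Rightarrow> (nat \<Rightarrow> nat) set" where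
  "pinned K x v = {r \<in> A v. \<forall>c\<in>K. v \<in> snd c \<longrightarrow> r (fst c) = x c}"

definition colors :: "(nat \<times> nat set) set \<Rightarrow> nat \<Rightarrow> nat set" where
  "colors K v = fst ` {c \<in> K. v \<in> snd c}"

definition free :: "nat \<Rightarrow> nat set" where "free v = {1..d} - colors C v"

lemma finite_C: "finite C"
proof (rule finite_subset)
  show "C \<subseteq> {2..d} \<times> Pow V"
  proof
    fix c assume "c \<in> C"
    from C_color[OF this] C_verts[OF this] show "c \<in> {2..d} \<times> Pow V" by (simp add: mem_Times_iff)
  qed
qed (use finite_V in auto)

lemma finite_snd: "c \<in> C \<Longrightarrow> finite (snd c)"
  using C_verts finite_V finite_subset by blast

lemma card_colors:
  assumes "K \<subseteq> C" shows "card (colors K v) = card {c \<in> K. v \<in> snd c}"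
  unfolding colors_def using assms C_disjoint by (intro card_image inj_onI) blast

lemma colors_subset: "K \<subseteq> C \<Longrightarrow> colors K v \<subseteq> {2..d}"
  using C_color by (auto simp: colors_def)

lemma card_free: "real (card (free v)) = real d - real (card {c \<in> C. v \<in> snd c})"
proof -
  have s: "colors C v \<subseteq> {1..d}" using colors_subset[of C v] by auto
  have "card (colors C v) \<le> card {1..d}" by (rule card_mono[OF _ s]) simp
  then show ?thesis
    unfolding free_def using s card_colors[of C v] by (subst card_Diff_subset) (auto intro: finite_subset)
qed

lemma one_free: "1 \<in> free v"
  using d_pos colors_subset[of C v] by (auto simp: free_def)

lemma finite_free: "finite (free v)" by (simp add: free_def)

text \<open>The pinned coordinates use up a fixed part of the total degree \<open>n\<close>. If
  nothing satisfies the prescribed values, any \<open>N\<close> will do.\<close>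

lemma slice_pinned:
  assumes v: "v \<in> V" and K: "K \<subseteq> C"
  obtains N where "slice ({1..d} - colors K v) N (pinned K x v)"
proof -
  let ?U = "{1..d} - colors K v"
  have s: "colors K v \<subseteq> {1..d}" using colors_subset[OF K, of v] by auto
  have agree: "r j = r' j" if "r \<in> pinned K x v" "r' \<in> pinned K x v" "j \<in> colors K v" for r r' j
  proof -
    obtain c where "c \<in> K" "v \<in> snd c" "j = fst c" using \<open>j \<in> colors K v\<close> unfolding colors_def by blast
    then show ?thesis using that by (simp add: pinned_def)
  qed
  have sums: "(\<Sum>j\<in>?U. int (r j)) = int n - (\<Sum>j\<in>colors K v. int (r j))" if "r \<in> pinned K x v" for r
  proof -
    have "(\<Sum>j\<in>{1..d}. r j) = n" by (rule A_sum[OF v]) (use that in \<open>simp add: pinned_def\<close>)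
    then have "(\<Sum>j\<in>{1..d}. int (r j)) = int n" by (simp flip: of_nat_sum)
    then show ?thesis using sum_diff[OF _ s, of "\<lambda>j. int (r j)"] by simp
  qed
  have same: "(\<Sum>j\<in>?U. int (r j)) = (\<Sum>j\<in>?U. int (r' j))" if "r \<in> pinned K x v" "r' \<in> pinned K x v" for r r'
    unfolding sums[OF that(1)] sums[OF that(2)] using agree[OF that] by simp
  obtain N where N: "\<forall>r\<in>pinned K x v. (\<Sum>j\<in>?U. int (r j)) = N"
  proof (cases "pinned K x v = {}")
    case False
    then obtain r0 where "r0 \<in> pinned K x v" by blast
    then show ?thesis using same that by blast
  qed (use that in auto)
  have "slice ?U N (pinned K x v)"
    unfolding slice_def using N A_box[OF v] agree s by (auto simp: pinned_def)
  then show ?thesis by (rule that)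
qed

text \<open>Once every clique value is prescribed, the vertices no longer constrain one another and
  the sum over tuples becomes a product. Values attained by no tuple contribute zero.\<close>

lemma sum_prod_pinned:
  "(\<Sum>r\<in>X. \<Prod>v\<in>V. f (r v) \<omega>) = (\<Sum>x\<in>C \<rightarrow>\<^sub>E {..n}. \<Prod>v\<in>V. S (pinned C x v) \<omega>)"
proof -
  \<comment> \<open>The value of a clique is read off at its least vertex; on \<open>X\<close> every
    other vertex of it gives the same.\<close>
  define g where "g r = (\<lambda>c\<in>C. r (Min (snd c)) (fst c))" for r :: "nat \<Rightarrow> nat \<Rightarrow> nat"
  have finA: "finite (A v)" if "v \<in> V" for v using finite_sub_box[OF A_box[OF that]] .
  have finX: "finite X"
  proof (rule finite_subset)
    show "X \<subseteq> Pi\<^sub>E V A" unfolding X_def by blast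
  qed (intro finite_PiE finite_V finA)
  have Min_in: "Min (snd c) \<in> snd c" if "c \<in> C" for c
    using finite_snd[OF that] C_card[OF that] by (intro Min_in) auto
  have gX: "g ` X \<subseteq> C \<rightarrow>\<^sub>E {..n}"
  proof (intro image_subsetI PiE_I)
    fix r c assume r: "r \<in> X" and c: "c \<in> C"
    have v: "Min (snd c) \<in> V" using Min_in[OF c] C_verts[OF c] by auto
    moreover have "r \<in> Pi\<^sub>E V A" using r unfolding X_def by blast
    ultimately have "r (Min (snd c)) \<in> A (Min (snd c))" by (rule PiE_mem[rotated])
    then show "g r c \<in> {..n}"
      using box_le[OF A_box[OF v], of "r (Min (snd c))" "fst c"] C_color[OF c] c by (auto simp: g_def)
  qed (auto simp: g_def)
  have fib: "{r \<in> X. g r = x} = Pi\<^sub>E V (pinned C x)" if x: "x \<in> C \<rightarrow>\<^sub>E {..n}" for x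
  proof (intro equalityI subsetI)
    fix r assume "r \<in> {r \<in> X. g r = x}"
    then have r: "r \<in> Pi\<^sub>E V A" "\<And>c v w. c \<in> C \<Longrightarrow> v \<in> snd c \<Longrightarrow> w \<in> snd c \<Longrightarrow> r v (fst c) = r w (fst c)"
      and gr: "g r = x" unfolding X_def by blast+
    have "r v (fst c) = x c" if "c \<in> C" "v \<in> snd c" for c v
      using r(2)[OF that Min_in[OF that(1)]] that unfolding gr[symmetric] by (simp add: g_def)
    then have "r v \<in> pinned C x v" if "v \<in> V" for v
      using r(1) that by (simp add: pinned_def PiE_iff)
    then show "r \<in> Pi\<^sub>E V (pinned C x)" using r(1) by (simp add: PiE_iff)
  next
    fix r assume r: "r \<in> Pi\<^sub>E V (pinned C x)"
    have rx: "r v (fst c) = x c" if "c \<in> C" "v \<in> snd c" for c v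
    proof -
      have "r v \<in> pinned C x v" using r C_verts[OF that(1)] that(2) by auto
      then show ?thesis using that by (simp add: pinned_def)
    qed
    have "r \<in> Pi\<^sub>E V A" using r by (auto simp: pinned_def PiE_iff)
    moreover have "g r = x"
    proof
      fix c show "g r c = x c"
        using rx[OF _ Min_in, of c] PiE_arb[OF x, of c] by (cases "c \<in> C") (simp_all add: g_def)
    qed
    moreover have "r v (fst c) = r w (fst c)" if "c \<in> C" "v \<in> snd c" "w \<in> snd c" for c v w
      using rx[OF that(1,2)] rx[OF that(1,3)] by simp
    ultimately show "r \<in> {r \<in> X. g r = x}" unfolding X_def by blast
  qed
  have "(\<Sum>r\<in>X. \<Prod>v\<in>V. f (r v) \<omega>) = (\<Sum>x\<in>C \<rightarrow>\<^sub>E {..n}. \<Sum>r\<in>{r \<in> X. g r = x}. \<Prod>v\<in>V. f (r v) \<omega>)"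
    by (rule sum.group[symmetric, OF finX _ gX]) (intro finite_PiE finite_C, simp)
  also have "\<dots> = (\<Sum>x\<in>C \<rightarrow>\<^sub>E {..n}. \<Sum>r\<in>Pi\<^sub>E V (pinned C x). \<Prod>v\<in>V. f (r v) \<omega>)"
    by (intro sum.cong refl fib)
  also have "\<dots> = (\<Sum>x\<in>C \<rightarrow>\<^sub>E {..n}. \<Prod>v\<in>V. S (pinned C x v) \<omega>)"
  proof (intro sum.cong refl)
    fix x
    have "finite (pinned C x v)" if "v \<in> V" for v
      by (rule finite_subset[OF _ finA[OF that]]) (auto simp: pinned_def)
    then show "(\<Sum>r\<in>Pi\<^sub>E V (pinned C x). \<Prod>v\<in>V. f (r v) \<omega>) = (\<Prod>v\<in>V. S (pinned C x v) \<omega>)"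
      unfolding S_def by (rule prod_sum_PiE[OF finite_V, symmetric])
  qed
  finally show ?thesis .
qed

definition matching :: "(nat \<times> nat set) set \<Rightarrow> bool" where
  "matching P \<longleftrightarrow> P \<subseteq> C \<and> (\<forall>c\<in>P. card (snd c) = 2) \<and> (\<forall>c\<in>P. \<forall>c'\<in>P. c \<noteq> c' \<longrightarrow> snd c \<inter> snd c' = {})"

text \<open>A matched vertex lies in only one clique of \<open>P\<close>, so each value of such a
  clique enters the two factors of its own pair and nothing else; the sum over these values
  factors.\<close>

lemma sum_prod_matching:
  assumes P: "matching P"
  shows "(\<Sum>r\<in>X. \<Prod>v\<in>V. f (r v) \<omega>) =
    (\<Sum>y\<in>(C - P) \<rightarrow>\<^sub>E {..n}. (\<Prod>v\<in>V - \<Union>(snd ` P). S (pinned (C - P) y v) \<omega>) *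
       (\<Prod>c\<in>P. \<Sum>s\<le>n. \<Prod>v\<in>snd c. S (fiber (fst c) s (pinned (C - P) y v)) \<omega>))"
proof -
  let ?W = "\<Union>(snd ` P)"
  have PC: "P \<subseteq> C" using P by (simp add: matching_def)
  have finP: "finite P" using PC finite_C finite_subset by blast
  have WV: "?W \<subseteq> V" using PC C_verts by blast
  have disj: "c = c'" if "c \<in> P" "c' \<in> P" "v \<in> snd c" "v \<in> snd c'" for c c' v
  proof -
    have "\<forall>c\<in>P. \<forall>c'\<in>P. c \<noteq> c' \<longrightarrow> snd c \<inter> snd c' = {}" using P by (simp add: matching_def)
    then show ?thesis using that by blast
  qed
  have out: "pinned C (\<lambda>c. if c \<in> P then z c else y c) v = pinned (C - P) y v" if "v \<notin> ?W" for v and y z :: "nat \<times> nat set \<Rightarrow> nat"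
    using that PC by (auto simp: pinned_def)
  have ins: "pinned C (\<lambda>c. if c \<in> P then z c else y c) v = fiber (fst c) (z c) (pinned (C - P) y v)"
    if c: "c \<in> P" "v \<in> snd c" for c v and y z :: "nat \<times> nat set \<Rightarrow> nat"
  proof -
    have "(\<forall>c'\<in>C. v \<in> snd c' \<longrightarrow> r (fst c') = (if c' \<in> P then z c' else y c')) \<longleftrightarrow>
        (\<forall>c'\<in>C - P. v \<in> snd c' \<longrightarrow> r (fst c') = y c') \<and> r (fst c) = z c" (is "?l \<longleftrightarrow> ?r") for r :: "nat \<Rightarrow> nat"
    proof
      assume l: ?l
      show ?r
      proof (intro conjI ballI impI)
        show "r (fst c) = z c" using bspec[OF l, of c] c PC by auto
      next
        fix c' assume "c' \<in> C - P" "v \<in> snd c'"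
        then show "r (fst c') = y c'" using bspec[OF l, of c'] by simp
      qed
    next
      assume rr: ?r
      show ?l
      proof (intro ballI impI)
        fix c' assume c': "c' \<in> C" "v \<in> snd c'"
        show "r (fst c') = (if c' \<in> P then z c' else y c')"
        proof (cases "c' \<in> P")
          case True
          then have "c' = c" using disj[OF True c(1) c'(2) c(2)] by simp
          then show ?thesis using rr c by simp
        next
          case False
          then show ?thesis using rr c' by simp
        qed
      qed
    qed
    then show ?thesis unfolding pinned_def fiber_def by auto
  qed
  have pr: "(\<Prod>v\<in>V. S (pinned C (\<lambda>c. if c \<in> P then z c else y c) v) \<omega>) =
     (\<Prod>v\<in>V - ?W. S (pinned (C - P) y v) \<omega>) * (\<Prod>c\<in>P. \<Prod>v\<in>snd c. S (fiber (fst c) (z c) (pinned (C - P) y v)) \<omega>)"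
    for y z :: "nat \<times> nat set \<Rightarrow> nat"
  proof -
    let ?F = "\<lambda>v. S (pinned C (\<lambda>c. if c \<in> P then z c else y c) v) \<omega>"
    have "(\<Prod>v\<in>V. ?F v) = (\<Prod>v\<in>V - ?W. ?F v) * (\<Prod>v\<in>?W. ?F v)"
      by (rule prod.subset_diff[OF WV finite_V])
    also have "(\<Prod>v\<in>?W. ?F v) = (\<Prod>c\<in>P. \<Prod>v\<in>snd c. ?F v)"
      using disj by (intro prod.UNION_disjoint finP ballI) (use finite_snd PC in blast)+
    also have "\<dots> = (\<Prod>c\<in>P. \<Prod>v\<in>snd c. S (fiber (fst c) (z c) (pinned (C - P) y v)) \<omega>)"
      by (intro prod.cong refl) (simp add: ins)
    also have "(\<Prod>v\<in>V - ?W. ?F v) = (\<Prod>v\<in>V - ?W. S (pinned (C - P) y v) \<omega>)"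
      by (intro prod.cong refl) (simp add: out)
    finally show ?thesis .
  qed
  have "(\<Sum>r\<in>X. \<Prod>v\<in>V. f (r v) \<omega>) = (\<Sum>y\<in>(C - P) \<rightarrow>\<^sub>E {..n}. \<Sum>z\<in>P \<rightarrow>\<^sub>E {..n}.
     (\<Prod>v\<in>V - ?W. S (pinned (C - P) y v) \<omega>) * (\<Prod>c\<in>P. \<Prod>v\<in>snd c. S (fiber (fst c) (z c) (pinned (C - P) y v)) \<omega>))"
    unfolding sum_prod_pinned sum_PiE_Diff[OF PC] pr ..
  also have "\<dots> = (\<Sum>y\<in>(C - P) \<rightarrow>\<^sub>E {..n}. (\<Prod>v\<in>V - ?W. S (pinned (C - P) y v) \<omega>) *
       (\<Prod>c\<in>P. \<Sum>s\<le>n. \<Prod>v\<in>snd c. S (fiber (fst c) s (pinned (C - P) y v)) \<omega>))"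
    unfolding sum_distrib_left[symmetric]
    by (intro sum.cong refl arg_cong2[of _ _ _ _ "(*)"] prod_sum_PiE[symmetric] finP) simp
  finally show ?thesis .
qed

text \<open>The constant of \<open>bnd_ordered_pair\<close> for \<open>D = {1..d}\<close>.\<close>

definition pair_const :: "nat \<Rightarrow> real" where "pair_const m = 2 * 5 ^ d * B m"

lemma bnd_single:
  assumes P: "matching P" and v: "v \<in> V - \<Union>(snd ` P)" and m: "1 \<le> m"
  shows "bnd \<Omega> (2*m) (S (pinned (C - P) y v)) (B m * real (Suc n) powr ((real (card (free v)) - 1) / 2))"
proof -
  obtain N where N: "slice ({1..d} - colors (C - P) v) N (pinned (C - P) y v)"
    using slice_pinned[of v "C - P"] v by blast
  have "{c \<in> C - P. v \<in> snd c} = {c \<in> C. v \<in> snd c}" using v by auto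
  then have "{1..d} - colors (C - P) v = free v" by (simp add: free_def colors_def)
  with N show ?thesis using bnd_slice[OF _ one_free m] by simp
qed

text \<open>Two single vertices and an unrestricted sum over \<open>s\<close> would give the
  exponent without the last term. \<open>bnd_ordered_pair\<close> is used with coordinate 1 as
  \<open>j\<close>, which is never a color; the larger vertex supplies \<open>R\<close>, as its
  first coordinates lie in the higher block.\<close>

lemma bnd_pair:
  assumes P: "matching P" and c: "c \<in> P" and m: "1 \<le> m"
  shows "bnd \<Omega> (2*m) (\<lambda>\<omega>. \<Sum>s\<le>n. \<Prod>v\<in>snd c. S (fiber (fst c) s (pinned (C - P) y v)) \<omega>)
    (pair_const m * real (Suc n) powr ((\<Sum>v\<in>snd c. real (card (free v)) / 2) - (1/2) ^ d / 2))"
proof -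
  have cC: "c \<in> C" and c2: "card (snd c) = 2" using P c by (auto simp: matching_def)
  obtain a b where ab: "snd c = {a, b}" "a \<noteq> b" using c2 by (auto simp: card_2_iff)
  obtain v w where vw: "snd c = {v, w}" "v < w"
  proof (cases "a < b")
    case False
    then show ?thesis using ab that[of b a] by (simp add: insert_commute)
  qed (use ab that in blast)
  have vwV: "v \<in> V" "w \<in> V" using C_verts[OF cC] vw by auto
  have ins: "{1..d} - colors (C - P) u = insert (fst c) (free u)" if u: "u \<in> snd c" for u
  proof -
    have "\<forall>c'\<in>P. c \<noteq> c' \<longrightarrow> snd c \<inter> snd c' = {}" using P c by (simp add: matching_def)
    then have uniq: "c' = c" if "c' \<in> P" "u \<in> snd c'" for c' using that u by (metis IntI empty_iff)
    have "{c' \<in> C. u \<in> snd c'} = insert c {c' \<in> C - P. u \<in> snd c'}"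
    proof (intro equalityI subsetI)
      fix c' assume "c' \<in> {c' \<in> C. u \<in> snd c'}"
      then show "c' \<in> insert c {c' \<in> C - P. u \<in> snd c'}" using uniq[of c'] by (cases "c' \<in> P") simp_all
    qed (use u cC in auto)
    then have "colors C u = insert (fst c) (colors (C - P) u)" by (simp add: colors_def)
    moreover have "fst c \<notin> colors (C - P) u"
      using C_disjoint[OF cC _ _ u] c by (auto simp: colors_def)
    moreover have "fst c \<in> {1..d}" using C_color[OF cC] by auto
    ultimately show ?thesis by (auto simp: free_def)
  qed
  have nf: "fst c \<notin> free u" if "u \<in> snd c" for u
    using that cC by (auto simp: free_def colors_def)
  have ins1: "insert 1 (free u - {1}) = free u" for u using one_free[of u] by auto
  obtain N where N: "slice (insert (fst c) (insert 1 (free w - {1}))) N (pinned (C - P) y w)"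
    using slice_pinned[OF vwV(2), of "C - P"] ins[of w] vw ins1 by (metis Diff_subset insertCI)
  obtain N' where N': "slice (insert (fst c) (free v)) N' (pinned (C - P) y v)"
    using slice_pinned[OF vwV(1), of "C - P"] ins[of v] vw by (metis Diff_subset insertCI)
  have "bnd \<Omega> (2*m) (\<lambda>\<omega>. \<Sum>s<Suc n. S (fiber (fst c) s (pinned (C - P) y w)) \<omega> * S (fiber (fst c) s (pinned (C - P) y v)) \<omega>)
     (2 * 5 ^ card {1..d} * B m * real (Suc n) powr ((real (card (insert 1 (free w - {1}))) + real (card (free v))) / 2 - (1/2) ^ card {1..d} / 2))"
  proof (rule bnd_ordered_pair[OF _ _ _ _ _ _ N N' _ m])
    fix r r' assume "r \<in> pinned (C - P) y w" "r' \<in> pinned (C - P) y v"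
    then show "r' 1 < r 1" using A_less[OF vwV vw(2)] by (auto simp: pinned_def)
  next
    have "fst c \<noteq> 1" using C_color[OF cC] by auto
    then show "fst c \<notin> insert 1 (free w - {1})" using nf[of w] vw by simp
    show "fst c \<notin> free v" using nf[of v] vw by simp
  qed (use finite_free one_free in auto)
  moreover have "(\<Sum>s<Suc n. S (fiber (fst c) s (pinned (C - P) y w)) \<omega> * S (fiber (fst c) s (pinned (C - P) y v)) \<omega>)
      = (\<Sum>s\<le>n. \<Prod>v\<in>snd c. S (fiber (fst c) s (pinned (C - P) y v)) \<omega>)" for \<omega>
    unfolding lessThan_Suc_atMost using vw by (intro sum.cong refl) (simp add: mult.commute)
  moreover have "(real (card (free w)) + real (card (free v))) / 2 = (\<Sum>v\<in>snd c. real (card (free v)) / 2)"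
    using vw by (simp add: add_divide_distrib)
  ultimately show ?thesis by (simp only: ins1 pair_const_def card_atLeastAtMost diff_Suc_1 add_diff_cancel_right')
qed

lemma bnd_sum_prod:
  assumes P: "matching P" and m: "1 \<le> m" and V: "V \<noteq> {}"
  shows "bnd \<Omega> (2*m) (\<lambda>\<omega>. \<Sum>r\<in>X. \<Prod>v\<in>V. f (r v) \<omega>)
    (pair_const (2*m*card V) ^ card V * real (Suc n) powr
       (real (card C) - real (card P) + (\<Sum>v\<in>V. (real (card (free v)) - 1) / 2) + real (card P) * (1 - (1/2) ^ d / 2)))"
proof -
  let ?W = "\<Union>(snd ` P)"
  define m' where "m' = 2 * m * card V"
  define K where "K = pair_const m'"
  define L where "L = real (Suc n)"
  define e where "e v = (real (card (free v)) - 1) / 2" for v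
  define \<theta> :: real where "\<theta> = 1 - (1/2) ^ d / 2"
  have cV: "1 \<le> card V" using V finite_V by (simp add: Suc_le_eq card_gt_0_iff)
  have m': "1 \<le> m'" using m cV by (simp add: m'_def)
  have m2: "1 \<le> 2 * m" "1 \<le> 2 * (2 * m)" using m by auto
  have PC: "P \<subseteq> C" using P by (simp add: matching_def)
  have finP: "finite P" using PC finite_C finite_subset by blast
  have WV: "?W \<subseteq> V" using PC C_verts by blast
  have finW: "finite ?W" using WV finite_V finite_subset by blast
  have L1: "1 \<le> L" by (simp add: L_def)
  have B1: "1 \<le> B m'" by (rule B_ge(2)[OF m'])
  have "(1::real) \<le> 5 ^ d" by simp
  then have "1 * B m' \<le> (2 * 5 ^ d) * B m'" using B1 by (intro mult_right_mono) linarith+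
  then have BK: "B m' \<le> K" by (simp add: K_def pair_const_def)
  have K1: "1 \<le> K" using B1 BK by linarith
  have disjP: "\<forall>c\<in>P. \<forall>c'\<in>P. c \<noteq> c' \<longrightarrow> snd c \<inter> snd c' = {}" using P by (simp add: matching_def)
  have card2: "card (snd c) = 2" if "c \<in> P" for c using P that by (simp add: matching_def)
  have cW: "card ?W = 2 * card P"
  proof -
    have "card ?W = (\<Sum>c\<in>P. card (snd c))"
      by (rule card_UN_disjoint[OF finP]) (use disjP finite_snd PC in blast)+
    then show ?thesis using card2 by simp
  qed
  have cVW: "card (V - ?W) = card V - 2 * card P" "2 * card P \<le> card V"
    using card_Diff_subset[OF finW WV] card_mono[OF finite_V WV] cW by auto
  have sW: "(\<Sum>v\<in>?W. e v) = (\<Sum>c\<in>P. \<Sum>v\<in>snd c. e v)"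
    by (rule sum.UNION_disjoint[OF finP]) (use disjP finite_snd PC in blast)+
  have pair: "bnd \<Omega> (2*m') (\<lambda>\<omega>. \<Sum>s\<le>n. \<Prod>v\<in>snd c. S (fiber (fst c) s (pinned (C - P) y v)) \<omega>)
      (K * L powr ((\<Sum>v\<in>snd c. e v) + \<theta>))" if "c \<in> P" for c y
  proof -
    have "(\<Sum>v\<in>snd c. e v) = (\<Sum>v\<in>snd c. real (card (free v)) / 2) - 1"
      using card2[OF that] by (simp add: e_def diff_divide_distrib sum_subtractf)
    then show ?thesis using bnd_pair[OF P that m', of y] by (simp add: K_def L_def \<theta>_def algebra_simps)
  qed
  have single: "bnd \<Omega> (2*m') (S (pinned (C - P) y v)) (K * L powr e v)" if "v \<in> V - ?W" for v y
    by (rule bnd_weaken[OF bnd_single[OF P that m']])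
      (use BK in \<open>auto simp: L_def e_def intro!: mult_right_mono\<close>)
  have ee: "2 * m' = 2 * (2 * m) * card V" by (simp add: m'_def)
  have summand: "bnd \<Omega> (2*m) (\<lambda>\<omega>. (\<Prod>v\<in>V - ?W. S (pinned (C - P) y v) \<omega>) *
       (\<Prod>c\<in>P. \<Sum>s\<le>n. \<Prod>v\<in>snd c. S (fiber (fst c) s (pinned (C - P) y v)) \<omega>))
     (K ^ card V * L powr ((\<Sum>v\<in>V. e v) + real (card P) * \<theta>))" for y
  proof -
    have b1: "bnd \<Omega> (2*(2*m)) (\<lambda>\<omega>. \<Prod>v\<in>V - ?W. S (pinned (C - P) y v) \<omega>) (\<Prod>v\<in>V - ?W. K * L powr e v)"
      by (rule bnd_prod[OF finite_space space_nonempty m2(2) _ _ single[unfolded ee]]) (use finite_V cVW in auto)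
    have b2: "bnd \<Omega> (2*(2*m)) (\<lambda>\<omega>. \<Prod>c\<in>P. \<Sum>s\<le>n. \<Prod>v\<in>snd c. S (fiber (fst c) s (pinned (C - P) y v)) \<omega>)
        (\<Prod>c\<in>P. K * L powr ((\<Sum>v\<in>snd c. e v) + \<theta>))"
      by (rule bnd_prod[OF finite_space space_nonempty m2(2) _ _ pair[unfolded ee]]) (use finP cVW in auto)
    have p1: "(\<Prod>v\<in>V - ?W. K * L powr e v) = K ^ card (V - ?W) * L powr (\<Sum>v\<in>V - ?W. e v)"
      using L1 finite_V by (simp add: prod.distrib powr_sum)
    have p2: "(\<Prod>c\<in>P. K * L powr ((\<Sum>v\<in>snd c. e v) + \<theta>)) = K ^ card P * L powr ((\<Sum>v\<in>?W. e v) + real (card P) * \<theta>)"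
    proof -
      have "(\<Sum>c\<in>P. (\<Sum>v\<in>snd c. e v) + \<theta>) = (\<Sum>v\<in>?W. e v) + real (card P) * \<theta>"
        unfolding sW by (simp add: sum.distrib)
      moreover have "(\<Prod>c\<in>P. L powr ((\<Sum>v\<in>snd c. e v) + \<theta>)) = L powr (\<Sum>c\<in>P. (\<Sum>v\<in>snd c. e v) + \<theta>)"
        using L1 finP by (intro powr_sum[symmetric]) auto
      ultimately show ?thesis by (simp add: prod.distrib)
    qed
    have "(\<Sum>v\<in>V - ?W. e v) + ((\<Sum>v\<in>?W. e v) + real (card P) * \<theta>) = (\<Sum>v\<in>V. e v) + real (card P) * \<theta>"
      using sum.subset_diff[OF WV finite_V, of e] by linarith
    then have pw: "L powr (\<Sum>v\<in>V - ?W. e v) * L powr ((\<Sum>v\<in>?W. e v) + real (card P) * \<theta>) = L powr ((\<Sum>v\<in>V. e v) + real (card P) * \<theta>)"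
      by (simp only: powr_add[symmetric])
    have "(\<Prod>v\<in>V - ?W. K * L powr e v) * (\<Prod>c\<in>P. K * L powr ((\<Sum>v\<in>snd c. e v) + \<theta>))
       = K ^ (card (V - ?W) + card P) * L powr ((\<Sum>v\<in>V. e v) + real (card P) * \<theta>)"
      unfolding p1 p2 power_add pw[symmetric] by (simp only: mult_ac)
    also have "\<dots> \<le> K ^ card V * L powr ((\<Sum>v\<in>V. e v) + real (card P) * \<theta>)"
      using K1 cVW by (intro mult_right_mono power_increasing) auto
    finally show ?thesis
      by (rule bnd_weaken[OF bnd_mult[OF finite_space space_nonempty m2(1) b1 b2]])
  qed
  have "bnd \<Omega> (2*m) (\<lambda>\<omega>. \<Sum>r\<in>X. \<Prod>v\<in>V. f (r v) \<omega>)
     (\<Sum>y\<in>(C - P) \<rightarrow>\<^sub>E {..n}. K ^ card V * L powr ((\<Sum>v\<in>V. e v) + real (card P) * \<theta>))"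
    unfolding sum_prod_matching[OF P] by (intro bnd_sum[OF finite_space space_nonempty m2(1)] summand)
  moreover have "(\<Sum>y\<in>(C - P) \<rightarrow>\<^sub>E {..n}. K ^ card V * L powr ((\<Sum>v\<in>V. e v) + real (card P) * \<theta>))
    = K ^ card V * L powr (real (card C) - real (card P) + (\<Sum>v\<in>V. e v) + real (card P) * \<theta>)"
  proof -
    have ex: "L powr (real (card C) - real (card P) + (\<Sum>v\<in>V. e v) + real (card P) * \<theta>)
        = L powr (real (card C) - real (card P)) * L powr ((\<Sum>v\<in>V. e v) + real (card P) * \<theta>)"
      by (simp only: powr_add[symmetric] add.assoc)
    have "real (card ((C - P) \<rightarrow>\<^sub>E {..n})) = L ^ card (C - P)"
      using finite_C by (simp add: card_PiE L_def)
    also have "\<dots> = L powr (real (card C) - real (card P))"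
      using L1 card_Diff_subset[OF finP PC] card_mono[OF finite_C PC] by (simp add: powr_realpow[symmetric] of_nat_diff)
    finally have c: "real (card ((C - P) \<rightarrow>\<^sub>E {..n})) = L powr (real (card C) - real (card P))" .
    show ?thesis unfolding ex sum_constant c by (simp only: mult_ac)
  qed
  ultimately show ?thesis by (simp only: K_def m'_def L_def e_def \<theta>_def)
qed

lemma sum_degree: "(\<Sum>v\<in>V. real (card {c \<in> C. v \<in> snd c})) = (\<Sum>c\<in>C. real (card (snd c)))"
proof -
  have "(\<Sum>v\<in>V. real (card {c \<in> C. v \<in> snd c})) = (\<Sum>v\<in>V. \<Sum>c\<in>C. if v \<in> snd c then 1 else 0)"
    using finite_C by (simp add: sum.If_cases Int_def)
  also have "\<dots> = (\<Sum>c\<in>C. \<Sum>v\<in>V. if v \<in> snd c then 1 else 0)" by (rule sum.swap)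
  also have "\<dots> = (\<Sum>c\<in>C. real (card (snd c)))"
    using C_verts finite_V by (intro sum.cong refl) (auto simp: sum.If_cases Int_absorb1)
  finally show ?thesis .
qed

lemma exists_large_matching:
  obtains P where "matching P"
    "real (card V) \<le> 4 * real d * real (card P) + 6 * (\<Sum>c\<in>C. real (card (snd c)) / 2 - 1)"
proof -
  let ?M = "{P. matching P}"
  have "finite ?M" by (rule finite_subset[of _ "Pow C"]) (auto simp: matching_def finite_C)
  moreover have "{} \<in> ?M" by (simp add: matching_def)
  ultimately have fin: "finite (card ` ?M)" "card ` ?M \<noteq> {}" by auto
  obtain P where P: "matching P" "card P = Max (card ` ?M)" using Max_in[OF fin] by auto
  have Pmax: "card P' \<le> card P" if "matching P'" for P'
    unfolding P(2) by (rule Max_ge[OF fin(1)]) (use that in simp)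
  note P = P(1)
  have PC: "P \<subseteq> C" using P by (simp add: matching_def)
  have finP: "finite P" using PC finite_C finite_subset by blast
  let ?W = "\<Union>(snd ` P)"
  define Big where "Big = {c \<in> C. 3 \<le> card (snd c)}"
  define Two where "Two w = {c \<in> C. card (snd c) = 2 \<and> w \<in> snd c}" for w
  have WV: "?W \<subseteq> V" using PC C_verts by blast
  have finW: "finite ?W" using WV finite_V finite_subset by blast
  have cW: "card ?W \<le> 2 * card P"
  proof -
    have "card ?W \<le> (\<Sum>c\<in>P. card (snd c))" by (rule card_UN_le[OF finP])
    then show ?thesis using P by (simp add: matching_def)
  qed
  have cover: "V \<subseteq> (\<Union>c\<in>Big. snd c) \<union> (\<Union>w\<in>?W. \<Union>c\<in>Two w. snd c)"
  proof
    fix v assume "v \<in> V"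
    then obtain c where c: "c \<in> C" "v \<in> snd c" using C_cover by blast
    show "v \<in> (\<Union>c\<in>Big. snd c) \<union> (\<Union>w\<in>?W. \<Union>c\<in>Two w. snd c)"
    proof (cases "card (snd c) = 2")
      case False
      then have "c \<in> Big" using C_card[OF c(1)] c by (auto simp: Big_def)
      then show ?thesis using c by blast
    next
      case True
      have "\<exists>w\<in>?W. w \<in> snd c"
      proof (rule ccontr)
        assume no: "\<not> ?thesis"
        then have "matching (insert c P)" using P c True by (auto simp: matching_def)
        then have "card (insert c P) \<le> card P" by (rule Pmax)
        moreover have "c \<notin> P" using no c by blast
        ultimately show False using finP by simp
      qed
      then obtain w where "w \<in> ?W" "c \<in> Two w" using True c by (auto simp: Two_def)
      then show ?thesis using c by blast
    qed
  qed
  have finT: "finite (Two w)" for w using finite_C by (simp add: Two_def)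
  have finB: "finite Big" using finite_C by (simp add: Big_def)
  have cT: "card (\<Union>c\<in>Two w. snd c) \<le> 2 * d" for w
  proof -
    have "card (Two w) \<le> card {c \<in> C. w \<in> snd c}" using finite_C by (intro card_mono) (auto simp: Two_def)
    also have "\<dots> = card (colors C w)" by (simp add: card_colors)
    also have "\<dots> \<le> card {2..d}" by (rule card_mono[OF _ colors_subset]) auto
    finally have "card (Two w) \<le> d" by simp
    moreover have "card (\<Union>c\<in>Two w. snd c) \<le> (\<Sum>c\<in>Two w. card (snd c))" by (rule card_UN_le[OF finT])
    moreover have "(\<Sum>c\<in>Two w. card (snd c)) = 2 * card (Two w)" by (simp add: Two_def)
    ultimately show ?thesis by linarith
  qed
  have "(\<Union>c\<in>Big. snd c) \<union> (\<Union>w\<in>?W. \<Union>c\<in>Two w. snd c) \<subseteq> V"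
    unfolding Big_def Two_def using C_verts by blast
  then have "card V \<le> card ((\<Union>c\<in>Big. snd c) \<union> (\<Union>w\<in>?W. \<Union>c\<in>Two w. snd c))"
    using finite_subset[OF _ finite_V] by (intro card_mono cover)
  also have "\<dots> \<le> card (\<Union>c\<in>Big. snd c) + card (\<Union>w\<in>?W. \<Union>c\<in>Two w. snd c)" by (rule card_Un_le)
  also have "\<dots> \<le> (\<Sum>c\<in>Big. card (snd c)) + (\<Sum>w\<in>?W. card (\<Union>c\<in>Two w. snd c))"
    by (intro add_mono card_UN_le finB finW)
  also have "\<dots> \<le> (\<Sum>c\<in>Big. card (snd c)) + 2 * card P * (2 * d)"
  proof -
    have "(\<Sum>w\<in>?W. card (\<Union>c\<in>Two w. snd c)) \<le> card ?W * (2 * d)"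
      using sum_bounded_above[of ?W "\<lambda>w. card (\<Union>c\<in>Two w. snd c)" "2 * d"] cT by simp
    also have "\<dots> \<le> 2 * card P * (2 * d)" by (intro mult_le_mono1 cW)
    finally show ?thesis by simp
  qed
  finally have "real (card V) \<le> real ((\<Sum>c\<in>Big. card (snd c)) + 2 * card P * (2 * d))" by (rule of_nat_mono)
  then have 1: "real (card V) \<le> (\<Sum>c\<in>Big. real (card (snd c))) + 4 * real d * real (card P)" by (simp add: algebra_simps)
  have "(\<Sum>c\<in>Big. real (card (snd c))) \<le> (\<Sum>c\<in>Big. 6 * (real (card (snd c)) / 2 - 1))"
    by (intro sum_mono) (auto simp: Big_def)
  also have "\<dots> \<le> (\<Sum>c\<in>C. 6 * (real (card (snd c)) / 2 - 1))"
    using C_card by (intro sum_mono2 finite_C) (auto simp: Big_def field_simps)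
  finally have "(\<Sum>c\<in>Big. real (card (snd c))) \<le> 6 * (\<Sum>c\<in>C. real (card (snd c)) / 2 - 1)" by (simp only: sum_distrib_left)
  then show ?thesis using 1 by (intro that[OF P]) linarith
qed

lemma bnd_sum_prod_gain:
  assumes m: "1 \<le> m" and V: "V \<noteq> {}"
  shows "bnd \<Omega> (2*m) (\<lambda>\<omega>. \<Sum>r\<in>X. \<Prod>v\<in>V. f (r v) \<omega>)
    (pair_const (2*m*card V) ^ card V * real (Suc n) powr (((real d - 1) / 2 - (1/2) ^ d / (8 * real d)) * real (card V)))"
proof -
  obtain P where P: "matching P"
    and big: "real (card V) \<le> 4 * real d * real (card P) + 6 * (\<Sum>c\<in>C. real (card (snd c)) / 2 - 1)"
    by (rule exists_large_matching)
  define \<delta> :: real where "\<delta> = (1/2) ^ d"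
  have \<delta>: "0 < \<delta>" "\<delta> \<le> 1" by (auto simp: \<delta>_def power_le_one)
  define s where "s = (\<Sum>c\<in>C. real (card (snd c)) / 2 - 1)"
  have s0: "0 \<le> s" unfolding s_def by (intro sum_nonneg) (use C_card in fastforce)
  have d1: "1 \<le> real d" using d_pos by simp
  have "(\<Sum>v\<in>V. (real (card (free v)) - 1) / 2) = (\<Sum>v\<in>V. (real d - 1) / 2 - real (card {c \<in> C. v \<in> snd c}) / 2)"
    unfolding card_free by (intro sum.cong refl) (simp add: field_simps)
  also have "\<dots> = (real d - 1) / 2 * real (card V) - (\<Sum>c\<in>C. real (card (snd c))) / 2"
    by (simp add: sum_subtractf sum_divide_distrib[symmetric] sum_degree)
  finally have e: "(\<Sum>v\<in>V. (real (card (free v)) - 1) / 2) = (real d - 1) / 2 * real (card V) - (\<Sum>c\<in>C. real (card (snd c))) / 2" .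
  have s': "s = (\<Sum>c\<in>C. real (card (snd c))) / 2 - real (card C)"
    by (simp add: s_def sum_subtractf sum_divide_distrib)
  have "\<delta> / (8 * real d) * real (card V) \<le> \<delta> / (8 * real d) * (4 * real d * real (card P) + 6 * s)"
    using big \<delta> d1 by (intro mult_left_mono) (auto simp: s_def)
  also have "\<dots> = real (card P) * \<delta> / 2 + (6 * \<delta> / (8 * real d)) * s" using d1 by (simp add: field_simps)
  also have "(6 * \<delta> / (8 * real d)) * s \<le> 1 * s"
    using \<delta> d1 s0 by (intro mult_right_mono) (auto simp: divide_le_eq)
  finally have g: "\<delta> / (8 * real d) * real (card V) \<le> real (card P) * \<delta> / 2 + s" by simp
  have ex: "real (card C) - real (card P) + (\<Sum>v\<in>V. (real (card (free v)) - 1) / 2) + real (card P) * (1 - (1/2) ^ d / 2)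
      \<le> ((real d - 1) / 2 - (1/2) ^ d / (8 * real d)) * real (card V)"
    using g unfolding e \<delta>_def s' left_diff_distrib right_diff_distrib by linarith
  have m2: "1 \<le> 2 * m * card V" using m V finite_V by (simp add: Suc_le_eq card_gt_0_iff)
  show ?thesis
    by (rule bnd_weaken[OF bnd_sum_prod[OF P m V]])
      (use ex B_ge(2)[OF m2] in \<open>intro mult_left_mono powr_mono, auto simp: pair_const_def\<close>)
qed

end

subsection \<open>Admissible graphs\<close>

lemma admissible_equiv:
  "admissible d q G \<Longrightarrow> j \<in> {2..d} \<Longrightarrow> equiv (verts G) (Id_on (verts G) \<union> edges G j)"
  by (simp add: admissible_def)

lemma admissible_verts:
  assumes "admissible d q G" shows "verts G \<subseteq> {1..q}"
  using assms by (simp add: admissible_def is_colored_graph_def)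

lemma admissible_edges:
  assumes "admissible d q G" "j \<in> {2..d}" shows "edges G j \<subseteq> verts G \<times> verts G - Id"
proof -
  have "is_colored_graph d q G" using assms(1) unfolding admissible_def by (rule conjunct1)
  then show ?thesis using assms(2) by (simp add: is_colored_graph_def)
qed

lemma pairwise_joinedD:
  "pairwise_joined G j Q \<Longrightarrow> v \<in> Q \<Longrightarrow> w \<in> Q \<Longrightarrow> v \<noteq> w \<Longrightarrow> (v, w) \<in> edges G j"
  by (simp add: pairwise_joined_def)

lemma equiv_common_left:
  assumes "equiv A R" "(v, a) \<in> R" "(v, b) \<in> R"
  shows "(a, b) \<in> R"
proof -
  have "sym R" "trans R" using assms(1) by (auto elim: equivE)
  then show ?thesis using transD[of R a v b] symD[of R v a] assms(2,3) by simp
qed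

lemma edge_in_clique:
  assumes adm: "admissible d q G" and j: "j \<in> {2..d}" and e: "(v, w) \<in> edges G j"
  shows "\<exists>Q. clique G j Q \<and> v \<in> Q \<and> w \<in> Q"
proof -
  let ?R = "Id_on (verts G) \<union> edges G j"
  have eq: "equiv (verts G) ?R" by (rule admissible_equiv[OF adm j])
  have sub: "verts G \<subseteq> {1..q}" "edges G j \<subseteq> verts G \<times> verts G - Id"
    by (rule admissible_verts[OF adm], rule admissible_edges[OF adm j])
  have vw: "v \<in> verts G" "w \<in> verts G" "v \<noteq> w" using e sub by auto
  define Q where "Q = ?R `` {v}"
  have QV: "Q \<subseteq> verts G" using sub by (auto simp: Q_def)
  have finQ: "finite Q" using QV sub(1) by (meson finite_atLeastAtMost finite_subset)
  have vQ: "v \<in> Q" "w \<in> Q" using e vw by (auto simp: Q_def)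
  have "pairwise_joined G j Q"
    unfolding pairwise_joined_def
  proof (intro conjI QV ballI impI)
    fix a b assume ab: "a \<in> Q" "b \<in> Q" "a \<noteq> b"
    then have "(v, a) \<in> ?R" "(v, b) \<in> ?R" by (auto simp: Q_def)
    then have "(a, b) \<in> ?R" by (rule equiv_common_left[OF eq])
    then show "(a, b) \<in> edges G j" using ab(3) by auto
  qed
  moreover have "Q' = Q" if Q': "pairwise_joined G j Q'" "Q \<subseteq> Q'" for Q'
  proof (intro equalityI subsetI)
    fix u assume u: "u \<in> Q'"
    have "v \<in> Q'" using Q'(2) vQ(1) by blast
    then have "u = v \<or> (v, u) \<in> edges G j" using pairwise_joinedD[OF Q'(1) _ u] by metis
    then show "u \<in> Q" using vw by (auto simp: Q_def)
  qed (use Q'(2) in blast)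
  moreover have "card {v, w} \<le> card Q" using vQ by (intro card_mono finQ) auto
  then have "2 \<le> card Q" using vw by simp
  ultimately have "clique G j Q" by (simp add: clique_def)
  with vQ show ?thesis by blast
qed

lemma clique_unique:
  assumes adm: "admissible d q G" and j: "j \<in> {2..d}" and Q: "clique G j Q" "clique G j Q'"
    and v: "v \<in> Q" "v \<in> Q'"
  shows "Q = Q'"
proof -
  let ?R = "Id_on (verts G) \<union> edges G j"
  have eq: "equiv (verts G) ?R" by (rule admissible_equiv[OF adm j])
  have pj: "pairwise_joined G j Q" "pairwise_joined G j Q'" using Q by (auto simp: clique_def)
  have star: "(v, a) \<in> ?R" if "a \<in> Q \<union> Q'" for a
  proof (cases "a = v")
    case True
    then show ?thesis using v(1) pj(1) by (auto simp: pairwise_joined_def)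
  next
    case False
    then have "(v, a) \<in> edges G j"
      using that pairwise_joinedD[OF pj(1) v(1), of a] pairwise_joinedD[OF pj(2) v(2), of a] by auto
    then show ?thesis by simp
  qed
  have "pairwise_joined G j (Q \<union> Q')"
    unfolding pairwise_joined_def
  proof (intro conjI ballI impI)
    show "Q \<union> Q' \<subseteq> verts G" using pj by (auto simp: pairwise_joined_def)
    fix a b assume ab: "a \<in> Q \<union> Q'" "b \<in> Q \<union> Q'" "a \<noteq> b"
    have "(a, b) \<in> ?R" by (rule equiv_common_left[OF eq star[OF ab(1)] star[OF ab(2)]])
    then show "(a, b) \<in> edges G j" using ab(3) by auto
  qed
  moreover have "T = Q \<union> Q'" if "clique G j T" "T \<subseteq> Q \<union> Q'" "pairwise_joined G j (Q \<union> Q')" for T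
    using that unfolding clique_def by metis
  ultimately have "Q = Q \<union> Q'" "Q' = Q \<union> Q'" using Q by blast+
  then show ?thesis by blast
qed

lemma clique_pair:
  "clique G j Q \<Longrightarrow> v \<in> Q \<Longrightarrow> w \<in> Q \<Longrightarrow> v \<noteq> w \<Longrightarrow> (v, w) \<in> edges G j"
  by (simp add: clique_def pairwise_joined_def)

definition cliques :: "nat \<Rightarrow> colored_graph \<Rightarrow> (nat \<times> nat set) set" where
  "cliques d G = {c. fst c \<in> {2..d} \<and> clique G (fst c) (snd c)}"

lemma X_set_eq:
  assumes adm: "admissible d q G"
  shows "X_set d n I G = {r \<in> Pi\<^sub>E (verts G) (A_block d n I).
    \<forall>c\<in>cliques d G. \<forall>v\<in>snd c. \<forall>w\<in>snd c. r v (fst c) = r w (fst c)}"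
proof (intro equalityI subsetI)
  fix r assume "r \<in> X_set d n I G"
  then have r: "r \<in> Pi\<^sub>E (verts G) (A_block d n I)"
    and re: "\<And>j v w. j \<in> {2..d} \<Longrightarrow> (v, w) \<in> edges G j \<Longrightarrow> r v j = r w j"
    unfolding X_set_def by blast+
  have "r v (fst c) = r w (fst c)" if "c \<in> cliques d G" "v \<in> snd c" "w \<in> snd c" for c v w
    using that re[of "fst c" v w] clique_pair[of G "fst c" "snd c" v w]
    by (cases "v = w") (simp_all add: cliques_def)
  with r show "r \<in> {r \<in> Pi\<^sub>E (verts G) (A_block d n I).
    \<forall>c\<in>cliques d G. \<forall>v\<in>snd c. \<forall>w\<in>snd c. r v (fst c) = r w (fst c)}" by blast
next
  fix r assume "r \<in> {r \<in> Pi\<^sub>E (verts G) (A_block d n I).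
    \<forall>c\<in>cliques d G. \<forall>v\<in>snd c. \<forall>w\<in>snd c. r v (fst c) = r w (fst c)}"
  then have r: "r \<in> Pi\<^sub>E (verts G) (A_block d n I)"
    and re: "\<And>c v w. c \<in> cliques d G \<Longrightarrow> v \<in> snd c \<Longrightarrow> w \<in> snd c \<Longrightarrow> r v (fst c) = r w (fst c)"
    by blast+
  have "r v j = r w j" if j: "j \<in> {2..d}" and e: "(v, w) \<in> edges G j" for j v w
  proof -
    obtain Q where "clique G j Q" "v \<in> Q" "w \<in> Q" using edge_in_clique[OF adm j e] by blast
    then show ?thesis using re[of "(j, Q)" v w] j by (simp add: cliques_def)
  qed
  with r show "r \<in> X_set d n I G" unfolding X_set_def by blast
qed

lemma A_block_subset: "A_block d n I v \<subseteq> {1..d} \<rightarrow>\<^sub>E {..n}"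
proof
  fix r assume r: "r \<in> A_block d n I v"
  then have "(\<Sum>j\<in>{1..d}. r j) = n" "r \<in> {1..d} \<rightarrow>\<^sub>E UNIV" by (auto simp: A_block_def hyperbolic_set_def)
  moreover have "r j \<le> (\<Sum>j\<in>{1..d}. r j)" if "j \<in> {1..d}" for j
    by (rule member_le_sum[OF that]) auto
  ultimately show "r \<in> {1..d} \<rightarrow>\<^sub>E {..n}" by (simp add: PiE_iff)
qed

lemma clique_system_graph:
  assumes d: "1 \<le> d" and adm: "admissible d q G" and div: "equal_division n q I"
  shows "clique_system (grid d n) (flip_digit d n) d n (grid_layer d n \<alpha>) (verts G) (cliques d G) (A_block d n I)"
proof -
  interpret haar_family "grid d n" "flip_digit d n" "{1..d}" n "grid_layer d n \<alpha>"
    by (rule haar_family_grid)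
  have V: "verts G \<subseteq> {1..q}" by (rule admissible_verts[OF adm])
  show ?thesis
  proof
    show "finite (verts G)" using V finite_subset by blast
    show "snd c \<subseteq> verts G" "2 \<le> card (snd c)" "fst c \<in> {2..d}" if "c \<in> cliques d G" for c
      using that by (auto simp: cliques_def clique_def pairwise_joined_def)
    show "c = c'" if "c \<in> cliques d G" "c' \<in> cliques d G" "fst c = fst c'" "v \<in> snd c" "v \<in> snd c'" for c c' v
      using that clique_unique[OF adm, of "fst c" "snd c" "snd c'" v] by (auto simp: cliques_def prod_eq_iff)
    show "\<exists>c\<in>cliques d G. v \<in> snd c" if v: "v \<in> verts G" for v
    proof -
      obtain j Q where "j \<in> {2..d}" "clique G j Q" "v \<in> Q" using adm v unfolding admissible_def by blast
      then show ?thesis by (intro bexI[of _ "(j, Q)"]) (auto simp: cliques_def)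
    qed
    show "A_block d n I v \<subseteq> box" for v unfolding box_def by (rule A_block_subset)
    show "(\<Sum>j\<in>{1..d}. r j) = n" if "r \<in> A_block d n I v" for r v
      using that by (auto simp: A_block_def hyperbolic_set_def)
    show "r 1 < s 1" if "v \<in> verts G" "w \<in> verts G" "v < w" "r \<in> A_block d n I v" "s \<in> A_block d n I w" for v w r s
    proof -
      have "v \<in> {1..q}" "w \<in> {1..q}" "r 1 \<in> I v" "s 1 \<in> I w" using that V by (auto simp: A_block_def)
      then show ?thesis using div that(3) unfolding equal_division_def by blast
    qed
  qed (use d in auto)
qed

lemma Lp_norm_cube_const:
  assumes p: "0 < p" shows "Lp_norm_cube d p (\<lambda>_. c) = \<bar>c\<bar>"
proof -
  interpret product_sigma_finite "\<lambda>_::nat. lborel :: real measure"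
    by standard
  let ?M = "\<Pi>\<^sub>M j\<in>{1..d}. (lborel :: real measure)"
  let ?Q = "{1..d} \<rightarrow>\<^sub>E {0..1::real}"
  have Q: "?Q \<in> sets ?M" by (intro sets_PiM_I_finite) auto
  have "emeasure ?M ?Q = (\<Prod>j\<in>{1..d}. emeasure lborel {0..1::real})" by (intro emeasure_PiM) auto
  also have "\<dots> = 1" by simp
  finally have "measure ?M ?Q = 1" by (simp add: measure_def)
  then have "set_lebesgue_integral ?M ?Q (\<lambda>_. \<bar>c\<bar> powr p) = \<bar>c\<bar> powr p"
    unfolding set_lebesgue_integral_def using Q
    by (simp only: real_scaleR_def integral_mult_left_zero Bochner_Integration.integral_indicator sets.Int_space_eq2 mult_1)
  then show ?thesis using p unfolding Lp_norm_cube_def by (simp add: powr_powr)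
qed

lemma Lp_norm_SumProd_empty:
  assumes p: "0 < p" and V: "verts G = {}"
  shows "Lp_norm_cube d p (SumProd d \<alpha> (verts G) (X_set d n I G)) \<le> 1"
proof -
  have sub: "X_set d n I G \<subseteq> {\<lambda>_. undefined}" by (auto simp: X_set_def V)
  have "card (X_set d n I G) \<le> card {\<lambda>_::nat. undefined :: nat \<Rightarrow> nat}" by (rule card_mono[OF _ sub]) simp
  moreover have "SumProd d \<alpha> (verts G) (X_set d n I G) = (\<lambda>_. real (card (X_set d n I G)))"
    by (rule ext) (simp add: SumProd_def V)
  ultimately show ?thesis using Lp_norm_cube_const[OF p] by simp
qed

lemma Lp_norm_SumProd_le:
  fixes p :: real
  assumes d: "1 \<le> d" and adm: "admissible d q G" and div: "equal_division n q I"
    and V: "verts G \<noteq> {}" and p: "0 < p" "p \<le> 2 * real m"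
  shows "Lp_norm_cube d p (SumProd d \<alpha> (verts G) (X_set d n I G)) \<le>
    (2 * 5 ^ d * (16 * (2 * real m * real (card (verts G))) ^ 3) ^ Suc d *
      real (Suc n) powr ((real d - 1) / 2 - (1/2) ^ d / (8 * real d))) ^ card (verts G)"
proof (rule Lp_norm_cube_le)
  interpret clique_system "grid d n" "flip_digit d n" d n "grid_layer d n \<alpha>" "verts G" "cliques d G" "A_block d n I"
    by (rule clique_system_graph[OF d adm div])
  let ?\<Psi> = "\<lambda>k. \<Sum>r\<in>X_set d n I G. \<Prod>v\<in>verts G. grid_layer d n \<alpha> (r v) k"
  have rv: "r v j \<le> n" if "r \<in> X_set d n I G" "v \<in> verts G" "j \<in> {1..d}" for r v j
  proof -
    have "r v \<in> A_block d n I v" using that by (auto simp: X_set_def)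
    then show ?thesis using A_block_subset that(3) by (auto simp: PiE_iff subset_iff)
  qed
  show "SumProd d \<alpha> (verts G) (X_set d n I G) x = ?\<Psi> (digits d n x)" if "x \<in> {1..d} \<rightarrow>\<^sub>E {0..<1}" for x
    unfolding SumProd_def using that rv
    by (intro sum.cong prod.cong refl f_layer_eq_grid_layer) (auto simp: PiE_iff)
  show "SumProd d \<alpha> (verts G) (X_set d n I G) x = 0"
    if x: "x \<in> {1..d} \<rightarrow>\<^sub>E {0..1}" "x \<notin> {1..d} \<rightarrow>\<^sub>E {0..<1}" for x
  proof -
    obtain j where j: "j \<in> {1..d}" "x j = 1" using x by (force simp: PiE_iff)
    obtain v where v: "v \<in> verts G" using V by blast
    show ?thesis unfolding SumProd_def
      using v by (intro sum.neutral ballI prod_zero finite_V bexI[of _ v] f_layer_boundary[of j d x] j)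
  qed
  show "0 < p" "p \<le> real (2 * m)" using p by auto
  have m: "1 \<le> m" using p by (cases m) auto
  have "bnd (grid d n) (2*m) ?\<Psi> (pair_const (2*m*card (verts G)) ^ card (verts G) *
      real (Suc n) powr (((real d - 1) / 2 - (1/2) ^ d / (8 * real d)) * real (card (verts G))))"
    using bnd_sum_prod_gain[OF m V] unfolding X_def X_set_eq[OF adm] .
  moreover have "pair_const (2*m*card (verts G)) = 2 * 5 ^ d * (16 * (2 * real m * real (card (verts G))) ^ 3) ^ Suc d"
    unfolding pair_const_def B_def by simp
  moreover have "real (Suc n) powr (((real d - 1) / 2 - (1/2) ^ d / (8 * real d)) * real (card (verts G)))
      = (real (Suc n) powr ((real d - 1) / 2 - (1/2) ^ d / (8 * real d))) ^ card (verts G)"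
    unfolding powr_powr[symmetric] by (rule powr_realpow) simp
  ultimately show "bnd (grid d n) (2*m) ?\<Psi>
    ((2 * 5 ^ d * (16 * (2 * real m * real (card (verts G))) ^ 3) ^ Suc d *
      real (Suc n) powr ((real d - 1) / 2 - (1/2) ^ d / (8 * real d))) ^ card (verts G))"
    by (simp only: power_mult_distrib)
qed

theorem theorem8p3:
  fixes d :: nat
  assumes "3 \<le> d"
  shows "\<exists>C0 C1 C2 C3 \<eta> :: real.
    0 < C0 \<and> 0 < C1 \<and> 0 < C2 \<and> 0 < C3 \<and> 0 < \<eta> \<and>
    (\<forall>(\<epsilon>::real) (a::real) (n::nat) (q::nat) (I :: nat \<Rightarrow> nat set)
        (\<alpha> :: (nat \<Rightarrow> real set) \<Rightarrow> real) (G :: colored_graph) (p::real).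
       0 < \<epsilon> \<and> \<epsilon> < 1 \<and> 0 < a \<and> q = q_param a \<epsilon> n \<and> 1 \<le> q \<and>
       equal_division n q I \<and> admissible d q G \<and> 2 < p \<longrightarrow>
       rho d n q ^ card (verts G) * Lp_norm_cube d p (SumProd d \<alpha> (verts G) (X_set d n I G))
         \<le> (C0 * real (card (verts G)) powr C1 * p powr C2 * real q powr C3 * real n powr (- \<eta>))
             ^ card (verts G))"
proof -
  define \<eta> :: real where "\<eta> = (1/2) ^ d / (8 * real d)"
  define e where "e = (real d - 1) / 2 - \<eta>"
  define C0 :: real where "C0 = 2 powr e * (2 * 5 ^ d * 128 ^ Suc d)"
  define k :: real where "k = real (3 * Suc d)"
  have d1: "1 \<le> d" using assms by simp
  have \<eta>: "0 < \<eta>" using assms by (simp add: \<eta>_def)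
  have "(1/2::real) ^ d \<le> 1" by (simp add: power_le_one)
  then have "\<eta> \<le> 1" using assms by (simp add: \<eta>_def divide_le_eq)
  then have e0: "0 \<le> e" using assms by (simp add: e_def)
  show ?thesis
  proof (rule exI[of _ C0], rule exI[of _ k], rule exI[of _ k], rule exI[of _ "1/2"], rule exI[of _ \<eta>],
      intro conjI allI impI)
    fix \<epsilon> a :: real and n q :: nat and I :: "nat \<Rightarrow> nat set"
      and \<alpha> :: "(nat \<Rightarrow> real set) \<Rightarrow> real" and G :: colored_graph and p :: real
    assume A: "0 < \<epsilon> \<and> \<epsilon> < 1 \<and> 0 < a \<and> q = q_param a \<epsilon> n \<and> 1 \<le> q \<and>
       equal_division n q I \<and> admissible d q G \<and> 2 < p"
    then have adm: "admissible d q G" and div: "equal_division n q I" and p: "2 < p" by auto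
    have n: "1 \<le> n" using A by (cases n) (auto simp: q_param_def)
    let ?N = "card (verts G)"
    show "rho d n q ^ ?N * Lp_norm_cube d p (SumProd d \<alpha> (verts G) (X_set d n I G))
         \<le> (C0 * real ?N powr k * p powr k * real q powr (1/2) * real n powr (- \<eta>)) ^ ?N"
    proof (cases "verts G = {}")
      case True
      then show ?thesis using Lp_norm_SumProd_empty[of p G d \<alpha> n I] p by simp
    next
      case False
      have "finite (verts G)"
        by (rule finite_subset[OF admissible_verts[OF adm]]) simp
      then have N: "0 < real ?N" using False by (simp add: card_gt_0_iff)
      define m where "m = nat \<lceil>p / 2\<rceil>"
      have m: "p \<le> 2 * real m" "real m \<le> p" using p unfolding m_def by linarith+
      define K where "K = 2 * 5 ^ d * (16 * (2 * real m * real ?N) ^ 3) ^ Suc d"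
      have K0: "0 \<le> K" by (simp add: K_def)
      have "K \<le> 2 * 5 ^ d * (16 * (2 * p * real ?N) ^ 3) ^ Suc d"
        unfolding K_def using m p by (intro mult_left_mono power_mono mult_right_mono) auto
      also have "\<dots> = 2 * 5 ^ d * 128 ^ Suc d * (real ?N powr k * p powr k)"
      proof -
        have "real ?N powr k = (real ?N ^ 3) ^ Suc d" "p powr k = (p ^ 3) ^ Suc d"
          using N p unfolding k_def by (simp_all only: powr_realpow power_mult)
        then show ?thesis by (simp add: power_mult_distrib)
      qed
      finally have K: "K \<le> 2 * 5 ^ d * 128 ^ Suc d * (real ?N powr k * p powr k)" .
      have L: "real (Suc n) powr e \<le> 2 powr e * real n powr e"
      proof -
        have "real (Suc n) powr e \<le> (2 * real n) powr e" using n e0 by (intro powr_mono2) auto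
        then show ?thesis using n by (simp add: powr_mult)
      qed
      have rho0: "0 \<le> rho d n q" by (simp add: rho_def)
      have "rho d n q * (K * real (Suc n) powr e)
          \<le> rho d n q * ((2 * 5 ^ d * 128 ^ Suc d * (real ?N powr k * p powr k)) * (2 powr e * real n powr e))"
        using K L K0 rho0 by (intro mult_left_mono mult_mono) auto
      also have "\<dots> = C0 * real ?N powr k * p powr k * real q powr (1/2) * (real n powr (- (real d - 1) / 2) * real n powr e)"
        by (simp add: rho_def C0_def powr_half_sqrt algebra_simps)
      also have "real n powr (- (real d - 1) / 2) * real n powr e = real n powr (- \<eta>)"
      proof -
        have "- (real d - 1) / 2 + e = - \<eta>" by (simp add: e_def field_simps)
        then show ?thesis by (simp only: powr_add[symmetric])
      qed
      finally have base: "rho d n q * (K * real (Suc n) powr e)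
          \<le> C0 * real ?N powr k * p powr k * real q powr (1/2) * real n powr (- \<eta>)" .
      have "rho d n q ^ ?N * Lp_norm_cube d p (SumProd d \<alpha> (verts G) (X_set d n I G))
          \<le> rho d n q ^ ?N * (K * real (Suc n) powr e) ^ ?N"
        using Lp_norm_SumProd_le[OF d1 adm div False _ m(1), of \<alpha>] p rho0
        by (intro mult_left_mono) (simp_all add: K_def e_def \<eta>_def)
      also have "\<dots> = (rho d n q * (K * real (Suc n) powr e)) ^ ?N" by (simp only: power_mult_distrib)
      also have "\<dots> \<le> (C0 * real ?N powr k * p powr k * real q powr (1/2) * real n powr (- \<eta>)) ^ ?N"
        using rho0 K0 by (intro power_mono base) auto
      finally show ?thesis .
    qed
  qed (use \<eta> in \<open>auto simp: C0_def k_def\<close>)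
qed

end
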